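(* In the setting of the context, for all $v\in\mathcal V^0_*$ and $w_h\in\mathcal V^0$ it holds that $$|a_h^{DoD}(v,w_h)|\le\|v\|_{\mathrm{uwb},*}\,|w_h|_\beta .$$
   Context: **Geometry.** Let $L>0$, $0<x_0<L$, $0<\gamma<\pi/2$ with $(L-x_0)\tan\gamma<L$, and $\Omega=\{(x,y)\in(0,L)^2:\ y>(x-x_0)\tan\gamma\}$: a square from which a ramp of angle $\gamma$ is cut out; the ramp is the part of $\partial\Omega$ on the line $y=(x-x_0)\tan\gamma$. **Mesh.** The square is divided into a Cartesian background mesh of square cells $\widehat E$ of side length $h$; $\mathcal T_h$ is the set of all non-degenerate $E=\widehat E\cap\Omega$. The faces of a cell are its edges; $\mathcal F_i$ = interior faces (shared by two cells), $\mathcal F_b$ = faces on $\partial\Omega$, $\mathcal F=\mathcal F_i\cup\mathcal F_b$. $n_E$ is the outer unit normal of $E$; $|E|$ area, $|e|$ length. **Velocity.** $\beta:\overline\Omega\to\mathbb R^2$ is Lipschitz continuous, $\nabla\cdot\beta=0$, $\beta\cdot n=0$ along the ramp, $\beta$ does not vanish on the ramp, and the sign of $\beta\cdot n$ is constant along each face of the mesh. **Stabilized cut cells.** A triangular cut cell $E\in\mathcal T_h$ has a hypotenuse $e_{bdy}$ on the ramp, one inflow face $e_{in}=e_{in}(E)$ ($\beta\cdot n_E<0$) with neighbor $E_{in}$, and one outflow face $e_{out}=e_{out}(E)$ ($\beta\cdot n_E>0$) with neighbor $E_{out}$. $\mathcal I$ is the set of triangular cut cells with $\max(|e_{in}|,|e_{out}|)<\tfrac12h$;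 for $E\in\mathcal I$, $e_{in},e_{out}\notin\mathcal F_b$. $\mathcal F_{\setminus o}$ = faces that are not outflow faces $e_{out}$ of cells in $\mathcal I$; $\mathcal F_{\setminus io}$ = faces that are neither $e_{in}$ nor $e_{out}$ of cells in $\mathcal I$. With a fixed $\tau>0$, the capacity is $\alpha_E=\min\big(\frac{|E|}{\tau h\int_{e_{in}}|\beta\cdot n|},1\big)$. **Spaces, means, jumps.** $\mathcal V^0$ = functions in $L^2(\Omega)$ constant on each $E\in\mathcal T_h$; $\mathcal V^0_*=H^1(\Omega)+\mathcal V^0$. For $v\in\mathcal V^0_*$, a cell $E$ and a face $e\subset\partial E$, the $\beta$-weighted mean $\bar v_{E,e}\in\mathbb R$ is defined by $\bar v_{E,e}\int_e|\beta\cdot n|\,ds=\int_e|\beta\cdot n|\,\mathrm{tr}(v|_E)\,ds$ (irrelevant, say $0$, where $\beta\cdot n\equiv0$ on $e$). On an interior face $e$ between $E_1,E_2$: $[\![\bar v]\!]=\bar v_{E_1,e}n_{E_1}+\bar v_{E_2,e}n_{E_2}$, and $\bar v^\uparrow$ is the mean $\bar v_{E_i,e}$ from the upwind cell, i.e. the $E_i$ with $\beta\cdot n_{E_i}>0$. On a boundary face of $E$: $[\![\bar v]\!]=\bar v_{E,e}n_E$, and $\bar v^\uparrow=\bar v_{E,e}$ if $\beta\cdot n_E>0$, $\bar v^\uparrow=0$ otherwise. $[\![\bar v]\!]^2=[\![\bar v]\!]\cdot[\![\bar v]\!]$. For $E\in\mathcal I$: $\bar v_{in}=\bar v_{E_{in},e_{in}}$,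 $\bar v_{out}=\bar v_{E_{out},e_{out}}$. **Bilinear form.** For $v\in\mathcal V^0_*$, $w_h\in\mathcal V^0$, $$a_h^{DoD}(v,w_h)=\sum_{e\in\mathcal F_{\setminus o}}\int_e\bar v^\uparrow\,\beta\cdot[\![\bar w_h]\!]+\sum_{E\in\mathcal I}\int_{e_{out}(E)}\big(\alpha_E\bar v^\uparrow+(1-\alpha_E)\bar v_{in}\big)\beta\cdot[\![\bar w_h]\!].$$ **Norms.** For $v\in\mathcal V^0_*$, $$|v|_\beta^2=\sum_{e\in\mathcal F_{\setminus io}}\int_e|\beta\cdot n|[\![\bar v]\!]^2+\sum_{E\in\mathcal I}\Big(\alpha_E\sum_{e\in\{e_{in}(E),e_{out}(E)\}}\int_e|\beta\cdot n|[\![\bar v]\!]^2+(1-\alpha_E)\int_{e_{out}(E)}|\beta\cdot n|(\bar v_{out}-\bar v_{in})^2\Big),$$ $$\|v\|_{\mathrm{uwb},*}^2=\|v\|_{L^2(\Omega)}^2+|v|_\beta^2+\sum_{E\notin\mathcal I}\big\||\beta\cdot n|^{1/2}\bar v\big\|_{L^2(\partial E)}^2+\sum_{E\in\mathcal I}\alpha_E\big\||\beta\cdot n|^{1/2}\bar v\big\|_{L^2(\partial E)}^2,$$ where on a face $e\subset\partial E$ the $\bar v$ in the last two sums is $\bar v_{E,e}$. *)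

theory Defs
  imports "HOL-Analysis.Analysis"
begin

section \<open>Sobolev functions and traces\<close>

primrec C_k :: "nat \<Rightarrow> ('a::euclidean_space \<Rightarrow> real) \<Rightarrow> bool" where
  "C_k 0 f \<longleftrightarrow> continuous_on UNIV f"
| "C_k (Suc k) f \<longleftrightarrow> (\<exists>g. (\<forall>x. GDERIV f x :> g x) \<and> (\<forall>b\<in>Basis. C_k k (\<lambda>x. g x \<bullet> b)))"

definition smooth :: "('a::euclidean_space \<Rightarrow> real) \<Rightarrow> bool" where
  "smooth f \<longleftrightarrow> (\<forall>k. C_k k f)"

definition test_function :: "'a::euclidean_space set \<Rightarrow> ('a \<Rightarrow> real) \<Rightarrow> bool" where
  "test_function U \<phi> \<longleftrightarrow> smooth \<phi> \<and> compact (closure {x. \<phi> x \<noteq> 0}) \<and> closure {x. \<phi> x \<noteq> 0} \<subseteq> U"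

definition L2 :: "'a measure \<Rightarrow> ('a \<Rightarrow> 'b::euclidean_space) set" where
  "L2 M = {f \<in> borel_measurable M. integrable M (\<lambda>x. (norm (f x))\<^sup>2)}"

definition weak_gradient ::
  "'a::euclidean_space set \<Rightarrow> ('a \<Rightarrow> real) \<Rightarrow> ('a \<Rightarrow> 'a) \<Rightarrow> bool" where
  "weak_gradient U u G \<longleftrightarrow>
     (\<forall>\<phi> g. test_function U \<phi> \<and> (\<forall>x. GDERIV \<phi> x :> g x) \<longrightarrow>
        (LINT x|lebesgue_on U. u x *\<^sub>R g x) = - (LINT x|lebesgue_on U. \<phi> x *\<^sub>R G x))"

definition H1 :: "'a::euclidean_space set \<Rightarrow> ('a \<Rightarrow> real) set" where
  "H1 U = {u \<in> L2 (lebesgue_on U). \<exists>G \<in> L2 (lebesgue_on U). weak_gradient U u G}"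

text \<open>The arc length measure on a segment, as the image of Lebesgue measure under a unit speed
  parametrization; it does not depend on the orientation chosen. Its measurable space is the
  segment itself, so that integrands only matter (and need only be measurable) there.\<close>

definition arclength :: "'a::euclidean_space set \<Rightarrow> 'a measure" where
  "arclength e =
     (let (a, b) = (SOME (a, b). e = closed_segment a b)
      in distr (lebesgue_on {0..dist a b}) (restrict_space borel e) (\<lambda>t. a + t *\<^sub>R sgn (b - a)))"

text \<open>\<open>g\<close> is the trace on \<open>e\<close> of \<open>u \<in> H1 U\<close>: the trace operator is the continuous extension of
  the restriction map from functions smooth up to the boundary, so its values are the limits in
  \<open>L2\<close> of the restrictions \<open>\<phi> n\<close> to \<open>e\<close>, where \<open>\<phi> n\<close> tends to \<open>u\<close> in \<open>H1 U\<close>.\<close>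

definition is_trace ::
  "'a::euclidean_space set \<Rightarrow> 'a set \<Rightarrow> ('a \<Rightarrow> real) \<Rightarrow> ('a \<Rightarrow> real) \<Rightarrow> bool" where
  "is_trace U e u g \<longleftrightarrow>
     u \<in> L2 (lebesgue_on U) \<and> g \<in> L2 (arclength e) \<and>
     (\<exists>G \<in> L2 (lebesgue_on U). weak_gradient U u G \<and>
       (\<exists>\<phi> \<psi>. (\<forall>n. smooth (\<phi> n)) \<and> (\<forall>n x. GDERIV (\<phi> n) x :> \<psi> n x) \<and>
          (\<lambda>n. LINT x|lebesgue_on U. (\<phi> n x - u x)\<^sup>2) \<longlonglongrightarrow> 0 \<and>
          (\<lambda>n. LINT x|lebesgue_on U. (norm (\<psi> n x - G x))\<^sup>2) \<longlonglongrightarrow> 0 \<and>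
          (\<lambda>n. LINT x|arclength e. (\<phi> n x - g x)\<^sup>2) \<longlonglongrightarrow> 0))"

definition trace :: "'a::euclidean_space set \<Rightarrow> 'a set \<Rightarrow> ('a \<Rightarrow> real) \<Rightarrow> 'a \<Rightarrow> real" where
  "trace U e u = (SOME g. is_trace U e u g)"


section \<open>Ramp domain, cut cell mesh and DoD stabilization\<close>

definition faces :: "(real \<times> real) set \<Rightarrow> (real \<times> real) set set" where
  "faces E = {e. e edge_of closure E}"

text \<open>Well defined because cells are convex with nonempty interior.\<close>

definition outer_normal :: "(real \<times> real) set \<Rightarrow> (real \<times> real) set \<Rightarrow> real \<times> real" where
  "outer_normal E e =
     (THE n. norm n = 1 \<and> (\<exists>c. (\<forall>p\<in>E. n \<bullet> p \<le> c) \<and> (\<forall>p\<in>e. n \<bullet> p = c)))"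

definition face_length :: "(real \<times> real) set \<Rightarrow> real" where
  "face_length e = measure (arclength e) e"

text \<open>Divergence of a Lipschitz field, understood almost everywhere.\<close>

definition divergence_free_on ::
  "(real \<times> real) set \<Rightarrow> (real \<times> real \<Rightarrow> real \<times> real) \<Rightarrow> bool" where
  "divergence_free_on U \<beta> \<longleftrightarrow>
     (AE p in lborel. p \<in> U \<longrightarrow>
        (\<exists>D. (\<beta> has_derivative D) (at p) \<and> (\<Sum>b\<in>Basis. D b \<bullet> b) = 0))"

context
  fixes L x0 \<gamma> h :: real
    and \<beta> :: "real \<times> real \<Rightarrow> real \<times> real"
    and \<tau> :: real
begin

definition \<Omega> :: "(real \<times> real) set" where
  "\<Omega> = {(x, y). 0 < x \<and> x < L \<and> 0 < y \<and> y < L \<and> y > (x - x0) * tan \<gamma>}"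

definition ramp :: "(real \<times> real) set" where
  "ramp = frontier \<Omega> \<inter> {(x, y). y = (x - x0) * tan \<gamma>}"

definition background_cells :: "(real \<times> real) set set" where
  "background_cells =
     {Q. \<exists>i j :: nat. Q = box (real i * h, real j * h) (real (Suc i) * h, real (Suc j) * h)
            \<and> Q \<subseteq> box (0, 0) (L, L)}"

text \<open>The intersection of open sets is degenerate only if it is empty.\<close>

definition mesh :: "(real \<times> real) set set" where
  "mesh = {E. E \<noteq> {} \<and> (\<exists>Q \<in> background_cells. E = Q \<inter> \<Omega>)}"

definition interior_faces :: "(real \<times> real) set set" where
  "interior_faces = {e. \<exists>E1 \<in> mesh. \<exists>E2 \<in> mesh. E1 \<noteq> E2 \<and> e \<in> faces E1 \<and> e \<in> faces E2}"

definition boundary_faces :: "(real \<times> real) set set" where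
  "boundary_faces = {e. e \<subseteq> frontier \<Omega> \<and> (\<exists>E \<in> mesh. e \<in> faces E)}"

definition all_faces :: "(real \<times> real) set set" where
  "all_faces = interior_faces \<union> boundary_faces"

text \<open>The end points of a face are exempt from the sign conditions.\<close>

definition constant_sign_on_faces :: bool where
  "constant_sign_on_faces \<longleftrightarrow>
     (\<forall>E \<in> mesh. \<forall>e \<in> faces E. \<exists>s. \<forall>p \<in> rel_interior e. sgn (\<beta> p \<bullet> outer_normal E e) = s)"

definition inflow :: "(real \<times> real) set \<Rightarrow> (real \<times> real) set \<Rightarrow> bool" where
  "inflow E e \<longleftrightarrow> (\<forall>p \<in> rel_interior e. \<beta> p \<bullet> outer_normal E e < 0)"

definition outflow :: "(real \<times> real) set \<Rightarrow> (real \<times> real) set \<Rightarrow> bool" where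
  "outflow E e \<longleftrightarrow> (\<forall>p \<in> rel_interior e. \<beta> p \<bullet> outer_normal E e > 0)"

definition e_in :: "(real \<times> real) set \<Rightarrow> (real \<times> real) set" where
  "e_in E = (THE e. e \<in> faces E \<and> inflow E e)"

definition e_out :: "(real \<times> real) set \<Rightarrow> (real \<times> real) set" where
  "e_out E = (THE e. e \<in> faces E \<and> outflow E e)"

definition neighbor :: "(real \<times> real) set \<Rightarrow> (real \<times> real) set \<Rightarrow> (real \<times> real) set" where
  "neighbor E e = (THE E'. E' \<in> mesh \<and> E' \<noteq> E \<and> e \<in> faces E')"

text \<open>Every triangular cell is a cut cell with its hypotenuse on the ramp.\<close>

definition stabilized_cells :: "(real \<times> real) set set" where
  "stabilized_cells =
     {E \<in> mesh. 2 simplex (closure E) \<and> max (face_length (e_in E)) (face_length (e_out E)) < h / 2}"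

definition faces_not_out :: "(real \<times> real) set set" where
  "faces_not_out = all_faces - e_out ` stabilized_cells"

definition faces_not_in_out :: "(real \<times> real) set set" where
  "faces_not_in_out = all_faces - (e_in ` stabilized_cells \<union> e_out ` stabilized_cells)"

text \<open>On a face \<open>e\<close> of \<open>E\<close>, the weight \<open>\<bar>\<beta> \<bullet> n\<bar>\<close> does not depend on the side of \<open>e\<close> from which the
  normal is taken.\<close>

definition flux_weight :: "(real \<times> real) set \<Rightarrow> (real \<times> real) set \<Rightarrow> real \<times> real \<Rightarrow> real" where
  "flux_weight E e p = \<bar>\<beta> p \<bullet> outer_normal E e\<bar>"

definition face_cells :: "(real \<times> real) set \<Rightarrow> (real \<times> real) set set" where
  "face_cells e = {E \<in> mesh. e \<in> faces E}"

definition face_weight :: "(real \<times> real) set \<Rightarrow> real \<times> real \<Rightarrow> real" where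
  "face_weight e = flux_weight (SOME E. E \<in> face_cells e) e"

definition capacity :: "(real \<times> real) set \<Rightarrow> real" where
  "capacity E =
     min (measure lborel E / (\<tau> * h * (LINT p|arclength (e_in E). face_weight (e_in E) p))) 1"

definition V0 :: "(real \<times> real \<Rightarrow> real) set" where
  "V0 = {w \<in> L2 (lebesgue_on \<Omega>). \<forall>E \<in> mesh. \<exists>c. AE p in lebesgue_on E. w p = c}"

definition V_star :: "(real \<times> real \<Rightarrow> real) set" where
  "V_star = {v. \<exists>u \<in> H1 \<Omega>. \<exists>w \<in> V0. v = (\<lambda>p. u p + w p)}"

text \<open>If \<open>\<beta> \<bullet> n\<close> vanishes on \<open>e\<close>, the mean is \<open>0\<close> by \<open>x / 0 = 0\<close>.\<close>

definition wmean ::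
  "(real \<times> real \<Rightarrow> real) \<Rightarrow> (real \<times> real) set \<Rightarrow> (real \<times> real) set \<Rightarrow> real" where
  "wmean v E e =
     (LINT p|arclength e. flux_weight E e p * trace E e v p) / (LINT p|arclength e. flux_weight E e p)"

text \<open>An interior face has two adjacent cells and a boundary face has one.\<close>

definition jump :: "(real \<times> real \<Rightarrow> real) \<Rightarrow> (real \<times> real) set \<Rightarrow> real \<times> real" where
  "jump v e = (\<Sum>E \<in> face_cells e. wmean v E e *\<^sub>R outer_normal E e)"

definition upwind :: "(real \<times> real \<Rightarrow> real) \<Rightarrow> (real \<times> real) set \<Rightarrow> real" where
  "upwind v e =
     (if \<exists>E \<in> face_cells e. outflow E e
      then wmean v (THE E. E \<in> face_cells e \<and> outflow E e) e else 0)"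

definition mean_in :: "(real \<times> real \<Rightarrow> real) \<Rightarrow> (real \<times> real) set \<Rightarrow> real" where
  "mean_in v E = wmean v (neighbor E (e_in E)) (e_in E)"

definition mean_out :: "(real \<times> real \<Rightarrow> real) \<Rightarrow> (real \<times> real) set \<Rightarrow> real" where
  "mean_out v E = wmean v (neighbor E (e_out E)) (e_out E)"

definition a_DoD :: "(real \<times> real \<Rightarrow> real) \<Rightarrow> (real \<times> real \<Rightarrow> real) \<Rightarrow> real" where
  "a_DoD v w =
     (\<Sum>e \<in> faces_not_out. LINT p|arclength e. upwind v e * (\<beta> p \<bullet> jump w e)) +
     (\<Sum>E \<in> stabilized_cells. LINT p|arclength (e_out E).
        (capacity E * upwind v (e_out E) + (1 - capacity E) * mean_in v E) * (\<beta> p \<bullet> jump w (e_out E)))"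

definition beta_seminorm :: "(real \<times> real \<Rightarrow> real) \<Rightarrow> real" where
  "beta_seminorm v = sqrt (
     (\<Sum>e \<in> faces_not_in_out. LINT p|arclength e. face_weight e p * (jump v e \<bullet> jump v e)) +
     (\<Sum>E \<in> stabilized_cells.
        capacity E *
          (\<Sum>e \<in> {e_in E, e_out E}. LINT p|arclength e. face_weight e p * (jump v e \<bullet> jump v e)) +
        (1 - capacity E) *
          (LINT p|arclength (e_out E). face_weight (e_out E) p * (mean_out v E - mean_in v E)\<^sup>2)))"

definition boundary_norm_sq :: "(real \<times> real \<Rightarrow> real) \<Rightarrow> (real \<times> real) set \<Rightarrow> real" where
  "boundary_norm_sq v E =
     (\<Sum>e \<in> faces E. LINT p|arclength e. (sqrt (flux_weight E e p) * wmean v E e)\<^sup>2)"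

definition uwb_star_norm :: "(real \<times> real \<Rightarrow> real) \<Rightarrow> real" where
  "uwb_star_norm v = sqrt (
     (LINT p|lebesgue_on \<Omega>. (v p)\<^sup>2) + (beta_seminorm v)\<^sup>2 +
     (\<Sum>E \<in> mesh - stabilized_cells. boundary_norm_sq v E) +
     (\<Sum>E \<in> stabilized_cells. capacity E * boundary_norm_sq v E))"

end

end

theory Submission
  imports Defs
begin

text \<open>Only the weighted means of \<open>v\<close> and \<open>w\<close> enter the estimate, which is a weighted Cauchy-Schwarz inequality,
  face by face on the unstabilized faces and cell by cell on the stabilized ones. On a stabilized cell
  the inflow and outflow fluxes agree, because \<open>\<beta>\<close> is divergence free and tangential to the ramp, and
  the two means of the piecewise constant function \<open>w\<close> from inside the cell agree. With \<open>F\<close> the common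
  flux and \<open>\<alpha>\<close> the capacity, the two face terms of the cell therefore combine to
  \<open>F (\<alpha> v\<^sub>i\<^sub>n (w\<^sub>i\<^sub>n - w\<^sub>E) + \<alpha> v\<^sub>E (w\<^sub>E - w\<^sub>o\<^sub>u\<^sub>t) + (1 - \<alpha>) v\<^sub>i\<^sub>n (w\<^sub>i\<^sub>n - w\<^sub>o\<^sub>u\<^sub>t))\<close>, which matches the
  weights of the seminorm. On the other side every upwind value is the mean on an outflow face of a
  cell that is not stabilized, or the outflow mean \<open>v\<^sub>E\<close> of a stabilized one, so each occurs once among
  the boundary terms of the norm.\<close>

section \<open>Edges and normals of planar convex sets\<close>

text \<open>The obstacle is that the definitions pick objects by \<open>THE\<close> and
  \<open>SOME\<close>: normals, inflow and outflow faces, neighbours, segment orientations, traces.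
  Most of the work shows that these picks are determined. Two points are analytic. The divergence of
  the Lipschitz field vanishes only almost everywhere, so the equality of the fluxes comes from
  difference quotients. The trace of a cellwise constant is a limit of arbitrary smooth
  approximations, so its uniqueness needs an estimate on thin wedges. The flow direction on a
  triangular cell comes from the ramp: \<open>\<beta>\<close> is tangential and nonzero there, so it
  keeps one sense along the hypotenuse, and its values at the two corners decide which of the other
  edges is the inflow face. Triangular cells have the outer normals (-1, 0) and (0, 1) on their grid
  edges. These are never opposite, so the inflow face of one stabilized cell is not the outflow face
  of another. Hence the inflow mean belongs to a cell that is not stabilized and carries full weight
  in the norm, which pays for both shares, \<alpha> and 1 - \<alpha>, in which it occurs.\<close>

lemma edges_of_triangle_meet:
  fixes S :: "'a::euclidean_space set"
  assumes "2 simplex S" "e1 edge_of S" "e2 edge_of S"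
  shows "e1 \<inter> e2 \<noteq> {}"
proof -
  obtain C where C: "\<not> affine_dependent C" "int (card C) = 3" "S = convex hull C"
    using assms(1) unfolding simplex_def by auto
  have fin: "finite C" using C aff_independent_finite by blast
  have *: "\<exists>c. c \<subseteq> C \<and> e = convex hull c \<and> card c = 2" if "e edge_of S" for e
  proof -
    from that obtain c where c: "c \<subseteq> C" "e = convex hull c"
      using C face_of_convex_hull_affine_independent unfolding edge_of_def by metis
    then have "aff_dim c = 1" using that by (auto simp: edge_of_def aff_dim_convex_hull)
    moreover have "\<not> affine_dependent c" using C c affine_independent_subset by blast
    ultimately have "card c = 2" using aff_dim_affine_independent by fastforce
    with c show ?thesis by blast
  qed
  from *[OF assms(2)] obtain c1 where c1: "c1 \<subseteq> C" "e1 = convex hull c1" "card c1 = 2" by blast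
  from *[OF assms(3)] obtain c2 where c2: "c2 \<subseteq> C" "e2 = convex hull c2" "card c2 = 2" by blast
  \<comment> \<open>Edges of a triangle are pairs of vertices; two disjoint pairs would need four
    vertices.\<close>
  have "c1 \<inter> c2 \<noteq> {}"
  proof
    assume "c1 \<inter> c2 = {}"
    then have "card (c1 \<union> c2) = 4"
      using c1 c2 fin by (subst card_Un_disjoint) (auto intro: finite_subset)
    moreover have "card (c1 \<union> c2) \<le> card C" using c1 c2 fin by (intro card_mono) auto
    ultimately show False using C(2) by simp
  qed
  then show ?thesis using c1 c2 hull_inc by (metis disjoint_iff)
qed

text \<open>For affinely independent vertices the faces of the hull are exactly the hulls of vertex
  subsets, and dimension 1 leaves the pairs.\<close>

lemma edge_of_triangle_iff:
  fixes a b c :: "'a::euclidean_space"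
  assumes "\<not> collinear {a, b, c}"
  shows "e edge_of (convex hull {a, b, c}) \<longleftrightarrow>
    e \<in> {closed_segment a b, closed_segment b c, closed_segment a c}"
proof -
  have ind: "\<not> affine_dependent {a, b, c}" and d: "a \<noteq> b" "b \<noteq> c" "a \<noteq> c"
    using assms collinear_3_eq_affine_dependent[of a b c] by auto
  have "e edge_of (convex hull {a, b, c}) \<longleftrightarrow>
      (\<exists>d. d \<subseteq> {a, b, c} \<and> e = convex hull d \<and> aff_dim d = 1)"
    unfolding edge_of_def face_of_convex_hull_affine_independent[OF ind] by (auto simp: aff_dim_convex_hull)
  also have "\<dots> \<longleftrightarrow> (\<exists>d\<in>{{a, b}, {b, c}, {a, c}}. e = convex hull d)" (is "?l \<longleftrightarrow> ?r")
  proof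
    assume ?l
    then obtain d where d': "d \<subseteq> {a, b, c}" "e = convex hull d" "aff_dim d = 1" by blast
    have "\<not> affine_dependent d" using ind d' affine_independent_subset by blast
    with d' have cd: "card d = 2" using aff_dim_affine_independent by fastforce
    have "d \<in> {{a, b}, {b, c}, {a, c}}"
    proof -
      have "d \<in> Pow {a, b, c}" using d' by blast
      then show ?thesis using cd d by (auto simp: Pow_insert)
    qed
    with d' show ?r by blast
  next
    assume ?r
    then obtain d where "d \<in> {{a, b}, {b, c}, {a, c}}" "e = convex hull d" by blast
    then show ?l using d by (intro exI[of _ d]) auto
  qed
  finally show ?thesis by (simp add: segment_convex_hull)
qed

text \<open>In the plane the vectors orthogonal to \<open>u\<close> form a line, which holds only
  two unit vectors.\<close>

lemma inner_eq_0_orthogonal_real2: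
  fixes n n' u :: "real \<times> real"
  assumes "norm n = 1" "norm n' = 1" "u \<noteq> 0" "n \<bullet> u = 0" "n' \<bullet> u = 0"
  shows "n' = n \<or> n' = - n"
proof -
  obtain n1 n2 where n: "n = (n1, n2)" by fastforce
  obtain m1 m2 where m: "n' = (m1, m2)" by fastforce
  obtain u1 u2 where u: "u = (u1, u2)" by fastforce
  have N: "n1^2 + n2^2 = 1" "m1^2 + m2^2 = 1"
    using assms(1,2) by (auto simp: n m norm_Pair)
  have U: "n1 * u1 + n2 * u2 = 0" "m1 * u1 + m2 * u2 = 0"
    using assms by (auto simp: n m u)
  have "u1 * (n1 * m2 - n2 * m1) = 0" "u2 * (n1 * m2 - n2 * m1) = 0" using U by algebra+
  then have "n1 * m2 - n2 * m1 = 0" using assms(3) by (auto simp: u zero_prod_def)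
  then have "(m1 - n1) * (m1 + n1) = 0" "(m2 - n2) * (m2 + n2) = 0" "n1 * m2 = n2 * m1"
    using N by (algebra, algebra, simp)
  then have "m1 = n1 \<or> m1 = - n1" "m2 = n2 \<or> m2 = - n2" "n1 * m2 = n2 * m1" by auto
  then show ?thesis by (elim disjE) (auto simp: n m)
qed

text \<open>Resolves the \<open>THE\<close> in \<open>outer_normal\<close>. The only rival of
  \<open>n\<close> is \<open>- n\<close>, and that one would squeeze \<open>E\<close> into a line,
  which an open nonempty set does not fit into.\<close>

lemma outer_normal_eqI:
  assumes E: "open E" "E \<noteq> {}" and ab: "a \<in> e" "b \<in> e" "a \<noteq> b"
    and n: "norm n = 1" "\<And>p. p \<in> E \<Longrightarrow> n \<bullet> p \<le> c" "\<And>p. p \<in> e \<Longrightarrow> n \<bullet> p = c"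
  shows "outer_normal E e = n"
  unfolding outer_normal_def
proof (rule the_equality)
  show "norm n = 1 \<and> (\<exists>c. (\<forall>p\<in>E. n \<bullet> p \<le> c) \<and> (\<forall>p\<in>e. n \<bullet> p = c))" using n by blast
next
  fix n' assume n': "norm n' = 1 \<and> (\<exists>c. (\<forall>p\<in>E. n' \<bullet> p \<le> c) \<and> (\<forall>p\<in>e. n' \<bullet> p = c))"
  then obtain c' where c': "\<And>p. p \<in> E \<Longrightarrow> n' \<bullet> p \<le> c'" "\<And>p. p \<in> e \<Longrightarrow> n' \<bullet> p = c'" by blast
  have "n' = n \<or> n' = - n"
    using n' n ab c' by (intro inner_eq_0_orthogonal_real2[of _ _ "b - a"]) (auto simp: inner_diff_right)
  moreover have "n' \<noteq> - n"
  proof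
    assume *: "n' = - n"
    have "c' = - c" using c'(2)[OF ab(1)] n(3)[OF ab(1)] * by simp
    then have "E \<subseteq> {p. n \<bullet> p = c}" using n c' * by fastforce
    then have "interior E \<subseteq> interior {p. n \<bullet> p = c}" using interior_mono by blast
    moreover have "n \<noteq> 0" using n(1) by auto
    ultimately show False using E by (simp add: interior_open interior_hyperplane)
  qed
  ultimately show "n' = n" by blast
qed

text \<open>Serves to show that disjoint cells lie on opposite sides of a common edge. From the
  midpoint \<open>m\<close> one moves a little towards a point of \<open>E1\<close>, from a slightly
  shifted point \<open>m'\<close> of the edge a little towards a point of \<open>E2\<close>; with
  the right shift both arrive at the same point.\<close>

lemma convex_open_same_side_meet:
  fixes n :: "real \<times> real"
  assumes E: "open E1" "convex E1" "open E2" "convex E2" "E1 \<noteq> {}" "E2 \<noteq> {}"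
    and ab: "a \<noteq> b" "closed_segment a b \<subseteq> closure E1" "closed_segment a b \<subseteq> closure E2"
    and n: "norm n = 1" "\<And>p. p \<in> E1 \<union> E2 \<Longrightarrow> n \<bullet> p \<le> c" "n \<bullet> a = c" "n \<bullet> b = c"
  shows "E1 \<inter> E2 \<noteq> {}"
proof -
  have strict: "n \<bullet> p < c" if "p \<in> F" "open F" "F \<subseteq> E1 \<union> E2" for p F
  proof -
    have "F \<subseteq> {p. n \<bullet> p \<le> c}" using that n by auto
    then have "F \<subseteq> interior {p. n \<bullet> p \<le> c}" using that interior_maximal by blast
    moreover have "n \<noteq> 0" using n(1) by auto
    ultimately show ?thesis using that by (auto simp: interior_halfspace_le)
  qed
  have into: "m + s *\<^sub>R (p - m) \<in> F" if "open F" "convex F" "p \<in> F" "m \<in> closure F" "0 < s" "s \<le> 1"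
    for m p s and F :: "(real \<times> real) set"
    using mem_interior_closure_convex_shrink[of F p m s] that
    by (simp add: interior_open algebra_simps)
  obtain p q where pq: "p \<in> E1" "q \<in> E2" using E by blast
  define m where "m = midpoint a b"
  have nm: "n \<bullet> m = c" using n by (simp add: m_def midpoint_def inner_add_right)
  have "n \<bullet> p < c" "n \<bullet> q < c" using strict[of p E1] strict[of q E2] pq E by auto
  \<comment> \<open>\<open>l\<close> is the ratio of the distances of \<open>q\<close> and
    \<open>p\<close> from the line of the edge. After scaling by it, the two displacements differ
    only by a vector \<open>r\<close> along the edge.\<close>
  define l where "l = (n \<bullet> q - c) / (n \<bullet> p - c)"
  have l: "l > 0" using \<open>n \<bullet> p < c\<close> \<open>n \<bullet> q < c\<close> by (simp add: l_def divide_neg_neg)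
  define r where "r = q - m - l *\<^sub>R (p - m)"
  have "n \<bullet> r = 0" using \<open>n \<bullet> p < c\<close>
    by (simp add: r_def inner_diff_right nm l_def)
  have "\<exists>\<mu>. r = \<mu> *\<^sub>R (b - a)"
  proof -
    define u where "u = (- snd n, fst n)"
    have par: "v = (v \<bullet> u) *\<^sub>R u" if "n \<bullet> v = 0" for v
    proof -
      obtain n1 n2 where n12: "n = (n1, n2)" by fastforce
      obtain v1 v2 where v: "v = (v1, v2)" by fastforce
      have N: "n1^2 + n2^2 = 1" using n(1) by (simp add: n12 norm_Pair)
      have U: "n1 * v1 + n2 * v2 = 0" using that by (simp add: n12 v)
      have "v1 = (- v1 * n2 + v2 * n1) * - n2" "v2 = (- v1 * n2 + v2 * n1) * n1"
        using N U by algebra+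
      then show ?thesis by (simp add: u_def v n12)
    qed
    have "b - a = ((b - a) \<bullet> u) *\<^sub>R u" using n by (intro par) (simp add: inner_diff_right)
    moreover have "(b - a) \<bullet> u \<noteq> 0" using calculation ab(1) by force
    ultimately have "u = (1 / ((b - a) \<bullet> u)) *\<^sub>R (b - a)"
      by (metis divide_inverse inverse_eq_divide real_vector_affinity_eq scale_eq_0_iff
          scaleR_left_imp_eq scaleR_one scaleR_scaleR right_inverse mult.commute)
    then show ?thesis using par[OF \<open>n \<bullet> r = 0\<close>] by (metis scaleR_scaleR)
  qed
  then obtain \<mu> where \<mu>: "r = \<mu> *\<^sub>R (b - a)" by blast
  \<comment> \<open>The first bound keeps the shift \<open>k\<close> below within half the edge
    length on either side of the midpoint, the second gives \<open>s * l \<le> 1\<close>, so that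
    neither motion overshoots its target.\<close>
  define s where "s = min (1 / (2 * (1 + \<bar>\<mu>\<bar>) * 2)) (1 / (2 * (l + 1)))"
  have s: "0 < s" "s \<le> 1 / (4 * (1 + \<bar>\<mu>\<bar>))" "s \<le> 1 / (2 * (l + 1))" using l by (auto simp: s_def)
  have s2: "s \<le> 1 / 4" "s * \<bar>\<mu>\<bar> \<le> 1 / 4" "s * l \<le> 1"
  proof -
    have "s * (4 * (1 + \<bar>\<mu>\<bar>)) \<le> 1" using s(2) by (subst (asm) pos_le_divide_eq) auto
    then have "4 * s + 4 * (s * \<bar>\<mu>\<bar>) \<le> 1" by (simp add: algebra_simps)
    moreover have "0 \<le> s * \<bar>\<mu>\<bar>" using s by simp
    ultimately show "s \<le> 1 / 4" "s * \<bar>\<mu>\<bar> \<le> 1 / 4" using s by linarith+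
    have "s * (2 * (l + 1)) \<le> 1" using s(3) l by (subst (asm) pos_le_divide_eq) auto
    then have "2 * (s * l) + 2 * s \<le> 1" by (simp add: algebra_simps)
    moreover have "0 \<le> s * l" using s l by simp
    ultimately show "s * l \<le> 1" using s by linarith
  qed
  \<comment> \<open>Solves \<open>(1 - s) * k = s * \<mu>\<close>, so that the shift of the starting
    point cancels the tangential difference \<open>r\<close> of the two motions.\<close>
  define k where "k = s * \<mu> / (1 - s)"
  define m' where "m' = m - k *\<^sub>R (b - a)"
  have k: "\<bar>k\<bar> \<le> 1 / 2"
  proof -
    have "\<bar>k\<bar> = s * \<bar>\<mu>\<bar> / (1 - s)" using s s2 by (simp add: k_def abs_mult)
    also have "\<dots> \<le> (1 / 4) / (1 / 2)" using s2 s by (intro frac_le) auto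
    finally show ?thesis by simp
  qed
  have m'_in: "m' \<in> closed_segment a b"
  proof -
    have "m' = (1 - (1/2 - k)) *\<^sub>R a + (1/2 - k) *\<^sub>R b"
      by (simp add: m'_def m_def midpoint_def algebra_simps)
    then show ?thesis unfolding in_segment using k by (intro exI[of _ "1/2 - k"]) auto
  qed
  have m_in: "m \<in> closed_segment a b" by (simp add: m_def)
  have "m' + s *\<^sub>R (q - m') = m + (s * l) *\<^sub>R (p - m)"
  proof -
    have kk: "(1 - s) * k = s * \<mu>" using s2 by (simp add: k_def)
    have "m' + s *\<^sub>R (q - m') = (1 - s) *\<^sub>R m' + s *\<^sub>R q" by (simp add: algebra_simps)
    also have "\<dots> = (1 - s) *\<^sub>R m - ((1 - s) * k) *\<^sub>R (b - a) + s *\<^sub>R q"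
      by (simp add: m'_def scaleR_diff_right)
    also have "\<dots> = (1 - s) *\<^sub>R m - s *\<^sub>R r + s *\<^sub>R q" by (simp add: kk \<mu>)
    also have "\<dots> = m + (s * l) *\<^sub>R (p - m)" by (simp add: r_def algebra_simps)
    finally show ?thesis .
  qed
  moreover have "m' + s *\<^sub>R (q - m') \<in> E2" using into[of E2 q m' s] E pq ab m'_in s s2 by auto
  moreover have "m + (s * l) *\<^sub>R (p - m) \<in> E1" using into[of E1 p m "s * l"] E pq ab m_in s s2 l by auto
  ultimately show ?thesis by auto
qed

text \<open>Faces of a polyhedron are exposed, which yields the supporting line. Its normal is
  nonzero because otherwise the edge would be all of \<open>S\<close>, which has dimension at least
  2.\<close>

lemma polytope_edge_cases:
  fixes S :: "'a::euclidean_space set"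
  assumes "polytope S" "interior S \<noteq> {}" "e edge_of S" "DIM('a) \<ge> 2"
  obtains a b n c where "a \<noteq> b" "e = closed_segment a b" "norm n = 1"
    "\<And>p. p \<in> S \<Longrightarrow> n \<bullet> p \<le> c" "\<And>p. p \<in> e \<Longrightarrow> n \<bullet> p = c"
proof -
  have e: "e face_of S" "aff_dim e = 1" using assms by (auto simp: edge_of_def)
  have pe: "polytope e" using e assms face_of_polytope_polytope by blast
  have "e \<noteq> {}" using e by auto
  then obtain a b where ab: "e = closed_segment a b"
    using compact_convex_collinear_segment[of e] pe e
    by (metis collinear_aff_dim order_refl polytope_imp_compact polytope_imp_convex)
  have "a \<noteq> b" using ab e by auto
  obtain n c where n: "S \<subseteq> {x. n \<bullet> x \<le> c}" "e = S \<inter> {x. n \<bullet> x = c}"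
    using exposed_face_of_polyhedron[of S e] e assms polytope_imp_polyhedron
    unfolding exposed_face_of_def by metis
  have "n \<noteq> 0"
  proof
    assume "n = 0"
    then have "e = S" using n \<open>e \<noteq> {}\<close> by auto
    then show False using assms e aff_dim_nonempty_interior[OF assms(2)] by simp
  qed
  show ?thesis
  proof (rule that[of a b "sgn n" "c / norm n"])
    show "norm (sgn n) = 1" using \<open>n \<noteq> 0\<close> by (simp add: norm_sgn)
    show "sgn n \<bullet> p \<le> c / norm n" if "p \<in> S" for p
      using n that \<open>n \<noteq> 0\<close> by (auto simp: sgn_div_norm divide_right_mono divide_simps)
    show "sgn n \<bullet> p = c / norm n" if "p \<in> e" for p
      using n that \<open>n \<noteq> 0\<close> by (auto simp: sgn_div_norm divide_simps)
  qed (use ab \<open>a \<noteq> b\<close> in auto)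
qed

section \<open>The divergence theorem on a triangle\<close>

text \<open>The integral of the difference quotient telescopes to the averages of \<open>f\<close>
  over two intervals of length \<open>h\<close> that start at \<open>b\<close> and \<open>a\<close>.
  Each average is within \<open>C * h\<close> of the value at its left end.\<close>

lemma lipschitz_difference_quotient_integral:
  fixes f :: "real \<Rightarrow> real"
  assumes lip: "\<And>x y. \<bar>f x - f y\<bar> \<le> C * \<bar>x - y\<bar>" and "a \<le> b" "0 < h"
  shows "\<bar>integral {a..b} (\<lambda>x. (f (x + h) - f x) / h) - (f b - f a)\<bar> \<le> 2 * C * h"
proof -
  have C: "0 \<le> C" using lip[of 0 1] by simp
  have "C-lipschitz_on UNIV f"
    by (rule lipschitz_onI) (use lip C in \<open>auto simp: dist_real_def\<close>)
  then have cont: "continuous_on UNIV f" by (rule lipschitz_on_continuous_on)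
  then have int: "f integrable_on {u..v}" for u v
    by (meson continuous_on_subset integrable_continuous_real top_greatest)
  have mean: "\<bar>integral {u..u + h} f - h * f u\<bar> \<le> C * h * h" for u
  proof -
    have "integral {u..u + h} (\<lambda>x. f x - f u) = integral {u..u + h} f - h * f u"
      using int \<open>0 < h\<close> by (subst integral_diff) auto
    moreover have "norm (integral {u..u + h} (\<lambda>x. f x - f u)) \<le> C * h * (u + h - u)"
    proof (rule integral_bound)
      show "continuous_on {u..u + h} (\<lambda>x. f x - f u)"
        using cont by (intro continuous_intros) (auto intro: continuous_on_subset)
      show "norm (f t - f u) \<le> C * h" if "t \<in> {u..u + h}" for t
      proof -
        have "\<bar>f t - f u\<bar> \<le> C * \<bar>t - u\<bar>" by (rule lip)
        also have "\<dots> \<le> C * h" using that C by (intro mult_left_mono) auto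
        finally show ?thesis by simp
      qed
    qed (use \<open>0 < h\<close> in auto)
    ultimately show ?thesis by simp
  qed
  have "integral {a..b} (\<lambda>x. f (x + h)) = integral {a + h..b + h} f"
    using integral_shift_real_ivl[of "a + h" h "b + h" f] by simp
  moreover have "integral {a..b} f + integral {b..b + h} f = integral {a..b + h} f"
    using int assms by (intro Henstock_Kurzweil_Integration.integral_combine) auto
  moreover have "integral {a..a + h} f + integral {a + h..b + h} f = integral {a..b + h} f"
    using int assms by (intro Henstock_Kurzweil_Integration.integral_combine) auto
  moreover have "integral {a..b} (\<lambda>x. (f (x + h) - f x) / h) =
      (integral {a..b} (\<lambda>x. f (x + h)) - integral {a..b} f) / h"
  proof -
    have "(\<lambda>x. f (x + h)) integrable_on {a..b}"
      by (intro integrable_continuous_real continuous_on_compose2[OF cont] continuous_intros) auto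
    then show ?thesis using int by (simp add: integral_diff)
  qed
  moreover from this have "h * integral {a..b} (\<lambda>x. (f (x + h) - f x) / h) =
      integral {a..b} (\<lambda>x. f (x + h)) - integral {a..b} f"
    using \<open>0 < h\<close> by (simp only: nonzero_mult_div_cancel_left times_divide_eq_right)
  ultimately have "h * (integral {a..b} (\<lambda>x. (f (x + h) - f x) / h) - (f b - f a)) =
      (integral {b..b + h} f - h * f b) - (integral {a..a + h} f - h * f a)"
    unfolding right_diff_distrib by linarith
  then have "h * \<bar>integral {a..b} (\<lambda>x. (f (x + h) - f x) / h) - (f b - f a)\<bar> \<le> C * h * h + C * h * h"
    using mean[of a] mean[of b] \<open>0 < h\<close>
    by (subst abs_of_pos[OF \<open>0 < h\<close>, symmetric], subst abs_mult[symmetric]) linarith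
  also have "\<dots> = h * (2 * C * h)" by simp
  finally show ?thesis using \<open>0 < h\<close> by (simp add: mult_le_cancel_left_pos)
qed

text \<open>By Fubini the preceding estimate is applied on every horizontal line. Its error does not
  depend on the line, so it survives the integration over \<open>y\<close>. The shifted points may
  leave \<open>S\<close>, which is why the Lipschitz bound is required on the whole plane.\<close>

lemma difference_quotient_integral_limit:
  fixes f :: "real \<times> real \<Rightarrow> real" and l u :: "real \<Rightarrow> real"
  assumes lip: "\<And>p q. \<bar>f p - f q\<bar> \<le> C * dist p q"
    and lu: "continuous_on {c..d} l" "continuous_on {c..d} u" "\<And>y. y \<in> {c..d} \<Longrightarrow> l y \<le> u y"
    and S: "S = {(x, y). y \<in> {c..d} \<and> l y \<le> x \<and> x \<le> u y}" "compact S"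
    and cd: "c \<le> d"
  shows "(\<lambda>n. LINT p|lborel. indicator S p * (real (Suc n) * (f (p + (1 / real (Suc n), 0)) - f p)))
    \<longlonglongrightarrow> (LINT y|lborel. indicator {c..d} y * (f (u y, y) - f (l y, y)))"
proof -
  have C: "0 \<le> C"
  proof -
    have "0 \<le> C * dist (0, 0) (1 :: real, 0 :: real)" using lip abs_ge_zero order_trans by blast
    then show ?thesis by (simp add: dist_Pair_Pair)
  qed
  have "C-lipschitz_on UNIV f" by (rule lipschitz_onI) (use lip C in \<open>auto simp: dist_real_def\<close>)
  then have cont: "continuous_on UNIV f" by (rule lipschitz_on_continuous_on)
  have lip1: "\<bar>f (x, y) - f (x', y)\<bar> \<le> C * \<bar>x - x'\<bar>" for x x' y
    using lip[of "(x,y)" "(x',y)"] by (simp add: dist_Pair_Pair dist_real_def)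
  define D where "D n p = indicator S p * (real (Suc n) * (f (p + (1 / real (Suc n), 0)) - f p))" for n p
  define g where "g y = f (u y, y) - f (l y, y)" for y
  define G where "G n y = (LINT x|lborel. D n (x, y))" for n y
  have Sb: "S \<in> sets borel" using S by (simp add: compact_imp_closed)
  have intD: "integrable lborel (D n)" for n
  proof -
    have "set_integrable lborel S (\<lambda>p. real (Suc n) * (f (p + (1 / real (Suc n), 0)) - f p))"
      unfolding set_integrable_def using S(2)
      by (intro borel_integrable_compact continuous_intros
          continuous_on_compose2[OF cont] continuous_on_subset[OF cont]) auto
    then show ?thesis by (simp add: set_integrable_def D_def[abs_def])
  qed
  have fub: "(LINT p|lborel. D n p) = (LINT y|lborel. G n y)" "integrable lborel (G n)" for n
  proof -
    have "integrable (lborel \<Otimes>\<^sub>M lborel) (case_prod (\<lambda>x y. D n (x, y)))"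
      using intD[of n] by (simp add: lborel_prod)
    from lborel_pair.integral_snd[OF this] lborel_pair.integrable_snd[OF this]
    show "(LINT p|lborel. D n p) = (LINT y|lborel. G n y)" "integrable lborel (G n)"
      by (simp_all add: lborel_prod G_def[abs_def])
  qed
  have out: "G n y = 0" if "y \<notin> {c..d}" for n y
  proof -
    have "D n (x, y) = 0" for x using that by (auto simp: D_def S)
    then show ?thesis by (simp add: G_def)
  qed
  have inn: "\<bar>G n y - g y\<bar> \<le> 2 * C * (1 / real (Suc n))" if y: "y \<in> {c..d}" for n y
  proof -
    define k where "k = 1 / real (Suc n)"
    have k: "k > 0" by (simp add: k_def)
    have "G n y = (LINT x:{l y..u y}|lborel. (f (x + k, y) - f (x, y)) / k)"
      unfolding G_def D_def set_lebesgue_integral_def using y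
      by (intro Bochner_Integration.integral_cong) (auto simp: S indicator_def k_def field_simps)
    also have "\<dots> = integral {l y..u y} (\<lambda>x. (f (x + k, y) - f (x, y)) / k)"
      using k by (intro set_borel_integral_eq_integral borel_integrable_atLeastAtMost' continuous_intros
          continuous_on_compose2[OF cont]) auto
    finally show ?thesis
      using lipschitz_difference_quotient_integral[of "\<lambda>x. f (x, y)" C "l y" "u y" k] lip1 lu(3)[OF y] k
      by (simp add: g_def k_def)
  qed
  have intg: "integrable lborel (\<lambda>y. indicator {c..d} y * g y)"
  proof -
    have "set_integrable lborel {c..d} g" unfolding g_def
      by (intro borel_integrable_atLeastAtMost' continuous_intros continuous_on_compose2[OF cont] lu) auto
    then show ?thesis by (simp add: set_integrable_def)
  qed
  have bound: "\<bar>(LINT p|lborel. D n p) - (LINT y|lborel. indicator {c..d} y * g y)\<bar>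
      \<le> 2 * C * (d - c) * (1 / real (Suc n))" for n
  proof -
    have intc: "integrable lborel (\<lambda>y. indicator {c..d} y * (2 * C * (1 / real (Suc n))))"
      using cd by (intro integrable_mult_left integrable_real_indicator) auto
    have "(LINT p|lborel. D n p) - (LINT y|lborel. indicator {c..d} y * g y) =
        (LINT y|lborel. G n y - indicator {c..d} y * g y)"
      using fub intg by simp
    also have "\<bar>\<dots>\<bar> \<le> (LINT y|lborel. indicator {c..d} y * (2 * C * (1 / real (Suc n))))"
    proof (rule order_trans[OF integral_abs_bound], rule integral_mono)
      show "integrable lborel (\<lambda>y. \<bar>G n y - indicator {c..d} y * g y\<bar>)"
        using fub(2) intg by (intro integrable_abs Bochner_Integration.integrable_diff)
      show "\<bar>G n y - indicator {c..d} y * g y\<bar> \<le> indicator {c..d} y * (2 * C * (1 / real (Suc n)))" for y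
        using inn[of y n] out[of y n] by (cases "y \<in> {c..d}") (auto simp: indicator_def)
    qed (rule intc)
    also have "\<dots> = 2 * C * (d - c) * (1 / real (Suc n))"
      unfolding integral_mult_left_zero using cd by simp
    finally show ?thesis .
  qed
  have "(\<lambda>n. (LINT p|lborel. D n p) - (LINT y|lborel. indicator {c..d} y * g y)) \<longlonglongrightarrow> 0"
  proof (rule tendsto_rabs_zero_cancel, rule tendsto_sandwich[OF _ _ tendsto_const])
    show "(\<lambda>n. 2 * C * (d - c) * (1 / real (Suc n))) \<longlonglongrightarrow> 0"
      using tendsto_mult_right_zero[OF LIMSEQ_inverse_real_of_nat] by (simp add: inverse_eq_divide)
  qed (use bound in auto)
  then have "(\<lambda>n. LINT p|lborel. D n p) \<longlonglongrightarrow> (LINT y|lborel. indicator {c..d} y * g y)"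
    by (rule LIM_zero_cancel)
  then show ?thesis by (simp add: D_def[abs_def] g_def[abs_def])
qed

text \<open>Rademacher's theorem and absolute continuity on lines are avoided: the difference quotients
  of \<open>\<beta>\<close> are bounded and their divergence tends to \<open>0\<close> almost everywhere, while their integrals over
  the triangle telescope to averages of \<open>\<beta>\<close> along the edges.\<close>

lemma divergence_theorem_triangle:
  fixes \<beta> :: "real \<times> real \<Rightarrow> real \<times> real" and m a c x0 C :: real
  defines "T \<equiv> {(x, y). a \<le> x \<and> y \<le> c \<and> m * (x - x0) \<le> y}"
  assumes m: "0 < m" and ac: "m * (a - x0) < c"
    and lip: "C-lipschitz_on T \<beta>"
    and div: "AE p in lborel. p \<in> interior T \<longrightarrow>
        (\<exists>D. (\<beta> has_derivative D) (at p) \<and> (\<Sum>b\<in>Basis. D b \<bullet> b) = 0)"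
    and tang: "\<And>x. x \<in> {a..x0 + c / m} \<Longrightarrow> snd (\<beta> (x, m * (x - x0))) = m * fst (\<beta> (x, m * (x - x0)))"
  shows "(LINT y|lborel. indicator {m * (a - x0)..c} y * fst (\<beta> (a, y))) =
         (LINT x|lborel. indicator {a..x0 + c / m} x * snd (\<beta> (x, c)))"
proof -
  have aX: "a < x0 + c / m" using ac m by (simp add: field_simps)
  \<comment> \<open>The triangle is needed as a region between graphs over the \<open>y\<close> axis
    for the first partial derivative and, in \<open>T2\<close>, over the \<open>x\<close> axis for
    the second.\<close>
  have T1: "T = {(x, y). y \<in> {m * (a - x0)..c} \<and> a \<le> x \<and> x \<le> x0 + y / m}"
  proof -
    have 1: "x \<le> x0 + y / m \<longleftrightarrow> m * (x - x0) \<le> y" for x y using m by (simp add: field_simps)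
    have 2: "m * (a - x0) \<le> m * (x - x0) \<longleftrightarrow> a \<le> x" for x using m by simp
    show ?thesis unfolding T_def 1 using 2 by (auto intro: order_trans)
  qed
  have T2: "T = {(x, y). x \<in> {a..x0 + c / m} \<and> m * (x - x0) \<le> y \<and> y \<le> c}"
  proof -
    have 1: "x \<le> x0 + c / m \<longleftrightarrow> m * (x - x0) \<le> c" for x using m by (simp add: field_simps)
    show ?thesis unfolding T_def by (auto simp: 1)
  qed
  have clT: "closed T"
  proof -
    have "T = {p. a \<le> fst p} \<inter> {p. snd p \<le> c} \<inter> {p. m * (fst p - x0) \<le> snd p}" by (auto simp: T_def)
    then show ?thesis by (simp only:) (intro closed_Int closed_Collect_le continuous_intros)
  qed
  have "bounded T"
  proof (rule bounded_subset)
    show "T \<subseteq> cbox (a, m * (a - x0)) (x0 + c / m, c)"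
    proof
      fix p assume "p \<in> T"
      then have "p \<in> {(x, y). y \<in> {m * (a - x0)..c} \<and> a \<le> x \<and> x \<le> x0 + y / m}"
        "p \<in> {(x, y). x \<in> {a..x0 + c / m} \<and> m * (x - x0) \<le> y \<and> y \<le> c}"
        using T1 T2 by blast+
      then show "p \<in> cbox (a, m * (a - x0)) (x0 + c / m, c)" by (auto simp: cbox_Pair_eq)
    qed
  qed simp
  with clT have coT: "compact T" by (simp add: compact_eq_bounded_closed)
  have "convex T"
  proof -
    have "T = {p. (1, 0) \<bullet> p \<ge> a} \<inter> {p. (0, 1) \<bullet> p \<le> c} \<inter> {p. (m, -1) \<bullet> p \<le> m * x0}"
      by (auto simp: T_def algebra_simps)
    then show ?thesis by (simp only:) (intro convex_Int convex_halfspace_le convex_halfspace_ge)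
  qed
  have "(a, c) \<in> T" using ac by (auto simp: T_def)
  then have neT: "T \<noteq> {}" by blast
  \<comment> \<open>Projection to the nearest point of the convex set \<open>T\<close> does not
    increase distances, so this extends \<open>\<beta>\<close> to the plane with the same constant
    \<open>C\<close>, and difference quotients may step out of \<open>T\<close>.\<close>
  define b where "b = (\<lambda>p. \<beta> (closest_point T p))"
  have bT: "b p = \<beta> p" if "p \<in> T" for p using that by (simp add: b_def closest_point_self)
  have C: "0 \<le> C" using lip lipschitz_on_nonneg by blast
  have lipb: "dist (b p) (b q) \<le> C * dist p q" for p q
  proof -
    have "dist (b p) (b q) \<le> C * dist (closest_point T p) (closest_point T q)"
      unfolding b_def by (intro lipschitz_onD[OF lip] closest_point_in_set clT neT)
    also have "\<dots> \<le> C * dist p q"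
      using C \<open>convex T\<close> clT neT by (intro mult_left_mono closest_point_lipschitz) auto
    finally show ?thesis .
  qed
  define P where "P p = fst (b p)" for p
  define Q where "Q p = snd (b p)" for p
  have lipP: "\<bar>P p - P q\<bar> \<le> C * dist p q" and lipQ: "\<bar>Q p - Q q\<bar> \<le> C * dist p q" for p q
    using order_trans[OF dist_fst_le lipb[of p q]] order_trans[OF dist_snd_le lipb[of p q]]
    by (auto simp: P_def Q_def dist_real_def)
  have contP: "continuous_on UNIV P" and contQ: "continuous_on UNIV Q"
    by (rule lipschitz_on_continuous_on[of C], rule lipschitz_onI,
        use lipP lipQ C in \<open>auto simp: dist_real_def\<close>)+
  define DP where "DP n p = indicator T p * (real (Suc n) * (P (p + (1 / real (Suc n), 0)) - P p))" for n p
  define DQ where "DQ n p = indicator T p * (real (Suc n) * (Q (p + (0, 1 / real (Suc n))) - Q p))" for n p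
  have limP: "(\<lambda>n. LINT p|lborel. DP n p) \<longlonglongrightarrow>
      (LINT y|lborel. indicator {m * (a - x0)..c} y * (P (x0 + y / m, y) - P (a, y)))"
    unfolding DP_def
  proof (rule difference_quotient_integral_limit[of P C])
    show "a \<le> x0 + y / m" if "y \<in> {m * (a - x0)..c}" for y using that m by (auto simp: field_simps)
  qed (use lipP T1 coT ac m in \<open>auto intro!: continuous_intros\<close>)
  \<comment> \<open>The vertical difference quotient is the horizontal one after a swap of the
    coordinates, applied to the reflected triangle.\<close>
  have limQ: "(\<lambda>n. LINT p|lborel. DQ n p) \<longlonglongrightarrow>
      (LINT x|lborel. indicator {a..x0 + c / m} x * (Q (x, c) - Q (x, m * (x - x0))))"
  proof -
    define T' where "T' = prod.swap ` T"
    have T': "T' = {(y, x). x \<in> {a..x0 + c / m} \<and> m * (x - x0) \<le> y \<and> y \<le> c}"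
      unfolding T'_def T2 by (auto simp: image_iff)
    have "(\<lambda>n. LINT p|lborel. indicator T' p * (real (Suc n) *
        ((Q \<circ> prod.swap) (p + (1 / real (Suc n), 0)) - (Q \<circ> prod.swap) p))) \<longlonglongrightarrow>
      (LINT x|lborel. indicator {a..x0 + c / m} x * ((Q \<circ> prod.swap) (c, x) - (Q \<circ> prod.swap) (m * (x - x0), x)))"
    proof (rule difference_quotient_integral_limit[of "Q \<circ> prod.swap" C])
      show "\<bar>(Q \<circ> prod.swap) p - (Q \<circ> prod.swap) q\<bar> \<le> C * dist p q" for p q
        using lipQ[of "prod.swap p" "prod.swap q"]
        by (cases p; cases q) (simp add: dist_Pair_Pair add.commute)
      show "m * (x - x0) \<le> c" if "x \<in> {a..x0 + c / m}" for x using that m by (auto simp: field_simps)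
      show "compact T'" unfolding T'_def by (intro compact_continuous_image coT continuous_intros)
    qed (use T' aX in \<open>auto intro!: continuous_intros\<close>)
    moreover have "(LINT p|lborel. DQ n p) = (LINT p|lborel. indicator T' p * (real (Suc n) *
        ((Q \<circ> prod.swap) (p + (1 / real (Suc n), 0)) - (Q \<circ> prod.swap) p)))" for n
    proof -
      have "DQ n \<in> borel_measurable (lborel \<Otimes>\<^sub>M lborel)"
      proof -
        have "DQ n \<in> borel_measurable borel" unfolding DQ_def
          by (intro borel_measurable_times borel_measurable_indicator borel_measurable_continuous_onI
              borel_measurable_const borel_measurable_diff
              continuous_on_compose2[OF contQ] continuous_intros contQ) (auto simp: clT)
        then show ?thesis by (simp add: lborel_prod)
      qed
      from lborel_pair.integral_product_swap[OF this]
      have "(LINT p|lborel. DQ n p) = (LINT (x, y)|lborel. DQ n (y, x))" by (simp add: lborel_prod)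
      also have "\<dots> = (LINT p|lborel. indicator T' p * (real (Suc n) *
        ((Q \<circ> prod.swap) (p + (1 / real (Suc n), 0)) - (Q \<circ> prod.swap) p)))"
        by (intro Bochner_Integration.integral_cong) (auto simp: DQ_def T'_def indicator_def)
      finally show ?thesis .
    qed
    ultimately show ?thesis by simp
  qed
  have intD: "integrable lborel (DP n)" "integrable lborel (DQ n)" for n
  proof -
    have "set_integrable lborel T (\<lambda>p. real (Suc n) * (P (p + (1 / real (Suc n), 0)) - P p))"
      "set_integrable lborel T (\<lambda>p. real (Suc n) * (Q (p + (0, 1 / real (Suc n))) - Q p))"
      unfolding set_integrable_def
      by (intro borel_integrable_compact coT continuous_intros
          continuous_on_compose2[OF contP] continuous_on_subset[OF contP]
          continuous_on_compose2[OF contQ] continuous_on_subset[OF contQ]; auto)+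
    then show "integrable lborel (DP n)" "integrable lborel (DQ n)"
      by (simp_all add: set_integrable_def DP_def[abs_def] DQ_def[abs_def])
  qed
  \<comment> \<open>Dominated convergence: each of the two difference quotients is at most
    \<open>C\<close> in absolute value, hence the bound \<open>2 * C\<close> on
    \<open>T\<close>.\<close>
  have "(\<lambda>n. LINT p|lborel. DP n p + DQ n p) \<longlonglongrightarrow> (LINT p|(lborel :: (real \<times> real) measure). 0)"
  proof (rule integral_dominated_convergence)
    show "(\<lambda>p. 0) \<in> borel_measurable lborel" by simp
    show "(\<lambda>p. DP n p + DQ n p) \<in> borel_measurable lborel" for n
      using intD[of n] by (intro borel_measurable_add borel_measurable_integrable)
    have "emeasure lborel T < \<infinity>" using coT emeasure_compact_finite by blast
    then show "integrable lborel (\<lambda>p. indicator T p * (2 * C))"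
      using clT by (intro integrable_mult_left integrable_real_indicator) auto
    have bd: "real (Suc n) * (C * (1 / real (Suc n))) = C" for n by simp
    have bdP: "\<bar>real (Suc n) * (P (p + (1 / real (Suc n), 0)) - P p)\<bar> \<le> C" for n p
    proof -
      have "\<bar>P (p + (1 / real (Suc n), 0)) - P p\<bar> \<le> C * (1 / real (Suc n))"
        using lipP[of "p + (1 / real (Suc n), 0)" p] by (simp add: dist_norm norm_Pair)
      then have "real (Suc n) * \<bar>P (p + (1 / real (Suc n), 0)) - P p\<bar> \<le> C"
        using mult_left_mono[of _ _ "real (Suc n)"] bd[of n] of_nat_0_le_iff by metis
      then show ?thesis by (simp only: abs_mult abs_of_nat)
    qed
    have bdQ: "\<bar>real (Suc n) * (Q (p + (0, 1 / real (Suc n))) - Q p)\<bar> \<le> C" for n p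
    proof -
      have "\<bar>Q (p + (0, 1 / real (Suc n))) - Q p\<bar> \<le> C * (1 / real (Suc n))"
        using lipQ[of "p + (0, 1 / real (Suc n))" p] by (simp add: dist_norm norm_Pair)
      then have "real (Suc n) * \<bar>Q (p + (0, 1 / real (Suc n))) - Q p\<bar> \<le> C"
        using mult_left_mono[of _ _ "real (Suc n)"] bd[of n] of_nat_0_le_iff by metis
      then show ?thesis by (simp only: abs_mult abs_of_nat)
    qed
    show "AE p in lborel. norm (DP n p + DQ n p) \<le> indicator T p * (2 * C)" for n
    proof (rule AE_I2)
      fix p :: "real \<times> real"
      show "norm (DP n p + DQ n p) \<le> indicator T p * (2 * C)"
        using bdP[of n p] bdQ[of n p] unfolding DP_def DQ_def
        by (cases "p \<in> T") (simp_all only: indicator_simps real_norm_def mult_1 mult_zero_left, auto)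
    qed
    \<comment> \<open>The divergence is controlled only in the interior of \<open>T\<close>; outside
      \<open>T\<close> the integrands are 0, and the frontier of a convex set is a null set.\<close>
    have "negligible (frontier T)" using \<open>convex T\<close> by (rule negligible_convex_frontier)
    then have "frontier T \<in> null_sets lborel"
      using negligible_iff_null_sets by (metis borel_closed frontier_closed null_sets_completion_iff sets_lborel)
    then have "AE p in lborel. p \<notin> frontier T" by (rule AE_not_in)
    with div show "AE p in lborel. (\<lambda>n. DP n p + DQ n p) \<longlonglongrightarrow> 0"
    proof eventually_elim
      case (elim p)
      show ?case
      proof (cases "p \<in> T")
        case False
        then show ?thesis by (simp add: DP_def DQ_def)
      next
        case True
        then have p: "p \<in> interior T" using elim clT by (simp add: frontier_def)
        with elim obtain D where D: "(\<beta> has_derivative D) (at p)" "(\<Sum>b\<in>Basis. D b \<bullet> b) = 0" by blast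
        have Db: "(b has_derivative D) (at p)"
          using D(1) by (rule has_derivative_transform_within_open[OF _ open_interior p])
            (metis bT interior_subset subsetD)
        have lim: "(\<lambda>n. real (Suc n) * (b (p + (1 / real (Suc n)) *\<^sub>R v) \<bullet> w - b p \<bullet> w)) \<longlonglongrightarrow> D v \<bullet> w" for v w
        proof -
          have "((\<lambda>t. b (p + t *\<^sub>R v)) has_derivative (\<lambda>t. D (t *\<^sub>R v))) (at 0)"
            by (rule has_derivative_compose[where g = b and f = "\<lambda>t. p + t *\<^sub>R v" and f' = "\<lambda>t. t *\<^sub>R v"])
              (use Db in \<open>auto intro!: derivative_eq_intros\<close>)
          then have "((\<lambda>t. b (p + t *\<^sub>R v) \<bullet> w) has_derivative (\<lambda>t. D (t *\<^sub>R v) \<bullet> w)) (at 0)"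
            by (rule has_derivative_inner_left)
          moreover have "(\<lambda>t. D (t *\<^sub>R v) \<bullet> w) = (*) (D v \<bullet> w)"
            using Db by (auto simp: linear_cmul has_derivative_linear)
          ultimately have "((\<lambda>t. b (p + t *\<^sub>R v) \<bullet> w) has_field_derivative (D v \<bullet> w)) (at 0)"
            by (simp add: has_field_derivative_def)
          then have "((\<lambda>t. (b (p + t *\<^sub>R v) \<bullet> w - b p \<bullet> w) / t) \<longlongrightarrow> D v \<bullet> w) (at 0)"
            by (simp add: DERIV_def)
          moreover have "filterlim (\<lambda>n. 1 / real (Suc n)) (at 0) sequentially"
            using LIMSEQ_inverse_real_of_nat by (simp add: filterlim_at inverse_eq_divide)
          ultimately have "(\<lambda>n. (b (p + (1 / real (Suc n)) *\<^sub>R v) \<bullet> w - b p \<bullet> w) / (1 / real (Suc n))) \<longlonglongrightarrow> D v \<bullet> w"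
            by (rule filterlim_compose)
          then show ?thesis by (simp add: mult.commute)
        qed
        have "(\<lambda>n. real (Suc n) * (b (p + (1 / real (Suc n)) *\<^sub>R (1, 0)) \<bullet> (1, 0) - b p \<bullet> (1, 0)) +
            real (Suc n) * (b (p + (1 / real (Suc n)) *\<^sub>R (0, 1)) \<bullet> (0, 1) - b p \<bullet> (0, 1)))
            \<longlonglongrightarrow> D (1, 0) \<bullet> (1, 0) + D (0, 1) \<bullet> (0, 1)"
          by (intro tendsto_add lim)
        also have "D (1, 0) \<bullet> (1, 0) + D (0, 1) \<bullet> (0, 1) = 0"
          using D(2) by (auto simp: Basis_prod_def sum.union_disjoint)
        finally have "(\<lambda>n. real (Suc n) * (P (p + (1 / real (Suc n), 0)) - P p) +
            real (Suc n) * (Q (p + (0, 1 / real (Suc n))) - Q p)) \<longlonglongrightarrow> 0"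
          by (simp add: P_def Q_def inner_prod_def)
        then show ?thesis using True by (simp add: DP_def DQ_def)
      qed
    qed
  qed
  moreover have "(\<lambda>n. LINT p|lborel. DP n p + DQ n p) \<longlonglongrightarrow>
     (LINT y|lborel. indicator {m * (a - x0)..c} y * (P (x0 + y / m, y) - P (a, y))) +
     (LINT x|lborel. indicator {a..x0 + c / m} x * (Q (x, c) - Q (x, m * (x - x0))))"
    using tendsto_add[OF limP limQ] intD by simp
  ultimately have key: "(LINT y|lborel. indicator {m * (a - x0)..c} y * (P (x0 + y / m, y) - P (a, y))) +
     (LINT x|lborel. indicator {a..x0 + c / m} x * (Q (x, c) - Q (x, m * (x - x0)))) = 0"
    using LIMSEQ_unique by fastforce
  have int: "integrable lborel (\<lambda>t. indicator {u..v} t * F t)" if "continuous_on UNIV F" for u v :: real and F :: "real \<Rightarrow> real"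
    using borel_integrable_atLeastAtMost'[of u v F] that continuous_on_subset
    by (auto simp: set_integrable_def)
  have cI: "continuous_on UNIV (\<lambda>t. F (g t))" if "continuous_on UNIV F" "continuous_on UNIV g"
    for F :: "real \<times> real \<Rightarrow> real" and g :: "real \<Rightarrow> real \<times> real"
    using that by (auto intro: continuous_on_compose2)
  \<comment> \<open>The substitution \<open>y = m * (x - x0)\<close> moves the integral along the
    hypotenuse to the variable \<open>x\<close>. Its factor \<open>m\<close> turns \<open>P\<close>
    into \<open>Q\<close> by tangency, so the two contributions of the hypotenuse cancel and only
    the two grid edges remain.\<close>
  have "(LINT y|lborel. indicator {m * (a - x0)..c} y * P (x0 + y / m, y)) =
      m * (LINT x|lborel. indicator {m * (a - x0)..c} (- m * x0 + m * x) * P (x0 + (- m * x0 + m * x) / m, - m * x0 + m * x))"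
    using m by (subst lborel_integral_real_affine[of m _ "- m * x0"]) auto
  also have "\<dots> = m * (LINT x|lborel. indicator {a..x0 + c / m} x * P (x, m * (x - x0)))"
    using m by (intro arg_cong[of _ _ "\<lambda>z. m * z"] Bochner_Integration.integral_cong)
      (auto simp: indicator_def field_simps)
  also have "\<dots> = (LINT x|lborel. indicator {a..x0 + c / m} x * Q (x, m * (x - x0)))"
  proof -
    have "Q (x, m * (x - x0)) = m * P (x, m * (x - x0))" if "x \<in> {a..x0 + c / m}" for x
    proof -
      have "(x, m * (x - x0)) \<in> T" using that m by (auto simp: T_def field_simps)
      then show ?thesis using tang[OF that] by (simp add: P_def Q_def bT)
    qed
    then show ?thesis by (subst integral_mult_right_zero[symmetric])
      (intro Bochner_Integration.integral_cong, auto simp: indicator_def)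
  qed
  finally have sub: "(LINT y|lborel. indicator {m * (a - x0)..c} y * P (x0 + y / m, y)) =
    (LINT x|lborel. indicator {a..x0 + c / m} x * Q (x, m * (x - x0)))" .
  have "(LINT y|lborel. indicator {m * (a - x0)..c} y * (P (x0 + y / m, y) - P (a, y))) =
      (LINT y|lborel. indicator {m * (a - x0)..c} y * P (x0 + y / m, y)) -
      (LINT y|lborel. indicator {m * (a - x0)..c} y * P (a, y))"
    unfolding right_diff_distrib using m
    by (intro Bochner_Integration.integral_diff int cI contP continuous_intros) auto
  moreover have "(LINT x|lborel. indicator {a..x0 + c / m} x * (Q (x, c) - Q (x, m * (x - x0)))) =
      (LINT x|lborel. indicator {a..x0 + c / m} x * Q (x, c)) -
      (LINT x|lborel. indicator {a..x0 + c / m} x * Q (x, m * (x - x0)))"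
    unfolding right_diff_distrib
    by (intro Bochner_Integration.integral_diff int cI contQ continuous_intros)
  ultimately have "(LINT y|lborel. indicator {m * (a - x0)..c} y * P (a, y)) =
      (LINT x|lborel. indicator {a..x0 + c / m} x * Q (x, c))"
    using key sub by simp
  moreover have "(LINT y|lborel. indicator {m * (a - x0)..c} y * P (a, y)) =
     (LINT y|lborel. indicator {m * (a - x0)..c} y * fst (\<beta> (a, y)))"
    by (intro Bochner_Integration.integral_cong) (auto simp: indicator_def P_def bT T_def)
  moreover have "(LINT x|lborel. indicator {a..x0 + c / m} x * Q (x, c)) =
     (LINT x|lborel. indicator {a..x0 + c / m} x * snd (\<beta> (x, c)))"
    using m by (intro Bochner_Integration.integral_cong) (auto simp: indicator_def Q_def bT T_def field_simps)
  ultimately show ?thesis by simp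
qed

section \<open>Arc length integrals\<close>

lemma unit_speed_mem_segment:
  fixes a b :: "'a::euclidean_space"
  assumes "t \<in> {0..dist a b}" shows "a + t *\<^sub>R sgn (b - a) \<in> closed_segment a b"
proof (cases "a = b")
  case False
  then have "a + t *\<^sub>R sgn (b - a) = (1 - t / dist a b) *\<^sub>R a + (t / dist a b) *\<^sub>R b"
    by (simp add: sgn_div_norm dist_norm norm_minus_commute algebra_simps divide_inverse)
  moreover have "0 \<le> t / dist a b" "t / dist a b \<le> 1" using assms False by auto
  ultimately show ?thesis unfolding in_segment by blast
qed simp

lemma unit_speed_measurable:
  fixes a b :: "'a::euclidean_space"
  shows "(\<lambda>t. a + t *\<^sub>R sgn (b - a)) \<in> measurable (lebesgue_on {0..dist a b}) (restrict_space borel (closed_segment a b))"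
proof (rule measurable_restrict_space2)
  have "(\<lambda>t. a + t *\<^sub>R sgn (b - a)) \<in> borel_measurable borel"
    by (intro borel_measurable_continuous_onI continuous_intros)
  then show "(\<lambda>t. a + t *\<^sub>R sgn (b - a)) \<in> borel_measurable (lebesgue_on {0..dist a b})"
    by (intro measurable_restrict_space1 measurable_completion) simp
  show "(\<lambda>t. a + t *\<^sub>R sgn (b - a)) \<in> space (lebesgue_on {0..dist a b}) \<rightarrow> closed_segment a b"
    by (rule funcsetI) (use unit_speed_mem_segment[of _ a b] in simp)
qed

text \<open>The end points in \<open>arclength\<close> are a \<open>SOME\<close> choice, so their
  order is unknown. All facts about the measure are derived from whichever parametrization was
  chosen.\<close>

lemma arclength_parametrization:
  fixes a b :: "'a::euclidean_space"
  obtains a' b' where "closed_segment a b = closed_segment a' b'"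
    "arclength (closed_segment a b) =
      distr (lebesgue_on {0..dist a' b'}) (restrict_space borel (closed_segment a' b')) (\<lambda>t. a' + t *\<^sub>R sgn (b' - a'))"
proof -
  obtain a' b' where ab': "(SOME (a', b'). closed_segment a b = closed_segment a' b') = (a', b')"
    by fastforce
  have "case (SOME (a', b'). closed_segment a b = closed_segment a' b') of (a', b') \<Rightarrow> closed_segment a b = closed_segment a' b'"
    by (rule someI[of _ "(a, b)"]) simp
  then have eq: "closed_segment a b = closed_segment a' b'" by (simp only: ab' prod.case)
  show ?thesis
  proof (rule that[OF eq])
    show "arclength (closed_segment a b) =
      distr (lebesgue_on {0..dist a' b'}) (restrict_space borel (closed_segment a' b')) (\<lambda>t. a' + t *\<^sub>R sgn (b' - a'))"
      unfolding arclength_def Let_def ab' by (simp only: prod.case eq)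
  qed
qed

lemma space_arclength: "space (arclength (closed_segment a b)) = closed_segment a b"
  by (rule arclength_parametrization[of a b]) simp

lemma finite_measure_arclength: "finite_measure (arclength (closed_segment a b))"
proof -
  obtain a' b' where "arclength (closed_segment a b) =
      distr (lebesgue_on {0..dist a' b'}) (restrict_space borel (closed_segment a' b')) (\<lambda>t. a' + t *\<^sub>R sgn (b' - a'))"
    by (rule arclength_parametrization)
  moreover have "finite_measure (lebesgue_on {0..dist a' b'})"
    by (intro finite_measure_lebesgue_on) simp
  ultimately show ?thesis by (simp add: finite_measure.finite_measure_distr unit_speed_measurable)
qed

lemma continuous_on_imp_measurable_arclength:
  fixes f :: "'a::euclidean_space \<Rightarrow> 'b::topological_space"
  assumes "continuous_on (closed_segment a b) f"
  shows "f \<in> borel_measurable (arclength (closed_segment a b))"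
proof -
  obtain a' b' where ab: "closed_segment a b = closed_segment a' b'" "arclength (closed_segment a b) =
      distr (lebesgue_on {0..dist a' b'}) (restrict_space borel (closed_segment a' b')) (\<lambda>t. a' + t *\<^sub>R sgn (b' - a'))"
    by (rule arclength_parametrization)
  have "f \<in> borel_measurable (restrict_space borel (closed_segment a' b'))"
    using assms unfolding ab(1) by (rule borel_measurable_continuous_on_restrict)
  then show ?thesis unfolding ab(2) by simp
qed

text \<open>A unit speed parametrization reaches \<open>q\<close> for at most one parameter. Used to
  discard the end point at which the weight of a wedge vanishes.\<close>

lemma AE_arclength_neq:
  fixes a b q :: "'a::euclidean_space"
  assumes "a \<noteq> b" shows "AE p in arclength (closed_segment a b). p \<noteq> q"
proof -
  obtain a' b' where ab: "closed_segment a b = closed_segment a' b'" "arclength (closed_segment a b) =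
      distr (lebesgue_on {0..dist a' b'}) (restrict_space borel (closed_segment a' b')) (\<lambda>t. a' + t *\<^sub>R sgn (b' - a'))"
    by (rule arclength_parametrization)
  have "a' \<noteq> b'" using ab(1) assms by auto
  then have s: "sgn (b' - a') \<noteq> 0" by (simp add: sgn_zero_iff)
  have uniq: "t = t'" if "a' + t *\<^sub>R sgn (b' - a') = q" "a' + t' *\<^sub>R sgn (b' - a') = q" for t t'
  proof -
    have "t *\<^sub>R sgn (b' - a') = t' *\<^sub>R sgn (b' - a')" using that by (metis add_left_cancel)
    then show ?thesis using s by simp
  qed
  have "AE t in lebesgue_on {0..dist a' b'}. a' + t *\<^sub>R sgn (b' - a') \<noteq> q"
  proof (cases "\<exists>t. a' + t *\<^sub>R sgn (b' - a') = q")
    case True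
    then obtain t0 where t0: "a' + t0 *\<^sub>R sgn (b' - a') = q" by blast
    have "AE t in lebesgue. t \<noteq> t0" by (intro AE_completion AE_lborel_singleton)
    then have "AE t in lebesgue_on {0..dist a' b'}. t \<noteq> t0"
      by (subst AE_restrict_space_iff) (auto elim: eventually_mono)
    then show ?thesis by (rule eventually_mono) (use uniq t0 in blast)
  qed auto
  moreover have "{p \<in> space (restrict_space borel (closed_segment a' b')). p \<noteq> q}
      \<in> sets (restrict_space borel (closed_segment a' b'))"
  proof -
    have "{p \<in> space (restrict_space borel (closed_segment a' b')). p \<noteq> q} = closed_segment a' b' \<inter> (- {q})"
      by (auto simp: space_restrict_space)
    then show ?thesis by (simp add: sets_restrict_space)
  qed
  ultimately show ?thesis unfolding ab(2) by (subst AE_distr_iff[OF unit_speed_measurable])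
qed

section \<open>Axis-parallel segments, integrals along them, and the model triangle\<close>

lemma closed_segment_vertical:
  fixes x :: real
  assumes "y1 \<le> y2" shows "closed_segment (x, y1) (x, y2) = {(x', y). x' = x \<and> y1 \<le> y \<and> y \<le> (y2::real)}"
proof -
  have "closed_segment y1 y2 = {y1..y2}" using assms by (simp add: closed_segment_eq_real_ivl)
  then have "y1 \<le> y \<and> y \<le> y2 \<longleftrightarrow> (\<exists>u. 0 \<le> u \<and> u \<le> 1 \<and> y = (1 - u) * y1 + u * y2)" for y
    by (metis (no_types, lifting) atLeastAtMost_iff in_segment(1) real_scaleR_def)
  then show ?thesis by (auto simp: in_segment algebra_simps)
qed

lemma closed_segment_horizontal:
  fixes y :: real
  assumes "x1 \<le> x2" shows "closed_segment (x1, y) (x2, y) = {(x, y'). y' = y \<and> x1 \<le> x \<and> x \<le> (x2::real)}"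
proof -
  have "closed_segment x1 x2 = {x1..x2}" using assms by (simp add: closed_segment_eq_real_ivl)
  then have "x1 \<le> x \<and> x \<le> x2 \<longleftrightarrow> (\<exists>u. 0 \<le> u \<and> u \<le> 1 \<and> x = (1 - u) * x1 + u * x2)" for x
    by (metis (no_types, lifting) atLeastAtMost_iff in_segment(1) real_scaleR_def)
  then show ?thesis by (auto simp: in_segment algebra_simps)
qed

text \<open>A supporting line cuts out a face of dimension at most 1, and two distinct points force
  dimension at least 1.\<close>

lemma edge_of_supportingI:
  fixes S :: "(real \<times> real) set"
  assumes "convex S" "n \<noteq> 0" "\<And>x. x \<in> S \<Longrightarrow> n \<bullet> x \<le> k" "p \<in> S" "q \<in> S" "p \<noteq> q" "n \<bullet> p = k" "n \<bullet> q = k"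
  shows "(S \<inter> {x. n \<bullet> x = k}) edge_of S"
proof -
  let ?e = "S \<inter> {x. n \<bullet> x = k}"
  have "?e face_of S" using assms by (intro face_of_Int_supporting_hyperplane_le) auto
  moreover have "aff_dim ?e \<le> aff_dim {x. n \<bullet> x = k}" by (intro aff_dim_subset) auto
  then have "aff_dim ?e \<le> 1" using assms(2) by simp
  moreover have "aff_dim {p, q} \<le> aff_dim ?e" using assms by (intro aff_dim_subset) auto
  then have "1 \<le> aff_dim ?e" using assms(6) by simp
  ultimately show ?thesis by (simp add: edge_of_def)
qed

lemma lebesgue_on_interval_integral:
  fixes g :: "real \<Rightarrow> real"
  assumes "continuous_on {0..d} g"
  shows "(LINT t|lebesgue_on {0..d}. g t) = (LINT t|lborel. indicator {0..d} t * g t)"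
proof -
  have "(\<lambda>t. indicator {0..d} t *\<^sub>R g t) \<in> borel_measurable lborel"
    using borel_measurable_continuous_on_indicator[OF _ assms] by simp
  then show ?thesis
    by (subst integral_restrict_space) (simp_all add: integral_completion)
qed

text \<open>A segment determines its end points up to order, so the hidden parametrization is the
  given one or its reversal; the substitution of \<open>dist a b - t\<close> for \<open>t\<close>
  exchanges the two.\<close>

lemma arclength_integral:
  fixes a b :: "'a::euclidean_space" and f :: "'a \<Rightarrow> real"
  assumes "continuous_on (closed_segment a b) f"
  shows "(LINT p|arclength (closed_segment a b). f p) =
    (LINT t|lborel. indicator {0..dist a b} t * f (a + t *\<^sub>R sgn (b - a)))"
proof -
  obtain a' b' where eq: "closed_segment a b = closed_segment a' b'" and al: "arclength (closed_segment a b) =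
      distr (lebesgue_on {0..dist a' b'}) (restrict_space borel (closed_segment a' b')) (\<lambda>t. a' + t *\<^sub>R sgn (b' - a'))"
    by (rule arclength_parametrization)
  have cont: "continuous_on (closed_segment a' b') f" using assms by (simp only: eq)
  have "(LINT p|arclength (closed_segment a b). f p) = (LINT t|lebesgue_on {0..dist a' b'}. f (a' + t *\<^sub>R sgn (b' - a')))"
    unfolding al by (intro integral_distr unit_speed_measurable borel_measurable_continuous_on_restrict cont)
  also have "\<dots> = (LINT t|lborel. indicator {0..dist a' b'} t * f (a' + t *\<^sub>R sgn (b' - a')))"
    by (intro lebesgue_on_interval_integral continuous_on_compose2[OF cont] continuous_intros)
      (use unit_speed_mem_segment[of _ a' b'] in auto)
  also have "\<dots> = (LINT t|lborel. indicator {0..dist a b} t * f (a + t *\<^sub>R sgn (b - a)))"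
  proof -
    have "{a, b} = {a', b'}" using eq by simp
    then consider "a' = a" "b' = b" | "a' = b" "b' = a" by (auto simp: doubleton_eq_iff)
    then show ?thesis
    proof cases
      case 2
      have rev: "b + (dist a b - t) *\<^sub>R sgn (a - b) = a + t *\<^sub>R sgn (b - a)" for t
        by (cases "a = b") (simp_all add: sgn_div_norm dist_norm norm_minus_commute algebra_simps)
      have "(LINT t|lborel. indicator {0..dist a b} t * f (b + t *\<^sub>R sgn (a - b))) =
          (LINT t|lborel. indicator {0..dist a b} (dist a b + (- 1) * t) * f (b + (dist a b + (- 1) * t) *\<^sub>R sgn (a - b)))"
        by (subst lborel_integral_real_affine[of "- 1" _ "dist a b"]) auto
      also have "\<dots> = (LINT t|lborel. indicator {0..dist a b} t * f (a + t *\<^sub>R sgn (b - a)))"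
        by (intro Bochner_Integration.integral_cong) (auto simp: indicator_def rev)
      finally show ?thesis using 2 by (simp add: dist_commute)
    qed simp
  qed
  finally show ?thesis .
qed

lemma arclength_integral_vertical:
  fixes f :: "real \<times> real \<Rightarrow> real"
  assumes "y1 < y2" "continuous_on (closed_segment (x, y1) (x, y2)) f"
  shows "(LINT p|arclength (closed_segment (x, y1) (x, y2)). f p) =
    (LINT y|lborel. indicator {y1..y2} y * f (x, y))"
proof -
  have "(x, y1) + t *\<^sub>R sgn ((x, y2) - (x, y1)) = (x, y1 + t)" for t
    using assms(1) by (simp add: sgn_div_norm norm_Pair)
  moreover have "dist (x, y1) (x, y2) = y2 - y1" using assms(1) by (simp add: dist_Pair_Pair dist_real_def)
  ultimately have "(LINT p|arclength (closed_segment (x, y1) (x, y2)). f p) =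
      (LINT t|lborel. indicator {0..y2 - y1} t * f (x, y1 + t))"
    using arclength_integral[OF assms(2)] by simp
  also have "\<dots> = (LINT t|lborel. indicator {y1..y2} (y1 + 1 * t) * f (x, y1 + 1 * t))"
    by (intro Bochner_Integration.integral_cong) (auto simp: indicator_def)
  also have "\<dots> = (LINT y|lborel. indicator {y1..y2} y * f (x, y))"
    by (subst lborel_integral_real_affine[of 1 "\<lambda>y. indicator {y1..y2} y * f (x, y)" y1]) auto
  finally show ?thesis .
qed

lemma arclength_integral_horizontal:
  fixes f :: "real \<times> real \<Rightarrow> real"
  assumes "x1 < x2" "continuous_on (closed_segment (x1, y) (x2, y)) f"
  shows "(LINT p|arclength (closed_segment (x1, y) (x2, y)). f p) =
    (LINT x|lborel. indicator {x1..x2} x * f (x, y))"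
proof -
  have "(x1, y) + t *\<^sub>R sgn ((x2, y) - (x1, y)) = (x1 + t, y)" for t
    using assms(1) by (simp add: sgn_div_norm norm_Pair)
  moreover have "dist (x1, y) (x2, y) = x2 - x1" using assms(1) by (simp add: dist_Pair_Pair dist_real_def)
  ultimately have "(LINT p|arclength (closed_segment (x1, y) (x2, y)). f p) =
      (LINT t|lborel. indicator {0..x2 - x1} t * f (x1 + t, y))"
    using arclength_integral[OF assms(2)] by simp
  also have "\<dots> = (LINT t|lborel. indicator {x1..x2} (x1 + 1 * t) * f (x1 + 1 * t, y))"
    by (intro Bochner_Integration.integral_cong) (auto simp: indicator_def)
  also have "\<dots> = (LINT x|lborel. indicator {x1..x2} x * f (x, y))"
    by (subst lborel_integral_real_affine[of 1 "\<lambda>x. indicator {x1..x2} x * f (x, y)" x1]) auto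
  finally show ?thesis .
qed

lemma triangle_convex_hull:
  fixes a c m x0 :: real
  assumes m: "0 < m" and ac: "m * (a - x0) < c"
  shows "convex hull {(a, m * (a - x0)), (a, c), (x0 + c / m, c)} =
    {(x, y). a \<le> x \<and> y \<le> c \<and> m * (x - x0) \<le> y}" (is "?H = ?T")
proof
  have "?T = {p. (1, 0) \<bullet> p \<ge> a} \<inter> {p. (0, 1) \<bullet> p \<le> c} \<inter> {p. (m, -1) \<bullet> p \<le> m * x0}"
    by (auto simp: algebra_simps)
  then have "convex ?T" by (simp only:) (intro convex_Int convex_halfspace_le convex_halfspace_ge)
  moreover have "{(a, m * (a - x0)), (a, c), (x0 + c / m, c)} \<subseteq> ?T"
    using m ac by (auto simp: field_simps)
  ultimately show "?H \<subseteq> ?T" by (intro hull_minimal)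
next
  show "?T \<subseteq> ?H"
  proof clarify
    fix x y assume xy: "a \<le> x" "y \<le> c" "m * (x - x0) \<le> y"
    define H where "H = c - m * (a - x0)"
    have H: "H > 0" using ac by (simp add: H_def)
    \<comment> \<open>Barycentric coordinates with respect to the lower left, upper left and upper
      right vertex. The vertical edge has length \<open>H\<close> and the horizontal one
      \<open>H / m\<close>.\<close>
    define u v w where "u = (c - y) / H" and "v = 1 - (c - y) / H - m * (x - a) / H" and "w = m * (x - a) / H"
    have v: "v = 1 - u - w" by (simp add: u_def v_def w_def)
    have "u \<ge> 0" "w \<ge> 0" using H xy m by (auto simp: u_def w_def)
    moreover have "u + w \<le> 1"
    proof -
      have "u + w = (c - y + m * (x - a)) / H" by (simp add: u_def w_def add_divide_distrib)
      also have "\<dots> \<le> 1" using H xy by (simp add: H_def algebra_simps)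
      finally show ?thesis .
    qed
    moreover have "(x, y) = u *\<^sub>R (a, m * (a - x0)) + v *\<^sub>R (a, c) + w *\<^sub>R (x0 + c / m, c)"
    proof -
      have uH: "u * H = c - y" and wH: "w * H = m * (x - a)" using H by (simp_all add: u_def w_def)
      have "u * (m * (a - x0)) + v * c + w * c = c - u * H" by (simp add: v H_def algebra_simps)
      moreover have "m * (u * a + v * a + w * (x0 + c / m)) = m * a + w * H"
        using m by (simp add: v H_def algebra_simps)
      then have "m * (u * a + v * a + w * (x0 + c / m)) = m * x"
        by (simp only: wH) (simp add: algebra_simps)
      ultimately show ?thesis using m uH by simp
    qed
    ultimately show "(x, y) \<in> ?H" unfolding convex_hull_3
      by (intro CollectI exI[of _ u] exI[of _ v] exI[of _ w]) (auto simp: v)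
  qed
qed

section \<open>Traces of constant functions\<close>

text \<open>One-dimensional trace inequality: the value at \<open>z\<close> differs from that at any
  \<open>x\<close> by at most the integral of the absolute derivative; integrate this over
  \<open>x\<close>.\<close>

lemma pointwise_bound_by_integrals:
  fixes f f' :: "real \<Rightarrow> real"
  assumes lu: "l < u" and z: "z \<in> {l..u}"
    and deriv: "\<And>x. (f has_real_derivative f' x) (at x)" and cont': "continuous_on UNIV f'"
  shows "(u - l) * \<bar>f z\<bar> \<le> integral {l..u} (\<lambda>x. \<bar>f x\<bar>) + (u - l) * integral {l..u} (\<lambda>x. \<bar>f' x\<bar>)"
proof -
  define J where "J = integral {l..u} (\<lambda>x. \<bar>f' x\<bar>)"
  have cont: "continuous_on UNIV f"
    using deriv by (meson DERIV_continuous continuous_at_imp_continuous_on)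
  have int: "(\<lambda>x. \<bar>f x\<bar>) integrable_on {p..q}" "(\<lambda>x. \<bar>f' x\<bar>) integrable_on {p..q}"
    "f' integrable_on {p..q}" for p q
    by (intro integrable_continuous_real continuous_intros
        continuous_on_subset[OF cont] continuous_on_subset[OF cont']; simp)+
  have diff: "\<bar>f q - f p\<bar> \<le> J" if "p \<in> {l..u}" "q \<in> {l..u}" "p \<le> q" for p q
  proof -
    have "(f' has_integral f q - f p) {p..q}"
      using that deriv by (intro fundamental_theorem_of_calculus)
        (auto simp: has_real_derivative_iff_has_vector_derivative intro: has_vector_derivative_at_within)
    then have "f q - f p = integral {p..q} f'" by (simp add: integral_unique)
    then have "\<bar>f q - f p\<bar> \<le> integral {p..q} (\<lambda>x. \<bar>f' x\<bar>)"
      using integral_norm_bound_integral[OF int(3,2), of p q] by simp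
    also have "\<dots> \<le> J" unfolding J_def using that int by (intro integral_subset_le) auto
    finally show ?thesis .
  qed
  have "\<bar>f z\<bar> \<le> \<bar>f x\<bar> + J" if "x \<in> {l..u}" for x
    using diff[of x z] diff[of z x] that z by (cases "x \<le> z") auto
  then have "integral {l..u} (\<lambda>x. \<bar>f z\<bar>) \<le> integral {l..u} (\<lambda>x. \<bar>f x\<bar> + J)"
    using int by (intro integral_le Henstock_Kurzweil_Integration.integrable_add) auto
  also have "\<dots> = integral {l..u} (\<lambda>x. \<bar>f x\<bar>) + (u - l) * J"
    using int lu by (subst Henstock_Kurzweil_Integration.integral_add) auto
  finally show ?thesis using lu by (simp add: J_def)
qed

text \<open>The one-dimensional inequality on every horizontal line, integrated over the lines. The
  width \<open>u y - l y\<close> stays as a weight on the left, since a wedge may taper to width 0;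
  only in front of the derivative is it replaced by its bound \<open>M\<close>.\<close>

lemma wedge_estimate:
  fixes f D :: "real \<times> real \<Rightarrow> real" and l u z :: "real \<Rightarrow> real"
  assumes f: "continuous_on UNIV f" and D: "continuous_on UNIV D"
    and deriv: "\<And>x y. ((\<lambda>x. f (x, y)) has_real_derivative D (x, y)) (at x)"
    and cont: "continuous_on UNIV l" "continuous_on UNIV u" "continuous_on UNIV z"
    and lu: "\<And>y. y \<in> {c<..<d} \<Longrightarrow> l y < u y \<and> u y - l y \<le> M \<and> z y \<in> {l y..u y}"
    and R: "R = {(x, y). c < y \<and> y < d \<and> l y < x \<and> x < u y}" and bounded: "bounded R"
  shows "(LINT y|lborel. indicator {c<..<d} y * ((u y - l y) * \<bar>f (z y, y)\<bar>))
    \<le> (LINT p|lborel. indicator R p * \<bar>f p\<bar>) + M * (LINT p|lborel. indicator R p * \<bar>D p\<bar>)"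
proof -
  have "open R"
  proof -
    have "R = {p. c < snd p} \<inter> {p. snd p < d} \<inter> {p. l (snd p) < fst p} \<inter> {p. fst p < u (snd p)}"
      by (auto simp: R)
    then show ?thesis
      by (simp only:) (intro open_Int open_Collect_less continuous_intros
          continuous_on_compose2[OF cont(1)] continuous_on_compose2[OF cont(2)]; simp)
  qed
  have fub: "integrable lborel (\<lambda>y. indicator {c<..<d} y * integral {l y..u y} (\<lambda>x. \<bar>F (x, y)\<bar>))"
    "(LINT p|lborel. indicator R p * \<bar>F p\<bar>) =
      (LINT y|lborel. indicator {c<..<d} y * integral {l y..u y} (\<lambda>x. \<bar>F (x, y)\<bar>))"
    if F: "continuous_on UNIV F" for F :: "real \<times> real \<Rightarrow> real"
  proof -
    have "set_integrable lborel (closure R) (\<lambda>p. \<bar>F p\<bar>)"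
      unfolding set_integrable_def using bounded
      by (intro borel_integrable_compact continuous_intros continuous_on_subset[OF F]) auto
    then have "set_integrable lborel R (\<lambda>p. \<bar>F p\<bar>)"
      by (rule set_integrable_subset) (use \<open>open R\<close> closure_subset in auto)
    then have "integrable (lborel \<Otimes>\<^sub>M lborel) (case_prod (\<lambda>x y. indicator R (x, y) * \<bar>F (x, y)\<bar>))"
      by (simp add: set_integrable_def lborel_prod case_prod_beta')
    note fub = lborel_pair.integral_snd[OF this] lborel_pair.integrable_snd[OF this]
    have inner: "(LINT x|lborel. indicator R (x, y) * \<bar>F (x, y)\<bar>) =
        indicator {c<..<d} y * integral {l y..u y} (\<lambda>x. \<bar>F (x, y)\<bar>)" for y
    proof (cases "y \<in> {c<..<d}")
      case True
      have cF: "continuous_on A (\<lambda>x. \<bar>F (x, y)\<bar>)" for A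
        by (intro continuous_intros continuous_on_compose2[OF F]) auto
      have si: "set_integrable lborel {l y<..<u y} (\<lambda>x. \<bar>F (x, y)\<bar>)"
        by (rule set_integrable_subset[OF borel_integrable_atLeastAtMost'[OF cF[of "{l y..u y}"]]]) auto
      have "(LINT x|lborel. indicator R (x, y) * \<bar>F (x, y)\<bar>) = (LINT x:{l y<..<u y}|lborel. \<bar>F (x, y)\<bar>)"
        unfolding set_lebesgue_integral_def using True
        by (intro Bochner_Integration.integral_cong) (auto simp: R indicator_def)
      also have "\<dots> = integral {l y<..<u y} (\<lambda>x. \<bar>F (x, y)\<bar>)"
        using si by (rule set_borel_integral_eq_integral)
      finally show ?thesis using True by (simp add: integral_open_interval_real)
    next
      case False
      then have "indicator R (x, y) * \<bar>F (x, y)\<bar> = 0" for x by (auto simp: R)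
      then have "(LINT x|lborel. indicator R (x, y) * \<bar>F (x, y)\<bar>) = 0"
        by (simp only: Bochner_Integration.integral_zero)
      then show ?thesis using False by simp
    qed
    show "integrable lborel (\<lambda>y. indicator {c<..<d} y * integral {l y..u y} (\<lambda>x. \<bar>F (x, y)\<bar>))"
      using fub(2) by (simp add: inner)
    show "(LINT p|lborel. indicator R p * \<bar>F p\<bar>) =
      (LINT y|lborel. indicator {c<..<d} y * integral {l y..u y} (\<lambda>x. \<bar>F (x, y)\<bar>))"
      using fub(1) by (simp add: inner lborel_prod case_prod_beta')
  qed
  have "(LINT y|lborel. indicator {c<..<d} y * ((u y - l y) * \<bar>f (z y, y)\<bar>))
      \<le> (LINT y|lborel. indicator {c<..<d} y * integral {l y..u y} (\<lambda>x. \<bar>f (x, y)\<bar>) +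
          M * (indicator {c<..<d} y * integral {l y..u y} (\<lambda>x. \<bar>D (x, y)\<bar>)))"
  proof (rule integral_mono)
    have "set_integrable lborel {c<..<d} (\<lambda>y. (u y - l y) * \<bar>f (z y, y)\<bar>)"
      by (rule set_integrable_subset[OF borel_integrable_atLeastAtMost'[of c d]])
        (auto intro!: continuous_intros continuous_on_compose2[OF f] continuous_on_compose2[OF cont(1)]
          continuous_on_compose2[OF cont(2)] continuous_on_compose2[OF cont(3)])
    then show "integrable lborel (\<lambda>y. indicator {c<..<d} y * ((u y - l y) * \<bar>f (z y, y)\<bar>))"
      by (simp add: set_integrable_def)
    show "integrable lborel (\<lambda>y. indicator {c<..<d} y * integral {l y..u y} (\<lambda>x. \<bar>f (x, y)\<bar>) +
          M * (indicator {c<..<d} y * integral {l y..u y} (\<lambda>x. \<bar>D (x, y)\<bar>)))"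
      using fub(1)[OF f] fub(1)[OF D] by (intro Bochner_Integration.integrable_add integrable_mult_right)
    show "indicator {c<..<d} y * ((u y - l y) * \<bar>f (z y, y)\<bar>) \<le>
        indicator {c<..<d} y * integral {l y..u y} (\<lambda>x. \<bar>f (x, y)\<bar>) +
          M * (indicator {c<..<d} y * integral {l y..u y} (\<lambda>x. \<bar>D (x, y)\<bar>))" for y
    proof (cases "y \<in> {c<..<d}")
      case True
      have "(u y - l y) * \<bar>f (z y, y)\<bar> \<le> integral {l y..u y} (\<lambda>x. \<bar>f (x, y)\<bar>) +
          (u y - l y) * integral {l y..u y} (\<lambda>x. \<bar>D (x, y)\<bar>)"
        using lu[OF True] deriv
        by (intro pointwise_bound_by_integrals continuous_on_compose2[OF D] continuous_intros) auto
      also have "(u y - l y) * integral {l y..u y} (\<lambda>x. \<bar>D (x, y)\<bar>) \<le> M * integral {l y..u y} (\<lambda>x. \<bar>D (x, y)\<bar>)"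
        using lu[OF True] by (intro mult_right_mono Henstock_Kurzweil_Integration.integral_nonneg
            integrable_continuous_real continuous_intros continuous_on_compose2[OF D]) auto
      finally show ?thesis using True by simp
    qed simp
  qed
  also have "\<dots> = (LINT p|lborel. indicator R p * \<bar>f p\<bar>) + M * (LINT p|lborel. indicator R p * \<bar>D p\<bar>)"
    using fub[OF f] fub[OF D] by simp
  finally show ?thesis .
qed

text \<open>Obtained by reflecting the region and both functions in the diagonal; it serves the
  horizontal edge of a triangular cell.\<close>

lemma wedge_estimate_swap:
  fixes f D :: "real \<times> real \<Rightarrow> real" and l u z :: "real \<Rightarrow> real"
  assumes f: "continuous_on UNIV f" and D: "continuous_on UNIV D"
    and deriv: "\<And>x y. ((\<lambda>y. f (x, y)) has_real_derivative D (x, y)) (at y)"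
    and cont: "continuous_on UNIV l" "continuous_on UNIV u" "continuous_on UNIV z"
    and lu: "\<And>x. x \<in> {c<..<d} \<Longrightarrow> l x < u x \<and> u x - l x \<le> M \<and> z x \<in> {l x..u x}"
    and R: "R = {(x, y). c < x \<and> x < d \<and> l x < y \<and> y < u x}" and bounded: "bounded R"
  shows "(LINT x|lborel. indicator {c<..<d} x * ((u x - l x) * \<bar>f (x, z x)\<bar>))
    \<le> (LINT p|lborel. indicator R p * \<bar>f p\<bar>) + M * (LINT p|lborel. indicator R p * \<bar>D p\<bar>)"
proof -
  define R' where "R' = prod.swap ` R"
  have R': "R' = {(y, x). c < x \<and> x < d \<and> l x < y \<and> y < u x}"
    unfolding R'_def R by (auto simp: image_iff)
  have "open R"
  proof -
    have "R = {p. c < fst p} \<inter> {p. fst p < d} \<inter> {p. l (fst p) < snd p} \<inter> {p. snd p < u (fst p)}"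
      by (auto simp: R)
    then show ?thesis
      by (simp only:) (intro open_Int open_Collect_less continuous_intros
          continuous_on_compose2[OF cont(1)] continuous_on_compose2[OF cont(2)]; simp)
  qed
  have "bounded (closure R)" using bounded by (rule bounded_closure)
  have "bounded R'"
  proof (rule bounded_subset)
    show "bounded (prod.swap ` closure R)" using bounded
      by (intro compact_imp_bounded compact_continuous_image continuous_intros) (simp add: compact_closure)
    show "R' \<subseteq> prod.swap ` closure R" unfolding R'_def by (intro image_mono closure_subset)
  qed
  have swap: "(LINT p|lborel. indicator R p * \<bar>F p\<bar>) = (LINT p|lborel. indicator R' p * \<bar>(F \<circ> prod.swap) p\<bar>)"
    if F: "continuous_on UNIV F" for F :: "real \<times> real \<Rightarrow> real"
  proof -
    have "(\<lambda>p. indicator R p * \<bar>F p\<bar>) \<in> borel_measurable borel"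
      using \<open>open R\<close> by (intro borel_measurable_times borel_measurable_indicator borel_measurable_abs
          borel_measurable_continuous_onI[OF F]) auto
    then have "(\<lambda>p. indicator R p * \<bar>F p\<bar>) \<in> borel_measurable (lborel \<Otimes>\<^sub>M lborel)"
      by (simp add: lborel_prod)
    from lborel_pair.integral_product_swap[OF this]
    have "(LINT p|lborel. indicator R p * \<bar>F p\<bar>) = (LINT (x, y)|lborel. indicator R (y, x) * \<bar>F (y, x)\<bar>)"
      by (simp add: lborel_prod)
    also have "\<dots> = (LINT p|lborel. indicator R' p * \<bar>(F \<circ> prod.swap) p\<bar>)"
      by (intro Bochner_Integration.integral_cong) (auto simp: R'_def indicator_def)
    finally show ?thesis .
  qed
  have "(LINT x|lborel. indicator {c<..<d} x * ((u x - l x) * \<bar>(f \<circ> prod.swap) (z x, x)\<bar>))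
    \<le> (LINT p|lborel. indicator R' p * \<bar>(f \<circ> prod.swap) p\<bar>) + M * (LINT p|lborel. indicator R' p * \<bar>(D \<circ> prod.swap) p\<bar>)"
  proof (rule wedge_estimate[OF _ _ _ cont lu R' \<open>bounded R'\<close>])
    show "continuous_on UNIV (f \<circ> prod.swap)" unfolding comp_def
      by (rule continuous_on_compose2[OF f]) (auto intro!: continuous_intros)
    show "continuous_on UNIV (D \<circ> prod.swap)" unfolding comp_def
      by (rule continuous_on_compose2[OF D]) (auto intro!: continuous_intros)
  qed (use deriv in auto)
  then show ?thesis unfolding swap[OF f] swap[OF D] by simp
qed

section \<open>Square integrable functions, gradients, and uniqueness of the trace of a
  constant\<close>

lemma L2_diff:
  assumes "f \<in> L2 M" "g \<in> L2 M" shows "(\<lambda>x. f x - g x) \<in> L2 M"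
proof -
  have meas: "f \<in> borel_measurable M" "g \<in> borel_measurable M" using assms by (auto simp: L2_def)
  have "integrable M (\<lambda>x. 2 * (norm (f x))\<^sup>2 + 2 * (norm (g x))\<^sup>2)" using assms by (simp add: L2_def)
  then have "integrable M (\<lambda>x. (norm (f x - g x))\<^sup>2)"
  proof (rule Bochner_Integration.integrable_bound)
    show "AE x in M. norm ((norm (f x - g x))\<^sup>2) \<le> norm (2 * (norm (f x))\<^sup>2 + 2 * (norm (g x))\<^sup>2)"
    proof (rule AE_I2)
      fix x
      have "(norm (f x - g x))\<^sup>2 \<le> (norm (f x) + norm (g x))\<^sup>2" by (intro power_mono norm_triangle_ineq4) simp
      also have "\<dots> \<le> 2 * (norm (f x))\<^sup>2 + 2 * (norm (g x))\<^sup>2"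
        using zero_le_power2[of "norm (f x) - norm (g x)"] by (simp add: power2_diff power2_sum)
      finally show "norm ((norm (f x - g x))\<^sup>2) \<le> norm (2 * (norm (f x))\<^sup>2 + 2 * (norm (g x))\<^sup>2)" by simp
    qed
  qed (use meas in measurable)
  then show ?thesis using meas by (simp add: L2_def)
qed

lemma (in finite_measure) L2_bounded:
  assumes "f \<in> borel_measurable M" "\<And>x. x \<in> space M \<Longrightarrow> norm (f x) \<le> B"
  shows "f \<in> L2 M"
proof -
  have "integrable M (\<lambda>x. (norm (f x))\<^sup>2)"
  proof (rule integrable_const_bound)
    show "AE x in M. norm ((norm (f x))\<^sup>2) \<le> B\<^sup>2" using assms by (auto intro!: AE_I2 power_mono)
  qed (use assms in measurable)
  then show ?thesis using assms by (simp add: L2_def)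
qed

text \<open>Follows from expanding the square of \<open>norm t - \<eta>\<close>. With
  \<open>\<eta>\<close> free, it takes the place of the Cauchy-Schwarz inequality in passing from
  convergence in L2 to convergence in L1.\<close>

lemma norm_le_square_bound: "0 < \<eta> \<Longrightarrow> norm t \<le> \<eta> + (norm t)\<^sup>2 / (\<eta> :: real)"
proof -
  assume "0 < \<eta>"
  have "0 \<le> norm t * \<eta>" using \<open>0 < \<eta>\<close> by simp
  then have "norm t * \<eta> \<le> \<eta>\<^sup>2 + (norm t)\<^sup>2"
    using zero_le_power2[of "norm t - \<eta>"] by (simp add: power2_diff)
  then show ?thesis using \<open>0 < \<eta>\<close> by (simp add: field_simps power2_eq_square)
qed

lemma (in finite_measure) L2_integrable_norm:
  assumes "f \<in> L2 M" shows "integrable M (\<lambda>x. norm (f x))"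
proof (rule Bochner_Integration.integrable_bound)
  show "integrable M (\<lambda>x. 1 + (norm (f x))\<^sup>2 / 1)" using assms by (simp add: L2_def)
  show "AE x in M. norm (norm (f x)) \<le> norm (1 + (norm (f x))\<^sup>2 / 1)"
    using norm_le_square_bound[of 1] by (intro AE_I2) (simp add: abs_of_nonneg)
qed (use assms in \<open>auto simp: L2_def intro: borel_measurable_norm\<close>)

lemma (in finite_measure) L2_tendsto_imp_L1_tendsto:
  assumes f: "\<And>n. f n \<in> L2 M" and lim: "(\<lambda>n. LINT x|M. (norm (f n x))\<^sup>2) \<longlonglongrightarrow> 0"
  shows "(\<lambda>n. LINT x|M. norm (f n x)) \<longlonglongrightarrow> 0"
proof (rule LIMSEQ_I)
  fix r :: real assume "0 < r"
  define \<mu> where "\<mu> = measure M (space M)"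
  \<comment> \<open>Splits \<open>r\<close> in halves: \<open>\<eta> * \<mu>\<close> is at most
    \<open>r / 2\<close>, and a square integral below \<open>\<eta> * (r / 2)\<close> contributes
    less than \<open>r / 2\<close>. The summand 1 keeps the divisor positive when the measure is
    zero.\<close>
  define \<eta> where "\<eta> = r / (2 * (\<mu> + 1))"
  have \<mu>: "0 \<le> \<mu>" by (simp add: \<mu>_def)
  have \<eta>: "0 < \<eta>" "\<eta> * \<mu> \<le> r / 2"
    using \<open>0 < r\<close> \<mu> by (auto simp: \<eta>_def field_simps)
  have "0 < \<eta> * (r / 2)" using \<eta> \<open>0 < r\<close> by simp
  from LIMSEQ_D[OF lim this] obtain no where
    no: "\<And>n. n \<ge> no \<Longrightarrow> \<bar>LINT x|M. (norm (f n x))\<^sup>2\<bar> < \<eta> * (r / 2)" by auto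
  have "norm ((LINT x|M. norm (f n x)) - 0) < r" if "n \<ge> no" for n
  proof -
    have i: "integrable M (\<lambda>x. (norm (f n x))\<^sup>2)" using f by (simp add: L2_def)
    have "(LINT x|M. norm (f n x)) \<le> (LINT x|M. \<eta> + (norm (f n x))\<^sup>2 / \<eta>)"
      using i by (intro integral_mono L2_integrable_norm f norm_le_square_bound \<eta>) auto
    also have "\<dots> = \<eta> * \<mu> + (LINT x|M. (norm (f n x))\<^sup>2) / \<eta>" using i by (simp add: \<mu>_def)
    also have "(LINT x|M. (norm (f n x))\<^sup>2) / \<eta> < r / 2"
      using no[OF that] \<eta> by (simp add: field_simps)
    finally show ?thesis using \<eta> by simp
  qed
  then show "\<exists>no. \<forall>n\<ge>no. norm ((LINT x|M. norm (f n x)) - 0) < r" by blast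
qed

lemma GDERIV_unique:
  assumes "GDERIV f x :> D" "GDERIV f x :> D'" shows "D = D'"
proof -
  have "(\<lambda>h. h \<bullet> D) = (\<lambda>h. h \<bullet> D')"
    using assms unfolding gderiv_def by (rule has_derivative_unique)
  then show ?thesis by (metis vector_eq_ldot)
qed

lemma smooth_continuous_gradient:
  assumes "smooth \<phi>" "\<And>x. GDERIV \<phi> x :> \<psi> x"
  shows "continuous_on UNIV \<psi>"
proof -
  have "C_k (Suc 0) \<phi>" using assms by (simp add: smooth_def)
  then obtain g where g: "\<And>x. GDERIV \<phi> x :> g x" "\<And>b. b \<in> Basis \<Longrightarrow> continuous_on UNIV (\<lambda>x. g x \<bullet> b)"
    by auto
  have "\<psi> = g" using GDERIV_unique[OF assms(2) g(1)] by (rule ext)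
  then show ?thesis using g(2) by (subst continuous_on_componentwise) simp
qed

lemma GDERIV_continuous:
  assumes "\<And>x. GDERIV \<phi> x :> \<psi> x" shows "continuous_on UNIV \<phi>"
  using assms unfolding gderiv_def by (meson continuous_at_imp_continuous_on has_derivative_continuous)

lemma GDERIV_partial:
  fixes \<phi> :: "real \<times> real \<Rightarrow> real"
  assumes "GDERIV \<phi> (x, y) :> d"
  shows "((\<lambda>x. \<phi> (x, y)) has_real_derivative fst d) (at x)"
    "((\<lambda>y. \<phi> (x, y)) has_real_derivative snd d) (at y)"
proof -
  have D: "(\<phi> has_derivative (\<lambda>h. h \<bullet> d)) (at (x, y))" using assms by (simp add: gderiv_def)
  have "((\<lambda>x. \<phi> (x, y)) has_derivative (\<lambda>t. (t, 0) \<bullet> d)) (at x)"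
    by (rule has_derivative_compose[where f = "\<lambda>x. (x, y)" and g = \<phi>]) (use D in \<open>auto intro!: derivative_eq_intros\<close>)
  moreover have "((\<lambda>y. \<phi> (x, y)) has_derivative (\<lambda>t. (0, t) \<bullet> d)) (at y)"
    by (rule has_derivative_compose[where f = "\<lambda>y. (x, y)" and g = \<phi>]) (use D in \<open>auto intro!: derivative_eq_intros\<close>)
  ultimately show "((\<lambda>x. \<phi> (x, y)) has_real_derivative fst d) (at x)"
    "((\<lambda>y. \<phi> (x, y)) has_real_derivative snd d) (at y)"
    by (auto simp: has_field_derivative_def inner_prod_def mult.commute fun_eq_iff elim!: has_derivative_eq_rhs)
qed

lemma continuous_L2_lebesgue_on:
  fixes f :: "'a::euclidean_space \<Rightarrow> 'b::euclidean_space"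
  assumes "continuous_on UNIV f" "bounded U" "U \<in> lmeasurable"
  shows "f \<in> L2 (lebesgue_on U)"
proof -
  have "compact (f ` closure U)"
    using assms by (intro compact_continuous_image continuous_on_subset[OF assms(1)]) (auto simp: compact_closure)
  then obtain B where "\<And>x. x \<in> closure U \<Longrightarrow> norm (f x) \<le> B"
    by (meson bounded_iff compact_imp_bounded image_eqI)
  then have "\<And>x. x \<in> U \<Longrightarrow> norm (f x) \<le> B" using closure_subset by blast
  moreover have "f \<in> borel_measurable (lebesgue_on U)"
    using borel_measurable_continuous_onI[OF assms(1)] by (intro measurable_restrict_space1 measurable_completion) simp
  ultimately show ?thesis
    by (intro finite_measure.L2_bounded[OF finite_measure_lebesgue_on[OF assms(3)], of _ B]) simp_all
qed

lemma continuous_L2_arclength: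
  fixes f :: "'a::euclidean_space \<Rightarrow> 'b::euclidean_space"
  assumes "continuous_on (closed_segment a b) f"
  shows "f \<in> L2 (arclength (closed_segment a b))"
proof -
  have "compact (f ` closed_segment a b)" using assms by (intro compact_continuous_image) auto
  then obtain B where "\<And>x. x \<in> closed_segment a b \<Longrightarrow> norm (f x) \<le> B"
    by (meson bounded_iff compact_imp_bounded image_eqI)
  then show ?thesis
    by (intro finite_measure.L2_bounded[OF finite_measure_arclength, of _ _ _ B] continuous_on_imp_measurable_arclength assms)
      (simp add: space_arclength)
qed

text \<open>Uniqueness of the trace of a constant, without knowing that its weak gradient \<open>G\<close> vanishes: the
  estimates on the thin sets \<open>R j\<close> bound the weighted deviation by the integral of \<open>norm G\<close> over \<open>R j\<close>.\<close>

lemma is_trace_of_constant_AE: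
  fixes a b :: "'a::euclidean_space" and R :: "nat \<Rightarrow> 'a set"
  assumes tr: "is_trace U (closed_segment a b) u g"
    and U: "U \<in> lmeasurable" "bounded U" and uc: "AE p in lebesgue_on U. u p = c"
    and k: "continuous_on (closed_segment a b) k" "\<And>p. p \<in> closed_segment a b \<Longrightarrow> 0 \<le> k p"
    and R: "\<And>j. R j \<in> sets lebesgue" "\<And>p. (\<lambda>j. indicator (R j) p :: real) \<longlonglongrightarrow> 0"
    and KM: "\<And>j. 0 \<le> K j" "0 \<le> M"
    and est: "\<And>j \<phi> \<psi>. (\<And>x. GDERIV \<phi> x :> \<psi> x) \<Longrightarrow> continuous_on UNIV \<psi> \<Longrightarrow>
      (LINT p|arclength (closed_segment a b). k p * \<bar>\<phi> p\<bar>) \<le>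
      K j * (LINT p|lebesgue_on U. indicator (R j) p * \<bar>\<phi> p\<bar>) +
      M * (LINT p|lebesgue_on U. indicator (R j) p * norm (\<psi> p))"
  shows "AE p in arclength (closed_segment a b). k p * \<bar>g p - c\<bar> = 0"
proof -
  define A where "A = arclength (closed_segment a b)"
  define \<nu> where "\<nu> = lebesgue_on U"
  interpret A: finite_measure A unfolding A_def by (rule finite_measure_arclength)
  interpret \<nu>: finite_measure \<nu> unfolding \<nu>_def by (rule finite_measure_lebesgue_on[OF U(1)])
  obtain G \<phi> \<psi> where u2: "u \<in> L2 \<nu>" and g2: "g \<in> L2 A" and G2: "G \<in> L2 \<nu>"
    and sm: "\<And>n. smooth (\<phi> n)" and gd: "\<And>n x. GDERIV (\<phi> n) x :> \<psi> n x"
    and lim1: "(\<lambda>n. LINT x|\<nu>. (\<phi> n x - u x)\<^sup>2) \<longlonglongrightarrow> 0"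
    and lim2: "(\<lambda>n. LINT x|\<nu>. (norm (\<psi> n x - G x))\<^sup>2) \<longlonglongrightarrow> 0"
    and lim3: "(\<lambda>n. LINT x|A. (\<phi> n x - g x)\<^sup>2) \<longlonglongrightarrow> 0"
    using tr unfolding is_trace_def A_def \<nu>_def by blast
  have c\<phi>: "continuous_on UNIV (\<phi> n)" and c\<psi>: "continuous_on UNIV (\<psi> n)" for n
    using gd sm GDERIV_continuous smooth_continuous_gradient by blast+
  have \<phi>u: "(\<lambda>x. \<phi> n x - u x) \<in> L2 \<nu>" and \<psi>G: "(\<lambda>x. \<psi> n x - G x) \<in> L2 \<nu>" and \<psi>2: "\<psi> n \<in> L2 \<nu>" for n
    using u2 G2 continuous_L2_lebesgue_on[OF c\<phi> U(2,1)] continuous_L2_lebesgue_on[OF c\<psi> U(2,1)]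
    by (auto simp: \<nu>_def intro: L2_diff)
  have \<phi>A: "\<phi> n \<in> L2 A" for n
    unfolding A_def by (intro continuous_L2_arclength continuous_on_subset[OF c\<phi>]) auto
  have cA: "(\<lambda>x. c) \<in> L2 A" unfolding A_def by (intro continuous_L2_arclength continuous_intros)
  have \<phi>g: "(\<lambda>x. \<phi> n x - g x) \<in> L2 A" for n using \<phi>A g2 by (rule L2_diff)
  have l1: "(\<lambda>n. LINT x|\<nu>. \<bar>\<phi> n x - u x\<bar>) \<longlonglongrightarrow> 0"
    using \<nu>.L2_tendsto_imp_L1_tendsto[OF \<phi>u] lim1 by simp
  have l2: "(\<lambda>n. LINT x|\<nu>. norm (\<psi> n x - G x)) \<longlonglongrightarrow> 0"
    using \<nu>.L2_tendsto_imp_L1_tendsto[OF \<psi>G] lim2 by simp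
  have l3: "(\<lambda>n. LINT x|A. \<bar>\<phi> n x - g x\<bar>) \<longlonglongrightarrow> 0"
    using A.L2_tendsto_imp_L1_tendsto[OF \<phi>g] lim3 by simp
  have "compact (k ` closed_segment a b)" using k(1) by (intro compact_continuous_image) auto
  then obtain B where B0: "\<And>p. p \<in> closed_segment a b \<Longrightarrow> norm (k p) \<le> B"
    by (meson bounded_iff compact_imp_bounded image_eqI)
  have "norm (k a) \<le> B" by (rule B0) simp
  then have "0 \<le> B" using norm_ge_zero order_trans by blast
  moreover have "k p \<le> B" if "p \<in> closed_segment a b" for p using B0[OF that] by simp
  ultimately have B: "0 \<le> B" "\<And>p. p \<in> closed_segment a b \<Longrightarrow> k p \<le> B" by auto
  have spA: "space A = closed_segment a b" by (simp add: A_def space_arclength)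
  have kA: "k \<in> borel_measurable A" unfolding A_def by (rule continuous_on_imp_measurable_arclength[OF k(1)])
  have intk: "integrable A (\<lambda>p. k p * \<bar>f p\<bar>)" if "f \<in> L2 A" for f :: "'a \<Rightarrow> real"
  proof (rule Bochner_Integration.integrable_bound)
    show "integrable A (\<lambda>p. B * norm (f p))" using A.L2_integrable_norm[OF that] by simp
    show "AE p in A. norm (k p * \<bar>f p\<bar>) \<le> norm (B * norm (f p))"
      using B k(2) spA by (intro AE_I2) (auto simp: abs_mult intro!: mult_right_mono)
    show "(\<lambda>p. k p * \<bar>f p\<bar>) \<in> borel_measurable A"
      using kA that by (intro borel_measurable_times borel_measurable_abs) (auto simp: L2_def)
  qed
  have Rm: "indicator (R j) \<in> borel_measurable \<nu>" for j
    unfolding \<nu>_def by (intro measurable_restrict_space1 borel_measurable_indicator R)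
  have intR: "integrable \<nu> (\<lambda>p. indicator (R j) p * f p)" if "integrable \<nu> f" for f :: "'a \<Rightarrow> real" and j
  proof (rule Bochner_Integration.integrable_bound[OF that])
    show "(\<lambda>p. indicator (R j) p * f p) \<in> borel_measurable \<nu>"
      using Rm that by (intro borel_measurable_times) auto
  qed (auto intro!: AE_I2 simp: indicator_def)
  have gc: "(\<lambda>x. g x - c) \<in> L2 A" using g2 cA by (rule L2_diff)
  define I where "I = (LINT p|A. k p * \<bar>g p - c\<bar>)"
  \<comment> \<open>With \<open>j\<close> fixed, \<open>n\<close> tends to infinity first:
    \<open>g\<close> is approximated by \<open>\<phi> n\<close>, the constant is \<open>u\<close>
    almost everywhere, and \<open>\<psi> n\<close> tends to \<open>G\<close>. The factor
    \<open>K j\<close> multiplies only an error that vanishes in this limit, so it may be as large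
    as it likes when \<open>j\<close> grows.\<close>
  have step: "I \<le> M * (LINT p|\<nu>. indicator (R j) p * norm (G p))" for j
  proof -
    have le: "I \<le> M * (LINT p|\<nu>. indicator (R j) p * norm (G p)) +
        (K j * (LINT x|\<nu>. \<bar>\<phi> n x - u x\<bar>) + M * (LINT x|\<nu>. norm (\<psi> n x - G x)) + B * (LINT x|A. \<bar>\<phi> n x - g x\<bar>))" for n
    proof -
      have "I \<le> (LINT p|A. k p * \<bar>\<phi> n p - c\<bar> + B * \<bar>\<phi> n p - g p\<bar>)"
        unfolding I_def
      proof (rule integral_mono)
        show "integrable A (\<lambda>p. k p * \<bar>g p - c\<bar>)" by (rule intk[OF gc])
        show "integrable A (\<lambda>p. k p * \<bar>\<phi> n p - c\<bar> + B * \<bar>\<phi> n p - g p\<bar>)"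
          using intk[OF L2_diff[OF \<phi>A cA]] A.L2_integrable_norm[OF \<phi>g] by auto
        show "k p * \<bar>g p - c\<bar> \<le> k p * \<bar>\<phi> n p - c\<bar> + B * \<bar>\<phi> n p - g p\<bar>" if "p \<in> space A" for p
        proof -
          have "k p * \<bar>g p - c\<bar> \<le> k p * (\<bar>\<phi> n p - c\<bar> + \<bar>\<phi> n p - g p\<bar>)"
            using k(2) that spA by (intro mult_left_mono) auto
          also have "\<dots> \<le> k p * \<bar>\<phi> n p - c\<bar> + B * \<bar>\<phi> n p - g p\<bar>"
            using B(2) that spA by (simp add: distrib_left mult_right_mono)
          finally show ?thesis .
        qed
      qed
      also have "\<dots> = (LINT p|A. k p * \<bar>\<phi> n p - c\<bar>) + B * (LINT x|A. \<bar>\<phi> n x - g x\<bar>)"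
        using intk[OF L2_diff[OF \<phi>A cA]] A.L2_integrable_norm[OF \<phi>g] by simp
      also have "(LINT p|A. k p * \<bar>\<phi> n p - c\<bar>) \<le>
          K j * (LINT p|\<nu>. indicator (R j) p * \<bar>\<phi> n p - c\<bar>) + M * (LINT p|\<nu>. indicator (R j) p * norm (\<psi> n p))"
        unfolding A_def \<nu>_def
      proof (rule est)
        have "GDERIV (\<lambda>p. \<phi> n p - c) x :> \<psi> n x - 0" for x
          by (intro GDERIV_diff gd GDERIV_const)
        then show "GDERIV (\<lambda>p. \<phi> n p - c) x :> \<psi> n x" for x by simp
      qed (rule c\<psi>)
      also have "(LINT p|\<nu>. indicator (R j) p * \<bar>\<phi> n p - c\<bar>) \<le> (LINT x|\<nu>. \<bar>\<phi> n x - u x\<bar>)"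
      proof -
        have "(LINT p|\<nu>. indicator (R j) p * \<bar>\<phi> n p - c\<bar>) \<le> (LINT p|\<nu>. \<bar>\<phi> n p - c\<bar>)"
        proof (rule integral_mono)
          have "(\<lambda>p. \<phi> n p - c) \<in> L2 \<nu>"
            unfolding \<nu>_def by (intro continuous_L2_lebesgue_on U continuous_intros c\<phi>)
          from \<nu>.L2_integrable_norm[OF this] show i: "integrable \<nu> (\<lambda>p. \<bar>\<phi> n p - c\<bar>)" by simp
          show "integrable \<nu> (\<lambda>p. indicator (R j) p * \<bar>\<phi> n p - c\<bar>)" by (rule intR[OF i])
        qed (simp add: indicator_def)
        also have "\<dots> = (LINT x|\<nu>. \<bar>\<phi> n x - u x\<bar>)"
        proof (rule integral_cong_AE)
          show "(\<lambda>x. \<bar>\<phi> n x - u x\<bar>) \<in> borel_measurable \<nu>" using \<nu>.L2_integrable_norm[OF \<phi>u[of n]] by auto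
          show "(\<lambda>p. \<bar>\<phi> n p - c\<bar>) \<in> borel_measurable \<nu>"
          proof -
            have "(\<lambda>p. \<bar>\<phi> n p - c\<bar>) \<in> borel_measurable borel"
              by (intro borel_measurable_continuous_onI continuous_intros c\<phi>)
            then show ?thesis
              unfolding \<nu>_def by (intro measurable_restrict_space1 measurable_completion) simp
          qed
          show "AE p in \<nu>. \<bar>\<phi> n p - c\<bar> = \<bar>\<phi> n p - u p\<bar>"
            using uc unfolding \<nu>_def by (rule eventually_mono) simp
        qed
        finally show ?thesis .
      qed
      also have "(LINT p|\<nu>. indicator (R j) p * norm (\<psi> n p)) \<le>
          (LINT p|\<nu>. indicator (R j) p * norm (G p)) + (LINT x|\<nu>. norm (\<psi> n x - G x))"
      proof -
        have "(LINT p|\<nu>. indicator (R j) p * norm (\<psi> n p)) \<le>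
            (LINT p|\<nu>. indicator (R j) p * norm (G p) + norm (\<psi> n p - G p))"
        proof (rule integral_mono)
          show "indicator (R j) p * norm (\<psi> n p) \<le> indicator (R j) p * norm (G p) + norm (\<psi> n p - G p)" for p
            using norm_triangle_sub[of "\<psi> n p" "G p"] by (simp add: indicator_def)
        qed (intro Bochner_Integration.integrable_add intR \<nu>.L2_integrable_norm \<psi>2 G2 \<psi>G)+
        also have "\<dots> = (LINT p|\<nu>. indicator (R j) p * norm (G p)) + (LINT x|\<nu>. norm (\<psi> n x - G x))"
          by (intro Bochner_Integration.integral_add intR \<nu>.L2_integrable_norm \<psi>2 G2 \<psi>G)
        finally show ?thesis .
      qed
      finally show ?thesis using KM by (simp add: mult_left_mono distrib_left add.assoc add.commute add.left_commute)
    qed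
    have "(\<lambda>n. M * (LINT p|\<nu>. indicator (R j) p * norm (G p)) +
        (K j * (LINT x|\<nu>. \<bar>\<phi> n x - u x\<bar>) + M * (LINT x|\<nu>. norm (\<psi> n x - G x)) + B * (LINT x|A. \<bar>\<phi> n x - g x\<bar>)))
        \<longlonglongrightarrow> M * (LINT p|\<nu>. indicator (R j) p * norm (G p)) + (K j * 0 + M * 0 + B * 0)"
      by (intro tendsto_intros l1 l2 l3)
    then show ?thesis using le by (intro LIMSEQ_le_const) auto
  qed
  \<comment> \<open>Only now \<open>j\<close> grows: the sets \<open>R j\<close> disappear
    pointwise, and the integrable function \<open>norm (G p)\<close> dominates.\<close>
  have "(\<lambda>j. LINT p|\<nu>. indicator (R j) p * norm (G p)) \<longlonglongrightarrow> (LINT p|\<nu>. 0)"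
  proof (rule integral_dominated_convergence[where w = "\<lambda>p. norm (G p)"])
    show "integrable \<nu> (\<lambda>p. norm (G p))" by (rule \<nu>.L2_integrable_norm[OF G2])
    show "(\<lambda>p. indicator (R j) p * norm (G p)) \<in> borel_measurable \<nu>" for j
      by (rule borel_measurable_integrable[OF intR[OF \<nu>.L2_integrable_norm[OF G2]]])
    show "AE p in \<nu>. (\<lambda>j. indicator (R j) p * norm (G p)) \<longlonglongrightarrow> 0"
      using tendsto_mult_left_zero[OF R(2)] by (intro AE_I2)
  qed (auto simp: indicator_def)
  then have "(\<lambda>j. M * (LINT p|\<nu>. indicator (R j) p * norm (G p))) \<longlonglongrightarrow> M * 0"
    by (intro tendsto_intros) simp
  then have "I \<le> M * 0" by (rule LIMSEQ_le_const) (use step in auto)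
  moreover have nn: "AE p in A. 0 \<le> k p * \<bar>g p - c\<bar>" using k(2) spA by (intro AE_I2) auto
  then have "0 \<le> I" unfolding I_def by (rule integral_nonneg_AE)
  ultimately have "I = 0" by simp
  then show ?thesis
    using integral_nonneg_eq_0_iff_AE[OF intk[OF gc] nn] unfolding I_def A_def by blast
qed

section \<open>Existence of the trace of a constant\<close>

lemma integral_partial_compact_support:
  fixes f D :: "real \<times> real \<Rightarrow> real"
  assumes deriv: "\<And>x y. ((\<lambda>x. f (x, y)) has_real_derivative D (x, y)) (at x)"
    and D: "integrable lborel D" "continuous_on UNIV D"
    and supp: "\<And>x y. B \<le> \<bar>x\<bar> \<Longrightarrow> f (x, y) = 0" "\<And>x y. B \<le> \<bar>x\<bar> \<Longrightarrow> D (x, y) = 0" and B: "0 < B"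
  shows "(LINT p|lborel. D p) = 0"
proof -
  have "integrable (lborel \<Otimes>\<^sub>M lborel) (case_prod (\<lambda>x y. D (x, y)))" using D by (simp add: lborel_prod)
  from lborel_pair.integral_snd[OF this]
  have "(LINT p|lborel. D p) = (LINT y|lborel. LINT x|lborel. D (x, y))" by (simp add: lborel_prod)
  also have "\<dots> = 0"
  proof -
    have "(LINT x|lborel. D (x, y)) = 0" for y
    proof -
      have cD: "continuous_on {- B..B} (\<lambda>x. D (x, y))" by (intro continuous_on_compose2[OF D(2)] continuous_intros) auto
      have "D (x, y) = indicator {- B..B} x *\<^sub>R D (x, y)" for x
        using supp(2)[of x y] by (cases "B \<le> \<bar>x\<bar>") (auto simp: indicator_def)
      then have "(LINT x|lborel. D (x, y)) = (LINT x:{- B..B}|lborel. D (x, y))"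
        unfolding set_lebesgue_integral_def by presburger
      also have "\<dots> = integral {- B..B} (\<lambda>x. D (x, y))"
        by (rule set_borel_integral_eq_integral[OF borel_integrable_atLeastAtMost'[OF cD]])
      also have "\<dots> = f (B, y) - f (- B, y)"
        using B deriv by (intro integral_unique fundamental_theorem_of_calculus)
          (auto simp: has_real_derivative_iff_has_vector_derivative intro: has_vector_derivative_at_within)
      finally show ?thesis using supp B by simp
    qed
    then show ?thesis by simp
  qed
  finally show ?thesis .
qed

text \<open>This makes the zero field a weak gradient of a constant. Each partial derivative has
  integral 0 along its own lines by the fundamental theorem of calculus, as a test function vanishes
  far out; the second one is reduced to the first by a swap.\<close>

lemma integral_gradient_test_function:
  fixes \<phi> :: "real \<times> real \<Rightarrow> real"
  assumes t: "test_function U \<phi>" and g: "\<And>x. GDERIV \<phi> x :> g x" and U: "U \<in> sets lebesgue"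
  shows "(LINT p|lebesgue_on U. g p) = 0"
proof -
  define S where "S = closure {x. \<phi> x \<noteq> 0}"
  have S: "compact S" "S \<subseteq> U" using t by (auto simp: test_function_def S_def)
  have "smooth \<phi>" using t by (simp add: test_function_def)
  then have cg: "continuous_on UNIV g" by (rule smooth_continuous_gradient) (rule g)
  have \<phi>0: "\<phi> p = 0" if "p \<notin> S" for p using that closure_subset[of "{x. \<phi> x \<noteq> 0}"] by (auto simp: S_def)
  have g0: "g p = 0" if "p \<notin> S" for p
  proof -
    have "GDERIV (\<lambda>x. 0) p :> g p"
      using g[of p] \<phi>0 that compact_imp_closed[OF S(1)] unfolding gderiv_def
      by (elim has_derivative_transform_within_open[of \<phi> _ p _ "- S"]) (auto simp: open_Compl)
    then show ?thesis using GDERIV_unique GDERIV_const by blast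
  qed
  have intg: "integrable lborel g"
  proof -
    have "integrable lborel (\<lambda>p. indicator S p *\<^sub>R g p)"
      by (intro borel_integrable_compact S continuous_on_subset[OF cg]) auto
    moreover have "(\<lambda>p. indicator S p *\<^sub>R g p) = g" using g0 by (auto simp: indicator_def)
    ultimately show ?thesis by simp
  qed
  obtain B where B: "0 < B" "\<And>p. p \<in> S \<Longrightarrow> norm p < B"
    using S(1) compact_imp_bounded bounded_pos_less by metis
  have out: "(x, y) \<notin> S" if "B \<le> \<bar>x\<bar> \<or> B \<le> \<bar>y\<bar>" for x y
    using that B(2)[of "(x, y)"] norm_fst_le[of x y] norm_snd_le[of y x] by force
  have "(LINT p|lborel. fst (g p)) = 0"
    by (rule integral_partial_compact_support[of \<phi> _ B])
      (use GDERIV_partial(1)[OF g] intg cg out \<phi>0 g0 B in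
        \<open>auto intro!: continuous_intros integrable_fst integrable_bounded_linear[OF bounded_linear_fst]\<close>)
  moreover have "(LINT p|lborel. snd (g p)) = 0"
  proof -
    have "(\<lambda>p. snd (g p)) \<in> borel_measurable (lborel \<Otimes>\<^sub>M lborel)"
      using borel_measurable_continuous_onI[OF continuous_on_snd[OF cg]] by (simp add: lborel_prod)
    from lborel_pair.integral_product_swap[OF this]
    have "(LINT p|lborel. snd (g p)) = (LINT p|lborel. snd (g (prod.swap p)))"
      by (simp add: lborel_prod case_prod_beta' prod.swap_def)
    also have "\<dots> = 0"
    proof (rule integral_partial_compact_support[of "\<phi> \<circ> prod.swap" _ B])
      show "((\<lambda>x. (\<phi> \<circ> prod.swap) (x, y)) has_real_derivative snd (g (prod.swap (x, y)))) (at x)" for x y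
        using GDERIV_partial(2)[OF g] by simp
      show cs: "continuous_on UNIV (\<lambda>p. snd (g (prod.swap p)))"
        by (intro continuous_on_snd continuous_on_compose2[OF cg] continuous_intros) auto
      have "compact (prod.swap ` S)" by (intro compact_continuous_image S continuous_intros)
      then have "integrable lborel (\<lambda>p. indicator (prod.swap ` S) p *\<^sub>R snd (g (prod.swap p)))"
        by (intro borel_integrable_compact continuous_on_subset[OF cs]) auto
      moreover have "(\<lambda>p. indicator (prod.swap ` S) p *\<^sub>R snd (g (prod.swap p))) = (\<lambda>p. snd (g (prod.swap p)))"
      proof
        fix p :: "real \<times> real"
        have "prod.swap p \<notin> S" if "p \<notin> prod.swap ` S" using that by (metis image_eqI swap_swap)
        then show "indicator (prod.swap ` S) p *\<^sub>R snd (g (prod.swap p)) = snd (g (prod.swap p))"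
          using g0[of "prod.swap p"] by (auto simp: indicator_def)
      qed
      ultimately show "integrable lborel (\<lambda>p. snd (g (prod.swap p)))" by simp
    qed (use out \<phi>0 g0 B in auto)
    finally show ?thesis .
  qed
  ultimately have "fst (LINT p|lborel. g p) = 0" "snd (LINT p|lborel. g p) = 0"
    using integral_bounded_linear[OF bounded_linear_fst intg] integral_bounded_linear[OF bounded_linear_snd intg]
    by simp_all
  then have "(LINT p|lborel. g p) = 0" by (simp add: prod_eq_iff)
  moreover have "(LINT p|lebesgue_on U. g p) = (LINT p|lebesgue. indicator U p *\<^sub>R g p)"
    using U by (subst integral_restrict_space) auto
  moreover have "(\<lambda>p. indicator U p *\<^sub>R g p) = g"
  proof
    show "indicator U p *\<^sub>R g p = g p" for p using g0[of p] S(2) by (cases "p \<in> U") auto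
  qed
  moreover have "(LINT p|lebesgue. g p) = (LINT p|lborel. g p)"
    using intg by (intro integral_completion) auto
  ultimately show ?thesis by simp
qed

lemma smooth_const: "smooth (\<lambda>x. c)"
proof -
  have "C_k k (\<lambda>x::'a::euclidean_space. c)" for k and c :: real
    by (induction k arbitrary: c) (auto intro!: exI[of _ "\<lambda>x. 0"] GDERIV_const)
  then show ?thesis by (simp add: smooth_def)
qed

text \<open>The constant function serves as its own approximating sequence. This guarantees that the
  \<open>SOME\<close> in \<open>trace\<close> picks a genuine trace, to which the uniqueness result
  can then be applied.\<close>

lemma is_trace_const:
  fixes U :: "(real \<times> real) set"
  assumes U: "U \<in> sets lebesgue" and u: "u \<in> L2 (lebesgue_on U)" and c: "AE p in lebesgue_on U. u p = c"
  shows "is_trace U (closed_segment a b) u (\<lambda>p. c)"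
  unfolding is_trace_def
proof (intro conjI bexI[of _ "\<lambda>p. 0"] exI[of _ "\<lambda>n p. c"] exI[of _ "\<lambda>n p. 0"] allI)
  show "u \<in> L2 (lebesgue_on U)" by (rule u)
  show "(\<lambda>p. c) \<in> L2 (arclength (closed_segment a b))"
    by (intro continuous_L2_arclength continuous_intros)
  show "smooth (\<lambda>p. c)" by (rule smooth_const)
  show "GDERIV (\<lambda>p. c) x :> 0" for x by (rule GDERIV_const)
  have um: "u \<in> borel_measurable (lebesgue_on U)" using u by (simp add: L2_def)
  have "(LINT x|lebesgue_on U. (c - u x)\<^sup>2) = (LINT x|lebesgue_on U. 0)"
    using c um by (intro integral_cong_AE) (auto elim!: eventually_mono)
  then show "(\<lambda>n. LINT x|lebesgue_on U. (c - u x)\<^sup>2) \<longlonglongrightarrow> 0" by simp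
  show "weak_gradient U u (\<lambda>p. 0)"
    unfolding weak_gradient_def
  proof (intro allI impI)
    fix \<phi> g assume *: "test_function U \<phi> \<and> (\<forall>x. GDERIV \<phi> x :> g x)"
    have "smooth \<phi>" using * by (simp add: test_function_def)
    then have cg: "continuous_on UNIV g" by (rule smooth_continuous_gradient) (use * in blast)
    have gm: "g \<in> borel_measurable (lebesgue_on U)"
      using borel_measurable_continuous_onI[OF cg] by (intro measurable_restrict_space1 measurable_completion) simp
    have "(LINT x|lebesgue_on U. u x *\<^sub>R g x) = (LINT x|lebesgue_on U. c *\<^sub>R g x)"
      using c um gm by (intro integral_cong_AE) (auto elim!: eventually_mono)
    also have "\<dots> = 0" using integral_gradient_test_function[of U \<phi> g] * U by simp
    finally show "(LINT x|lebesgue_on U. u x *\<^sub>R g x) = - (LINT x|lebesgue_on U. \<phi> x *\<^sub>R 0)" by simp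
  qed
qed (simp_all add: L2_def)

section \<open>Traces of constants on the edges of a triangle, by shrinking wedges\<close>

lemma lborel_integral_Icc_Ioo:
  fixes F :: "real \<Rightarrow> real"
  assumes "continuous_on UNIV F"
  shows "(LINT y|lborel. indicator {a..b} y * F y) = (LINT y|lborel. indicator {a<..<b} y * F y)"
proof (rule integral_cong_AE)
  have F: "F \<in> borel_measurable borel" by (rule borel_measurable_continuous_onI[OF assms])
  show "(\<lambda>y. indicator {a..b} y * F y) \<in> borel_measurable lborel"
    "(\<lambda>y. indicator {a<..<b} y * F y) \<in> borel_measurable lborel" using F by auto
  have "AE y in lborel. y \<noteq> a" "AE y in lborel. y \<noteq> b" by (rule AE_lborel_singleton)+
  then show "AE y in lborel. indicator {a..b} y * F y = indicator {a<..<b} y * F y"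
    by eventually_elim (auto simp: indicator_def)
qed

lemma lebesgue_on_indicator_integral:
  fixes F :: "'a::euclidean_space \<Rightarrow> real"
  assumes "U \<in> sets lebesgue" "R \<in> sets borel" "R \<subseteq> U" "continuous_on UNIV F"
  shows "(LINT p|lebesgue_on U. indicator R p * F p) = (LINT p|lborel. indicator R p * F p)"
proof -
  have m: "(\<lambda>p. indicator R p * F p) \<in> borel_measurable lborel"
    using assms(2) borel_measurable_continuous_onI[OF assms(4)] by simp
  have "(LINT p|lebesgue_on U. indicator R p * F p) = (LINT p|lebesgue. indicator U p *\<^sub>R (indicator R p * F p))"
    using assms(1) by (subst integral_restrict_space) auto
  also have "(\<lambda>p. indicator U p *\<^sub>R (indicator R p * F p)) = (\<lambda>p. indicator R p * F p)"
  proof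
    show "indicator U p *\<^sub>R (indicator R p * F p) = indicator R p * F p" for p
      using assms(3) by (cases "p \<in> R") auto
  qed
  finally show ?thesis using m by (simp add: integral_completion)
qed

text \<open>\<open>t\<close> is the distance of \<open>p\<close> from the edge, which does not
  depend on \<open>j\<close>, while the width of the wedge at \<open>p\<close> tends to 0; so
  \<open>p\<close> lies in only finitely many wedges.\<close>

lemma indicator_wedge_tendsto_0:
  fixes s t d :: real
  assumes "\<And>j. p \<in> R j \<Longrightarrow> 0 < t \<and> t < d / real (Suc j) * s"
  shows "(\<lambda>j. indicator (R j) p :: real) \<longlonglongrightarrow> 0"
proof -
  have "(\<lambda>j. d * s * inverse (real (Suc j))) \<longlonglongrightarrow> d * s * 0"
    by (intro tendsto_mult tendsto_const LIMSEQ_inverse_real_of_nat)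
  then have lim: "(\<lambda>j. d / real (Suc j) * s) \<longlonglongrightarrow> 0" by (simp add: field_simps)
  have "\<forall>\<^sub>F j in sequentially. p \<notin> R j"
  proof (cases "0 < t")
    case True
    from order_tendstoD(2)[OF lim True] show ?thesis
      by (rule eventually_mono) (use assms in force)
  next
    case False
    then have "p \<notin> R j" for j using assms by blast
    then show ?thesis by simp
  qed
  then have "\<forall>\<^sub>F j in sequentially. indicator (R j) p = (0 :: real)" by (rule eventually_mono) simp
  then show ?thesis by (rule tendsto_eventually)
qed

text \<open>A wedge estimate is divided by its scale \<open>\<delta> j\<close>. The value term gets
  the factor \<open>1 / \<delta> j\<close>, which may blow up, whereas in the derivative term the
  scale cancels and leaves \<open>M\<close>, independent of \<open>j\<close>. \<open>D\<close>
  selects the partial derivative across the edge.\<close>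

lemma trace_of_constant_wedges:
  fixes E :: "(real \<times> real) set" and R :: "nat \<Rightarrow> (real \<times> real) set"
  assumes tr: "is_trace E (closed_segment a b) u g" and E: "open E" "bounded E"
    and c: "AE p in lebesgue_on E. u p = c0"
    and k: "continuous_on (closed_segment a b) k" "\<And>p. p \<in> closed_segment a b \<Longrightarrow> 0 \<le> k p"
    and R: "\<And>j. open (R j)" "\<And>j. R j \<subseteq> E" "\<And>p. (\<lambda>j. indicator (R j) p :: real) \<longlonglongrightarrow> 0"
    and \<delta>: "\<And>j. 0 < \<delta> j" and M: "0 \<le> M"
    and D: "\<And>v. \<bar>D v\<bar> \<le> norm v" "continuous_on UNIV D"
    and est: "\<And>j \<phi> \<psi>. (\<And>x. GDERIV \<phi> x :> \<psi> x) \<Longrightarrow> continuous_on UNIV \<phi> \<Longrightarrow> continuous_on UNIV \<psi> \<Longrightarrow>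
      \<delta> j * (LINT p|arclength (closed_segment a b). k p * \<bar>\<phi> p\<bar>) \<le>
      (LINT p|lborel. indicator (R j) p * \<bar>\<phi> p\<bar>) + (\<delta> j * M) * (LINT p|lborel. indicator (R j) p * \<bar>D (\<psi> p)\<bar>)"
  shows "AE p in arclength (closed_segment a b). k p * \<bar>g p - c0\<bar> = 0"
proof -
  have Elm: "E \<in> lmeasurable" using E by (simp add: lmeasurable_open)
  show ?thesis
  proof (rule is_trace_of_constant_AE[OF tr Elm E(2) c k _ R(3), where K = "\<lambda>j. 1 / \<delta> j" and M = M])
    show "R j \<in> sets lebesgue" for j using R(1) by simp
    show "0 \<le> 1 / \<delta> j" for j using \<delta>[of j] by simp
    fix j and \<phi> :: "real \<times> real \<Rightarrow> real" and \<psi>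
    assume gd: "\<And>x. GDERIV \<phi> x :> \<psi> x" and c\<psi>: "continuous_on UNIV \<psi>"
    define S N I where "S = (LINT p|arclength (closed_segment a b). k p * \<bar>\<phi> p\<bar>)"
      and "N = (LINT p|lebesgue_on E. indicator (R j) p * norm (\<psi> p))"
      and "I = (LINT p|lebesgue_on E. indicator (R j) p * \<bar>\<phi> p\<bar>)"
    have c\<phi>: "continuous_on UNIV \<phi>" by (rule GDERIV_continuous[OF gd])
    have cD: "continuous_on UNIV (\<lambda>p. D (\<psi> p))" by (rule continuous_on_compose2[OF D(2) c\<psi>]) simp
    have "\<delta> j * S \<le> (LINT p|lborel. indicator (R j) p * \<bar>\<phi> p\<bar>) +
        (\<delta> j * M) * (LINT p|lborel. indicator (R j) p * \<bar>D (\<psi> p)\<bar>)"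
      unfolding S_def by (rule est[OF gd c\<phi> c\<psi>])
    also have "(LINT p|lborel. indicator (R j) p * \<bar>\<phi> p\<bar>) = I"
      unfolding I_def using E R by (intro lebesgue_on_indicator_integral[symmetric] continuous_intros c\<phi>) auto
    also have "(LINT p|lborel. indicator (R j) p * \<bar>D (\<psi> p)\<bar>) = (LINT p|lebesgue_on E. indicator (R j) p * \<bar>D (\<psi> p)\<bar>)"
      using E R by (intro lebesgue_on_indicator_integral[symmetric] continuous_intros cD) auto
    also have "\<dots> \<le> N"
      unfolding N_def
    proof (rule integral_mono)
      have i: "integrable (lebesgue_on E) (\<lambda>p. indicator (R j) p * norm (F p))"
        if "continuous_on UNIV F" for F :: "real \<times> real \<Rightarrow> 'b::euclidean_space"
      proof (rule Bochner_Integration.integrable_bound)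
        show "integrable (lebesgue_on E) (\<lambda>p. norm (F p))"
          by (rule finite_measure.L2_integrable_norm[OF finite_measure_lebesgue_on[OF Elm]
                continuous_L2_lebesgue_on[OF that E(2) Elm]])
        show "(\<lambda>p. indicator (R j) p * norm (F p)) \<in> borel_measurable (lebesgue_on E)"
          using R(1) borel_measurable_continuous_onI[OF that]
          by (intro measurable_restrict_space1 measurable_completion) auto
      qed (auto intro!: AE_I2 simp: indicator_def)
      show "integrable (lebesgue_on E) (\<lambda>p. indicator (R j) p * norm (\<psi> p))" by (rule i[OF c\<psi>])
      show "integrable (lebesgue_on E) (\<lambda>p. indicator (R j) p * \<bar>D (\<psi> p)\<bar>)" using i[OF cD] by simp
      show "indicator (R j) p * \<bar>D (\<psi> p)\<bar> \<le> indicator (R j) p * norm (\<psi> p)" for p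
        using D(1)[of "\<psi> p"] by (simp add: indicator_def)
    qed
    finally have "\<delta> j * S \<le> I + \<delta> j * M * N" using \<delta>[of j] M by (simp add: mult_left_mono)
    then have "S \<le> (I + \<delta> j * M * N) / \<delta> j" using \<delta>[of j] by (simp add: pos_le_divide_eq mult.commute)
    also have "\<dots> = 1 / \<delta> j * I + M * N" using \<delta>[of j] by (simp add: add_divide_distrib)
    finally show "S \<le> 1 / \<delta> j * I + M * N" .
  qed (use M in auto)
qed

text \<open>The sets \<open>R j\<close> are wedges along the edge that stay inside \<open>E\<close>; their width vanishes at one end
  point, which is why the weight does.\<close>

lemma trace_of_constant_vertical:
  fixes E :: "(real \<times> real) set"
  assumes tr: "is_trace E (closed_segment (a, y1) (a, y2)) u g" and y: "y1 < y2"
    and E: "open E" "bounded E" and c: "AE p in lebesgue_on E. u p = c0"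
    and d: "0 < d" and wedge: "\<And>x y. y1 < y \<Longrightarrow> y < y2 \<Longrightarrow> a < x \<Longrightarrow> x < a + d * (y - y1) \<Longrightarrow> (x, y) \<in> E"
  shows "AE p in arclength (closed_segment (a, y1) (a, y2)). g p = c0"
proof -
  let ?e = "closed_segment (a, y1) (a, y2)"
  define R where "R j = {(x, y). y1 < y \<and> y < y2 \<and> a < x \<and> x < a + d / real (Suc j) * (y - y1)}" for j
  have RE: "R j \<subseteq> E" for j
  proof -
    have "(x, y) \<in> E" if "y1 < y" "y < y2" "a < x" "x < a + d / real (Suc j) * (y - y1)" for x y
    proof -
      have "d / real (Suc j) \<le> d" using d by (simp add: field_simps)
      then have "d / real (Suc j) * (y - y1) \<le> d * (y - y1)" using that by (intro mult_right_mono) auto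
      then show ?thesis using that by (intro wedge) auto
    qed
    then show ?thesis by (auto simp: R_def)
  qed
  have Ropen: "open (R j)" for j
  proof -
    have "R j = {p. y1 < snd p} \<inter> {p. snd p < y2} \<inter> {p. a < fst p} \<inter> {p. fst p < a + d / real (Suc j) * (snd p - y1)}"
      by (auto simp: R_def)
    then show ?thesis by (simp only:) (intro open_Int open_Collect_less continuous_intros)
  qed
  have "AE p in arclength ?e. (snd p - y1) * \<bar>g p - c0\<bar> = 0"
  proof (rule trace_of_constant_wedges[OF tr E c _ _ Ropen RE, where \<delta> = "\<lambda>j. d / real (Suc j)" and M = "y2 - y1" and D = fst])
    show "continuous_on ?e (\<lambda>p. snd p - y1)" by (intro continuous_intros)
    show "0 \<le> snd p - y1" if "p \<in> ?e" for p using that y by (auto simp: closed_segment_vertical)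
    show "\<bar>fst v\<bar> \<le> norm v" for v :: "real \<times> real"
      using norm_fst_le[of "fst v" "snd v"] by simp
    show "(\<lambda>j. indicator (R j) p :: real) \<longlonglongrightarrow> 0" for p
      by (rule indicator_wedge_tendsto_0[where t = "fst p - a" and d = d and s = "snd p - y1"]) (auto simp: R_def)
    fix j and \<phi> :: "real \<times> real \<Rightarrow> real" and \<psi>
    assume gd: "\<And>x. GDERIV \<phi> x :> \<psi> x" and c\<phi>: "continuous_on UNIV \<phi>" and c\<psi>: "continuous_on UNIV \<psi>"
    define \<delta> where "\<delta> = d / real (Suc j)"
    have \<delta>: "0 < \<delta>" using d by (simp add: \<delta>_def)
    have "(LINT p|arclength ?e. (snd p - y1) * \<bar>\<phi> p\<bar>) =
        (LINT y|lborel. indicator {y1..y2} y * ((y - y1) * \<bar>\<phi> (a, y)\<bar>))"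
      using y by (subst arclength_integral_vertical)
        (auto intro!: continuous_intros continuous_on_subset[OF c\<phi>])
    also have "\<dots> = (LINT y|lborel. indicator {y1<..<y2} y * ((y - y1) * \<bar>\<phi> (a, y)\<bar>))"
      by (intro lborel_integral_Icc_Ioo continuous_intros continuous_on_compose2[OF c\<phi>]) auto
    finally have "\<delta> * (LINT p|arclength ?e. (snd p - y1) * \<bar>\<phi> p\<bar>) =
        (LINT y|lborel. \<delta> * (indicator {y1<..<y2} y * ((y - y1) * \<bar>\<phi> (a, y)\<bar>)))"
      by (simp only: integral_mult_right_zero)
    also have "\<dots> = (LINT y|lborel. indicator {y1<..<y2} y * ((a + \<delta> * (y - y1) - a) * \<bar>\<phi> (a, y)\<bar>))"
      by (intro Bochner_Integration.integral_cong) (simp_all add: indicator_def)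
    also have "\<dots> \<le> (LINT p|lborel. indicator (R j) p * \<bar>\<phi> p\<bar>) + (\<delta> * (y2 - y1)) * (LINT p|lborel. indicator (R j) p * \<bar>fst (\<psi> p)\<bar>)"
    proof (rule wedge_estimate[OF c\<phi> continuous_on_fst[OF c\<psi>] GDERIV_partial(1)[OF gd]])
      show "R j = {(x, y). y1 < y \<and> y < y2 \<and> a < x \<and> x < a + \<delta> * (y - y1)}" by (simp add: R_def \<delta>_def)
      show "bounded (R j)" using E(2) RE bounded_subset by blast
      show "a < a + \<delta> * (y - y1) \<and> a + \<delta> * (y - y1) - a \<le> \<delta> * (y2 - y1) \<and> a \<in> {a..a + \<delta> * (y - y1)}"
        if "y \<in> {y1<..<y2}" for y using that \<delta> by (auto intro: mult_left_mono)
    qed (intro continuous_intros)+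
    finally show "d / real (Suc j) * (LINT p|arclength ?e. (snd p - y1) * \<bar>\<phi> p\<bar>) \<le>
        (LINT p|lborel. indicator (R j) p * \<bar>\<phi> p\<bar>) +
        d / real (Suc j) * (y2 - y1) * (LINT p|lborel. indicator (R j) p * \<bar>fst (\<psi> p)\<bar>)"
      unfolding \<delta>_def .
  qed (use d y in \<open>auto intro: continuous_intros\<close>)
  \<comment> \<open>The weight \<open>snd p - y1\<close> vanishes on the edge only at the lower end
    point, a null set, so it can be cancelled.\<close>
  moreover have "AE p in arclength ?e. p \<noteq> (a, y1)" using y by (intro AE_arclength_neq) simp
  moreover have "AE p in arclength ?e. p \<in> ?e"
    using AE_space[of "arclength ?e"] by (simp add: space_arclength)
  ultimately show ?thesis
  proof eventually_elim
    case (elim p)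
    then have "snd p \<noteq> y1" using y by (auto simp: closed_segment_vertical)
    then show ?case using elim by simp
  qed
qed

text \<open>Here the wedges hang below the edge and taper to its right end point, the corner where
  the top edge of a triangular cell meets the ramp.\<close>

lemma trace_of_constant_horizontal:
  fixes E :: "(real \<times> real) set"
  assumes tr: "is_trace E (closed_segment (x1, b) (x2, b)) u g" and x: "x1 < x2"
    and E: "open E" "bounded E" and c: "AE p in lebesgue_on E. u p = c0"
    and d: "0 < d" and wedge: "\<And>x y. x1 < x \<Longrightarrow> x < x2 \<Longrightarrow> b - d * (x2 - x) < y \<Longrightarrow> y < b \<Longrightarrow> (x, y) \<in> E"
  shows "AE p in arclength (closed_segment (x1, b) (x2, b)). g p = c0"
proof -
  let ?e = "closed_segment (x1, b) (x2, b)"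
  define R where "R j = {(x, y). x1 < x \<and> x < x2 \<and> b - d / real (Suc j) * (x2 - x) < y \<and> y < b}" for j
  have RE: "R j \<subseteq> E" for j
  proof -
    have "(x, y) \<in> E" if "x1 < x" "x < x2" "b - d / real (Suc j) * (x2 - x) < y" "y < b" for x y
    proof -
      have "d / real (Suc j) \<le> d" using d by (simp add: field_simps)
      then have "d / real (Suc j) * (x2 - x) \<le> d * (x2 - x)" using that by (intro mult_right_mono) auto
      then show ?thesis using that by (intro wedge) auto
    qed
    then show ?thesis by (auto simp: R_def)
  qed
  have Ropen: "open (R j)" for j
  proof -
    have "R j = {p. x1 < fst p} \<inter> {p. fst p < x2} \<inter> {p. b - d / real (Suc j) * (x2 - fst p) < snd p} \<inter> {p. snd p < b}"
      by (auto simp: R_def)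
    then show ?thesis by (simp only:) (intro open_Int open_Collect_less continuous_intros)
  qed
  have "AE p in arclength ?e. (x2 - fst p) * \<bar>g p - c0\<bar> = 0"
  proof (rule trace_of_constant_wedges[OF tr E c _ _ Ropen RE, where \<delta> = "\<lambda>j. d / real (Suc j)" and M = "x2 - x1" and D = snd])
    show "continuous_on ?e (\<lambda>p. x2 - fst p)" by (intro continuous_intros)
    show "0 \<le> x2 - fst p" if "p \<in> ?e" for p using that x by (auto simp: closed_segment_horizontal)
    show "\<bar>snd v\<bar> \<le> norm v" for v :: "real \<times> real"
      using norm_snd_le[of "snd v" "fst v"] by simp
    show "(\<lambda>j. indicator (R j) p :: real) \<longlonglongrightarrow> 0" for p
      by (rule indicator_wedge_tendsto_0[where t = "b - snd p" and d = d and s = "x2 - fst p"]) (auto simp: R_def)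
    fix j and \<phi> :: "real \<times> real \<Rightarrow> real" and \<psi>
    assume gd: "\<And>x. GDERIV \<phi> x :> \<psi> x" and c\<phi>: "continuous_on UNIV \<phi>" and c\<psi>: "continuous_on UNIV \<psi>"
    define \<delta> where "\<delta> = d / real (Suc j)"
    have \<delta>: "0 < \<delta>" using d by (simp add: \<delta>_def)
    have "(LINT p|arclength ?e. (x2 - fst p) * \<bar>\<phi> p\<bar>) =
        (LINT x|lborel. indicator {x1..x2} x * ((x2 - x) * \<bar>\<phi> (x, b)\<bar>))"
      using x by (subst arclength_integral_horizontal)
        (auto intro!: continuous_intros continuous_on_subset[OF c\<phi>])
    also have "\<dots> = (LINT x|lborel. indicator {x1<..<x2} x * ((x2 - x) * \<bar>\<phi> (x, b)\<bar>))"
      by (intro lborel_integral_Icc_Ioo continuous_intros continuous_on_compose2[OF c\<phi>]) auto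
    finally have "\<delta> * (LINT p|arclength ?e. (x2 - fst p) * \<bar>\<phi> p\<bar>) =
        (LINT x|lborel. \<delta> * (indicator {x1<..<x2} x * ((x2 - x) * \<bar>\<phi> (x, b)\<bar>)))"
      by (simp only: integral_mult_right_zero)
    also have "\<dots> = (LINT x|lborel. indicator {x1<..<x2} x * ((b - (b - \<delta> * (x2 - x))) * \<bar>\<phi> (x, b)\<bar>))"
      by (intro Bochner_Integration.integral_cong) (simp_all add: indicator_def)
    also have "\<dots> \<le> (LINT p|lborel. indicator (R j) p * \<bar>\<phi> p\<bar>) + (\<delta> * (x2 - x1)) * (LINT p|lborel. indicator (R j) p * \<bar>snd (\<psi> p)\<bar>)"
    proof (rule wedge_estimate_swap[OF c\<phi> continuous_on_snd[OF c\<psi>] GDERIV_partial(2)[OF gd]])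
      show "R j = {(x, y). x1 < x \<and> x < x2 \<and> b - \<delta> * (x2 - x) < y \<and> y < b}" by (simp add: R_def \<delta>_def)
      show "bounded (R j)" using E(2) RE bounded_subset by blast
      show "b - \<delta> * (x2 - x) < b \<and> b - (b - \<delta> * (x2 - x)) \<le> \<delta> * (x2 - x1) \<and> b \<in> {b - \<delta> * (x2 - x)..b}"
        if "x \<in> {x1<..<x2}" for x using that \<delta> by (auto intro: mult_left_mono)
    qed (intro continuous_intros)+
    finally show "d / real (Suc j) * (LINT p|arclength ?e. (x2 - fst p) * \<bar>\<phi> p\<bar>) \<le>
        (LINT p|lborel. indicator (R j) p * \<bar>\<phi> p\<bar>) +
        d / real (Suc j) * (x2 - x1) * (LINT p|lborel. indicator (R j) p * \<bar>snd (\<psi> p)\<bar>)"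
      unfolding \<delta>_def .
  qed (use d x in \<open>auto intro: continuous_intros\<close>)
  moreover have "AE p in arclength ?e. p \<noteq> (x2, b)" using x by (intro AE_arclength_neq) simp
  moreover have "AE p in arclength ?e. p \<in> ?e"
    using AE_space[of "arclength ?e"] by (simp add: space_arclength)
  ultimately show ?thesis
  proof eventually_elim
    case (elim p)
    then have "fst p \<noteq> x2" using x by (auto simp: closed_segment_horizontal)
    then show ?case using elim by simp
  qed
qed

section \<open>Cells and faces of the cut cell mesh\<close>

lemma mem_box_real2:
  fixes a b c d x y :: real
  shows "(x, y) \<in> box (a, b) (c, d) \<longleftrightarrow> a < x \<and> x < c \<and> b < y \<and> y < d"
  by (auto simp: mem_box Basis_prod_def)

lemma cbox_real2:
  fixes a b c d :: real
  shows "cbox (a, b) (c, d) = {(x, y). a \<le> x \<and> x \<le> c \<and> b \<le> y \<and> y \<le> d}"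
  by (auto simp: cbox_Pair_eq)

text \<open>\<open>LN\<close> expresses that the background grid fits the square exactly, with
  \<open>N\<close> cells per side. The vector \<open>(sin \<gamma>, - cos \<gamma>)\<close> is the
  unit normal of the ramp that points out of the domain.\<close>

locale ramp_mesh =
  fixes L x0 \<gamma> h \<tau> :: real and N :: nat and \<beta> :: "real \<times> real \<Rightarrow> real \<times> real"
  assumes L: "0 < L" and x0: "0 < x0" "x0 < L" and \<gamma>: "0 < \<gamma>" "\<gamma> < pi / 2"
    and ramp_right: "(L - x0) * tan \<gamma> < L"
    and h: "0 < h" and LN: "L = real N * h" and \<tau>: "0 < \<tau>"
    and lip: "\<exists>C. C-lipschitz_on (closure (\<Omega> L x0 \<gamma>)) \<beta>"
    and div: "divergence_free_on (\<Omega> L x0 \<gamma>) \<beta>"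
    and tang: "\<And>p. p \<in> ramp L x0 \<gamma> \<Longrightarrow> \<beta> p \<bullet> (sin \<gamma>, - cos \<gamma>) = 0"
    and nonzero: "\<And>p. p \<in> ramp L x0 \<gamma> \<Longrightarrow> \<beta> p \<noteq> 0"
    and sign: "constant_sign_on_faces L x0 \<gamma> h \<beta>"
begin

abbreviation "m \<equiv> tan \<gamma>"
abbreviation "above_ramp \<equiv> {(x, y). m * (x - x0) < y}"
abbreviation "cut_cell i j \<equiv>
  box (real i * h, real j * h) (real (Suc i) * h, real (Suc j) * h) \<inter> above_ramp"
abbreviation "\<Omega>' \<equiv> \<Omega> L x0 \<gamma>"
abbreviation "mesh' \<equiv> mesh L x0 \<gamma> h"
abbreviation "stab \<equiv> stabilized_cells L x0 \<gamma> h \<beta>"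
abbreviation "cells_at \<equiv> face_cells L x0 \<gamma> h"
abbreviation "jmp \<equiv> jump L x0 \<gamma> h \<beta>"
abbreviation "V0s \<equiv> V0 L x0 \<gamma> h"
abbreviation "seminrm \<equiv> beta_seminorm L x0 \<gamma> h \<beta> \<tau>"
abbreviation "starnrm \<equiv> uwb_star_norm L x0 \<gamma> h \<beta> \<tau>"

section \<open>The half plane above the ramp and the shape of the cells\<close>

lemma m_pos: "0 < m" using \<gamma> by (simp add: tan_gt_zero)
lemma cos_pos: "0 < cos \<gamma>" using \<gamma> by (intro cos_gt_zero) auto

lemma above_ramp_eq: "above_ramp = {p. (m, -1) \<bullet> p < m * x0}"
  by (auto simp: algebra_simps)

lemma open_above_ramp: "open above_ramp"
  unfolding above_ramp_eq by (rule open_halfspace_lt)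

lemma convex_above_ramp: "convex above_ramp"
  unfolding above_ramp_eq by (rule convex_halfspace_lt)

lemma closure_above_ramp: "closure above_ramp = {(x, y). m * (x - x0) \<le> y}"
proof -
  have "closure above_ramp = {p. (m, -1) \<bullet> p \<le> m * x0}"
    unfolding above_ramp_eq by (rule closure_halfspace_lt) (simp add: zero_prod_def)
  also have "\<dots> = {(x, y). m * (x - x0) \<le> y}" by (auto simp: algebra_simps)
  finally show ?thesis .
qed

lemma Omega_eq: "\<Omega>' = box (0, 0) (L, L) \<inter> above_ramp"
  unfolding \<Omega>_def by (auto simp: mem_box_real2 mult.commute)

lemma open_Omega: "open \<Omega>'"
  unfolding Omega_eq by (intro open_Int open_box open_above_ramp)

text \<open>A background cell already lies in the square, so of the conditions defining the domain
  only the ramp is left: each cell is a box cut by a single half plane, and finitely many indices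
  suffice.\<close>

lemma mesh_iff: "E \<in> mesh' \<longleftrightarrow> E \<noteq> {} \<and> (\<exists>i<N. \<exists>j<N. E = cut_cell i j)"
proof -
  have sub: "box (real i * h, real j * h) (real (Suc i) * h, real (Suc j) * h) \<subseteq> box (0, 0) (L, L) \<longleftrightarrow>
      i < N \<and> j < N" for i j
  proof -
    have "real i * h < real (Suc i) * h" for i using h by simp
    moreover have "real (Suc i) * h \<le> L \<longleftrightarrow> i < N" for i
    proof -
      have "real (Suc i) * h \<le> L \<longleftrightarrow> real (Suc i) \<le> real N" using h by (simp only: LN mult_le_cancel_right_pos)
      then show ?thesis by linarith
    qed
    moreover have "0 \<le> real i * h" for i using h by simp
    ultimately show ?thesis by (auto simp: subset_box Basis_prod_def not_le[symmetric] simp del: of_nat_Suc)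
  qed
  show ?thesis
  proof
    assume "E \<in> mesh'"
    then obtain i j where ij: "E \<noteq> {}" "box (real i * h, real j * h) (real (Suc i) * h, real (Suc j) * h) \<subseteq> box (0, 0) (L, L)"
      "E = box (real i * h, real j * h) (real (Suc i) * h, real (Suc j) * h) \<inter> \<Omega>'"
      unfolding mesh_def background_cells_def by blast
    then have "E = cut_cell i j" unfolding Omega_eq by blast
    with ij sub show "E \<noteq> {} \<and> (\<exists>i<N. \<exists>j<N. E = cut_cell i j)" by blast
  next
    assume "E \<noteq> {} \<and> (\<exists>i<N. \<exists>j<N. E = cut_cell i j)"
    then obtain i j where ij: "E \<noteq> {}" "i < N" "j < N" "E = cut_cell i j" by blast
    let ?Q = "box (real i * h, real j * h) (real (Suc i) * h, real (Suc j) * h)"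
    have "?Q \<subseteq> box (0, 0) (L, L)" using ij sub by blast
    moreover from this have "E = ?Q \<inter> \<Omega>'" using ij unfolding Omega_eq by blast
    ultimately show "E \<in> mesh'" using ij(1) unfolding mesh_def background_cells_def by blast
  qed
qed

lemma finite_mesh: "finite mesh'"
proof (rule finite_subset)
  show "mesh' \<subseteq> (\<lambda>(i, j). cut_cell i j) ` ({..<N} \<times> {..<N})" by (auto simp: mesh_iff)
qed auto

lemma mesh_cell:
  assumes "E \<in> mesh'"
  shows "open E" "convex E" "E \<noteq> {}" "E \<subseteq> \<Omega>'"
proof -
  obtain i j where "E \<noteq> {}" "E = cut_cell i j" using assms by (auto simp: mesh_iff)
  then show "E \<noteq> {}" "open E" "convex E"
    by (blast, blast intro: open_Int open_box open_above_ramp, blast intro: convex_Int convex_box convex_above_ramp)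
  show "E \<subseteq> \<Omega>'" using assms by (auto simp: mesh_def)
qed

text \<open>Closure commutes with the intersection of two convex sets whose relative interiors meet;
  here both are open and the cell is their nonempty intersection.\<close>

lemma closure_cut_cell:
  assumes "cut_cell i j \<noteq> {}"
  shows "closure (cut_cell i j) = {(x, y). real i * h \<le> x \<and> x \<le> real (Suc i) * h \<and>
    real j * h \<le> y \<and> y \<le> real (Suc j) * h \<and> m * (x - x0) \<le> y}"
proof -
  let ?Q = "box (real i * h, real j * h) (real (Suc i) * h, real (Suc j) * h)"
  have "closure (?Q \<inter> above_ramp) = closure ?Q \<inter> closure above_ramp"
    using assms by (intro closure_Int_convex convex_box convex_above_ramp)
      (simp only: rel_interior_open[OF open_above_ramp] rel_interior_open[OF open_box] not_False_eq_True)
  also have "closure ?Q = cbox (real i * h, real j * h) (real (Suc i) * h, real (Suc j) * h)"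
    using assms by (intro closure_box) auto
  finally show ?thesis unfolding closure_above_ramp cbox_real2 by blast
qed

lemma polytope_closure_cell:
  assumes "E \<in> mesh'" shows "polytope (closure E)"
proof -
  obtain i j where E: "E = cut_cell i j" "cut_cell i j \<noteq> {}" using assms by (auto simp: mesh_iff)
  have "closure E = cbox (real i * h, real j * h) (real (Suc i) * h, real (Suc j) * h) \<inter> {p. (m, -1) \<bullet> p \<le> m * x0}"
    unfolding E(1) closure_cut_cell[OF E(2)] cbox_real2 by (auto simp: algebra_simps simp del: of_nat_Suc)
  then show ?thesis by (simp only:) (intro polytope_Int_polyhedron polytope_interval polyhedron_halfspace_le)
qed

lemma interior_closure_cell:
  assumes "E \<in> mesh'" shows "interior (closure E) = E"
  using mesh_cell[OF assms] by (simp add: convex_interior_closure interior_open)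

section \<open>Faces, normals and adjacent cells\<close>

lemma finite_faces: "E \<in> mesh' \<Longrightarrow> finite (faces E)"
  by (rule finite_subset[OF _ finite_polytope_faces[OF polytope_closure_cell]])
    (auto simp: faces_def edge_of_def)

lemma grid_index_unique:
  assumes "real i * h < x" "x < real (Suc i) * h" "real i' * h < x" "x < real (Suc i') * h"
  shows "i = i'"
proof -
  have "real i < real (Suc i')" "real i' < real (Suc i)"
    using assms h by (metis mult_less_cancel_right_pos order_less_trans)+
  then show ?thesis by linarith
qed

lemma mesh_disjoint:
  assumes "E \<in> mesh'" "E' \<in> mesh'" "E \<noteq> E'" shows "E \<inter> E' = {}"
proof (rule ccontr)
  assume "E \<inter> E' \<noteq> {}"
  then obtain x y where p: "(x, y) \<in> E" "(x, y) \<in> E'" by auto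
  obtain i j where E: "E = cut_cell i j" using assms by (auto simp: mesh_iff)
  obtain i' j' where E': "E' = cut_cell i' j'" using assms by (auto simp: mesh_iff)
  have "i = i'" using p unfolding E E'
    by (intro grid_index_unique[of _ x]) (auto simp: mem_box_real2 simp del: of_nat_Suc)
  moreover have "j = j'" using p unfolding E E'
    by (intro grid_index_unique[of _ y]) (auto simp: mem_box_real2 simp del: of_nat_Suc)
  ultimately show False using E E' assms(3) by simp
qed

text \<open>The working form of a face. The closure of a cell is a polytope with nonempty interior,
  so a supporting unit normal exists, and \<open>outer_normal_eqI\<close> identifies it with the one
  chosen by \<open>THE\<close>.\<close>

lemma face_cases:
  assumes "E \<in> mesh'" "e \<in> faces E"
  obtains a b c where "a \<noteq> b" "e = closed_segment a b" "e \<subseteq> closure E" "norm (outer_normal E e) = 1"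
    "\<And>p. p \<in> E \<Longrightarrow> outer_normal E e \<bullet> p \<le> c" "\<And>p. p \<in> e \<Longrightarrow> outer_normal E e \<bullet> p = c"
proof -
  have e: "e edge_of closure E" using assms by (simp add: faces_def)
  have ne: "interior (closure E) \<noteq> {}"
    using mesh_cell[OF assms(1)] interior_closure_cell[OF assms(1)] by simp
  have dim: "2 \<le> DIM(real \<times> real)" by simp
  obtain a b n c where *: "a \<noteq> b" "e = closed_segment a b" "norm n = 1"
    "\<And>p. p \<in> closure E \<Longrightarrow> n \<bullet> p \<le> c" "\<And>p. p \<in> e \<Longrightarrow> n \<bullet> p = c"
    using polytope_edge_cases[OF polytope_closure_cell[OF assms(1)] ne e dim] by metis
  have "outer_normal E e = n"
  proof (rule outer_normal_eqI[of E a e b n c])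
    show "n \<bullet> p \<le> c" if "p \<in> E" for p using *(4) that closure_subset by blast
  qed (use mesh_cell[OF assms(1)] * in auto)
  then show ?thesis using * that[of a b c] edge_of_imp_subset[OF e] closure_subset by blast
qed

text \<open>Both normals are unit vectors orthogonal to the edge. If they were equal, the cells
  would lie on the same side of it and overlap, but distinct cells are disjoint.\<close>

lemma outer_normal_opposite:
  assumes "E1 \<in> mesh'" "E2 \<in> mesh'" "E1 \<noteq> E2" "e \<in> faces E1" "e \<in> faces E2"
  shows "outer_normal E2 e = - outer_normal E1 e"
proof -
  obtain a b c where 1: "a \<noteq> b" "e = closed_segment a b" "e \<subseteq> closure E1" "norm (outer_normal E1 e) = 1"
    "\<And>p. p \<in> E1 \<Longrightarrow> outer_normal E1 e \<bullet> p \<le> c" "\<And>p. p \<in> e \<Longrightarrow> outer_normal E1 e \<bullet> p = c"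
    using face_cases[OF assms(1,4)] by metis
  obtain c' where 2: "e \<subseteq> closure E2" "norm (outer_normal E2 e) = 1"
    "\<And>p. p \<in> E2 \<Longrightarrow> outer_normal E2 e \<bullet> p \<le> c'" "\<And>p. p \<in> e \<Longrightarrow> outer_normal E2 e \<bullet> p = c'"
    using face_cases[OF assms(2,5)] by metis
  have ab: "a \<in> e" "b \<in> e" using 1 by auto
  have "outer_normal E2 e = outer_normal E1 e \<or> outer_normal E2 e = - outer_normal E1 e"
    using 1 2 ab by (intro inner_eq_0_orthogonal_real2[of _ _ "b - a"]) (auto simp: inner_diff_right)
  moreover have "outer_normal E2 e \<noteq> outer_normal E1 e"
  proof
    assume eq: "outer_normal E2 e = outer_normal E1 e"
    have "c' = c" using 1(6)[OF ab(1)] 2(4)[OF ab(1)] eq by simp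
    then have "E1 \<inter> E2 \<noteq> {}"
      using 1 2 ab eq mesh_cell[OF assms(1)] mesh_cell[OF assms(2)]
      by (intro convex_open_same_side_meet[of E1 E2 a b "outer_normal E1 e" c]) auto
    then show False using mesh_disjoint assms by blast
  qed
  ultimately show ?thesis by blast
qed

text \<open>The normal of a third cell would be opposite to each of two vectors that are opposite to
  each other, which only 0 could be.\<close>

lemma face_cells_eq:
  assumes "E \<in> mesh'" "E' \<in> mesh'" "E' \<noteq> E" "e \<in> faces E" "e \<in> faces E'"
  shows "cells_at e = {E, E'}"
proof -
  have "E'' = E \<or> E'' = E'" if E'': "E'' \<in> mesh'" "e \<in> faces E''" for E''
  proof (rule ccontr)
    assume "\<not> (E'' = E \<or> E'' = E')"
    then have "outer_normal E'' e = - outer_normal E e" "outer_normal E'' e = - outer_normal E' e"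
      "outer_normal E' e = - outer_normal E e"
      using assms E'' by (metis outer_normal_opposite)+
    then have "outer_normal E e = - outer_normal E e" by (metis minus_minus)
    then have "outer_normal E e = 0" by (cases "outer_normal E e") (auto simp: zero_prod_def)
    moreover have "norm (outer_normal E e) = 1" using face_cases[OF assms(1,4)] by metis
    ultimately show False by simp
  qed
  then show ?thesis using assms by (auto simp: face_cells_def)
qed

lemma face_cells_cases:
  assumes "E \<in> mesh'" "e \<in> faces E"
  obtains "cells_at e = {E}"
    | E' where "E' \<in> mesh'" "E' \<noteq> E" "e \<in> faces E'" "cells_at e = {E, E'}"
proof (cases "\<exists>E'. E' \<in> mesh' \<and> E' \<noteq> E \<and> e \<in> faces E'")
  case True
  then show ?thesis using that(2) face_cells_eq assms by metis
next
  case False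
  then have "cells_at e = {E}" using assms by (auto simp: face_cells_def)
  then show ?thesis by (rule that)
qed

text \<open>The cell chosen by \<open>SOME\<close> in \<open>face_weight\<close> is harmless: the
  normals from the two sides differ by a sign, which the absolute value removes.\<close>

lemma face_weight_eq:
  assumes "E \<in> mesh'" "e \<in> faces E"
  shows "face_weight L x0 \<gamma> h \<beta> e = flux_weight \<beta> E e"
proof -
  have "E \<in> cells_at e" using assms by (simp add: face_cells_def)
  then have "(SOME E. E \<in> cells_at e) \<in> cells_at e" by (rule someI)
  then have F: "(SOME E. E \<in> cells_at e) \<in> mesh'" "e \<in> faces (SOME E. E \<in> cells_at e)"
    by (simp_all add: face_cells_def)
  show ?thesis
  proof (cases "(SOME E. E \<in> cells_at e) = E")
    case False
    then have "outer_normal (SOME E. E \<in> cells_at e) e = - outer_normal E e"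
      using outer_normal_opposite[OF assms(1) F(1)] assms F by metis
    then show ?thesis by (auto simp: face_weight_def flux_weight_def)
  qed (simp add: face_weight_def)
qed

lemma jump_interior:
  assumes "E \<in> mesh'" "E' \<in> mesh'" "E' \<noteq> E" "e \<in> faces E" "e \<in> faces E'"
  shows "jmp w e = (wmean \<beta> w E e - wmean \<beta> w E' e) *\<^sub>R outer_normal E e"
  using assms outer_normal_opposite[of E E' e]
  by (simp add: jump_def face_cells_eq[OF assms] scaleR_left_diff_distrib)

lemma jump_parallel:
  assumes "E \<in> mesh'" "e \<in> faces E"
  obtains d where "jmp w e = d *\<^sub>R outer_normal E e"
  using face_cells_cases[OF assms]
proof cases
  case 1
  then have "jmp w e = wmean \<beta> w E e *\<^sub>R outer_normal E e" by (simp add: jump_def)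
  then show ?thesis by (rule that)
next
  case (2 E')
  then show ?thesis using that jump_interior assms by metis
qed

section \<open>Signs of the normal flow on a face\<close>

lemma cont_beta: "continuous_on (closure \<Omega>') \<beta>"
  using lip lipschitz_on_continuous_on by blast

lemma face_subset:
  assumes "E \<in> mesh'" "e \<in> faces E" shows "e \<subseteq> closure E" "e \<subseteq> closure \<Omega>'"
proof -
  show "e \<subseteq> closure E" using face_cases[OF assms] by metis
  then show "e \<subseteq> closure \<Omega>'" using mesh_cell(4)[OF assms(1)] closure_mono by blast
qed

lemma cont_flux:
  assumes "E \<in> mesh'" "e \<in> faces E" shows "continuous_on e (\<lambda>p. \<beta> p \<bullet> n)"
  using continuous_on_subset[OF cont_beta face_subset(2)[OF assms]] by (intro continuous_intros)

lemma rel_interior_face: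
  assumes "E \<in> mesh'" "e \<in> faces E" shows "closure (rel_interior e) = e" "rel_interior e \<noteq> {}"
proof -
  obtain a b where "a \<noteq> b" "e = closed_segment a b" using face_cases[OF assms] by metis
  then show "closure (rel_interior e) = e" "rel_interior e \<noteq> {}"
    by (simp_all add: convex_closure_rel_interior rel_interior_eq_empty)
qed

text \<open>A face is the closure of its relative interior, so a weak sign condition extends by
  continuity to the end points.\<close>

lemma le_on_face:
  assumes "E \<in> mesh'" "e \<in> faces E" "\<And>p. p \<in> rel_interior e \<Longrightarrow> \<beta> p \<bullet> n \<le> 0" "p \<in> e"
  shows "\<beta> p \<bullet> n \<le> 0"
proof (rule continuous_le_on_closure[of "rel_interior e" "\<lambda>p. \<beta> p \<bullet> n"])
  show "continuous_on (closure (rel_interior e)) (\<lambda>p. \<beta> p \<bullet> n)"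
    unfolding rel_interior_face(1)[OF assms(1,2)] by (rule cont_flux[OF assms(1,2)])
  show "p \<in> closure (rel_interior e)"
    unfolding rel_interior_face(1)[OF assms(1,2)] by (rule assms(4))
qed (rule assms(3))

lemma inflow_le: "\<lbrakk>E \<in> mesh'; e \<in> faces E; inflow \<beta> E e; p \<in> e\<rbrakk> \<Longrightarrow> \<beta> p \<bullet> outer_normal E e \<le> 0"
  by (rule le_on_face[of E e]) (auto simp: inflow_def less_imp_le)

lemma outflow_ge:
  assumes "E \<in> mesh'" "e \<in> faces E" "outflow \<beta> E e" "p \<in> e"
  shows "0 \<le> \<beta> p \<bullet> outer_normal E e"
proof -
  have "\<beta> p \<bullet> (- outer_normal E e) \<le> 0"
    using assms(3) by (intro le_on_face[OF assms(1,2) _ assms(4)]) (auto simp: outflow_def less_imp_le)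
  then show ?thesis by simp
qed

lemma not_inflow_outflow: "\<lbrakk>E \<in> mesh'; e \<in> faces E; inflow \<beta> E e\<rbrakk> \<Longrightarrow> \<not> outflow \<beta> E e"
  using rel_interior_face(2) unfolding inflow_def outflow_def by (metis ex_in_conv order_less_asym)

text \<open>\<open>p\<close> may be an end point, where the sign condition on faces says nothing;
  this is how the flow at the corners of a triangle decides the type of its edges. If the constant
  sign in the relative interior were different, continuity would give the wrong weak sign at
  \<open>p\<close>. The factor \<open>s\<close> treats inflow and outflow at once.\<close>

lemma negative_on_faceI:
  assumes "E \<in> mesh'" "e \<in> faces E" "p \<in> e" "s = 1 \<or> s = -1" "s * (\<beta> p \<bullet> outer_normal E e) < 0"
    and q: "q \<in> rel_interior e"
  shows "s * (\<beta> q \<bullet> outer_normal E e) < 0"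
proof (rule ccontr)
  assume n: "\<not> ?thesis"
  obtain z where z: "\<And>p. p \<in> rel_interior e \<Longrightarrow> sgn (\<beta> p \<bullet> outer_normal E e) = z"
    using sign assms unfolding constant_sign_on_faces_def by metis
  have "\<beta> r \<bullet> (- s *\<^sub>R outer_normal E e) \<le> 0" if "r \<in> rel_interior e" for r
    using n z[OF that] z[OF q] assms(4) by (auto simp: sgn_if split: if_splits)
  then have "\<beta> p \<bullet> (- s *\<^sub>R outer_normal E e) \<le> 0"
    by (rule le_on_face[OF assms(1,2) _ assms(3)])
  then show False using assms(5) by simp
qed

lemma inflowI: "\<lbrakk>E \<in> mesh'; e \<in> faces E; p \<in> e; \<beta> p \<bullet> outer_normal E e < 0\<rbrakk> \<Longrightarrow> inflow \<beta> E e"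
  using negative_on_faceI[of E e p 1] by (simp add: inflow_def)

lemma outflowI: "\<lbrakk>E \<in> mesh'; e \<in> faces E; p \<in> e; 0 < \<beta> p \<bullet> outer_normal E e\<rbrakk> \<Longrightarrow> outflow \<beta> E e"
  using negative_on_faceI[of E e p "-1"] by (simp add: outflow_def)

end

section \<open>Triangular cut cells\<close>

lemma L2_lebesgue_on_subset:
  fixes f :: "'a::euclidean_space \<Rightarrow> 'b::euclidean_space"
  assumes f: "f \<in> L2 (lebesgue_on V)" and UV: "U \<subseteq> V" "U \<in> sets lebesgue" "V \<in> sets lebesgue"
  shows "f \<in> L2 (lebesgue_on U)"
proof -
  have "f \<in> borel_measurable (lebesgue_on V)" "integrable (lebesgue_on V) (\<lambda>x. (norm (f x))\<^sup>2)"
    using f by (auto simp: L2_def)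
  moreover from this(2) have "integrable (lebesgue_on U) (\<lambda>x. (norm (f x))\<^sup>2)"
    using UV set_integrable_subset[of lebesgue V "\<lambda>x. (norm (f x))\<^sup>2" U]
    by (simp add: integrable_restrict_space set_integrable_def)
  ultimately show ?thesis using UV by (auto simp: L2_def intro: measurable_restrict_mono)
qed

context ramp_mesh begin

text \<open>A point of the closed box suffices, since a neighbourhood of it stays above the ramp and
  meets the open box. It is applied to corners of the boxes.\<close>

lemma cut_cell_nonempty:
  assumes "real i * h \<le> x" "x \<le> real (Suc i) * h" "real j * h \<le> y" "y \<le> real (Suc j) * h" "m * (x - x0) < y"
  shows "cut_cell i j \<noteq> {}"
proof -
  let ?Q = "box (real i * h, real j * h) (real (Suc i) * h, real (Suc j) * h)"
  have "?Q \<noteq> {}" using h by (auto simp: box_ne_empty Basis_prod_def)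
  then have "closure ?Q = cbox (real i * h, real j * h) (real (Suc i) * h, real (Suc j) * h)"
    by (rule closure_box)
  then have "(x, y) \<in> above_ramp \<inter> closure ?Q" using assms by (simp add: cbox_Pair_eq del: of_nat_Suc)
  then have "above_ramp \<inter> ?Q \<noteq> {}"
    using open_Int_closure_eq_empty[OF open_above_ramp, of ?Q] by blast
  then show ?thesis by blast
qed

lemma cut_cell_inj:
  assumes "cut_cell i j = cut_cell i' j'" "cut_cell i j \<noteq> {}"
  shows "i = i'" "j = j'"
proof -
  obtain x y where 1: "(x, y) \<in> cut_cell i j" using assms(2) by auto
  have 2: "(x, y) \<in> cut_cell i' j'" using 1 unfolding assms(1) .
  show "i = i'" "j = j'"
    using 1 2 grid_index_unique[of i x i'] grid_index_unique[of j y j']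
    by (auto simp: mem_box_real2 simp del: of_nat_Suc)
qed

text \<open>Any two edges of a triangle meet, so a triangular cell has neither a bottom nor a right edge
  on the grid, as these would be disjoint from its top and left edge, respectively.\<close>

lemma triangular_cell_indices:
  assumes E: "E \<in> mesh'" and tri: "2 simplex closure E"
  obtains i j where "i < N" "j < N" "E = cut_cell i j" "real j * h \<le> m * (real i * h - x0)"
    "m * (real i * h - x0) < real (Suc j) * h" "real (Suc j) * h \<le> m * (real (Suc i) * h - x0)"
proof -
  obtain i j where ij: "i < N" "j < N" "E = cut_cell i j" using E by (auto simp: mesh_iff)
  define a b a' c where "a = real i * h" and "b = real j * h" and "a' = real (Suc i) * h" and "c = real (Suc j) * h"
  have ac: "a' = a + h" "c = b + h" by (simp_all add: a_def b_def a'_def c_def algebra_simps)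
  have ne: "cut_cell i j \<noteq> {}" using E ij by (auto simp: mesh_iff)
  have cl: "closure E = {(x, y). a \<le> x \<and> x \<le> a' \<and> b \<le> y \<and> y \<le> c \<and> m * (x - x0) \<le> y}"
    unfolding ij(3) closure_cut_cell[OF ne] a_def b_def a'_def c_def by (rule refl)
  have conv: "convex (closure E)" using mesh_cell[OF E] by (simp add: convex_closure)
  have mono: "m * (u - x0) \<le> m * (v - x0) \<longleftrightarrow> u \<le> v" for u v using m_pos by simp
  obtain x y where "(x, y) \<in> E" using ne ij by auto
  then have xy: "a < x" "y < c" "m * (x - x0) < y" unfolding ij(3) a_def c_def by (auto simp: mem_box_real2)
  then have top_left: "m * (a - x0) < c" using mono[of a x] by simp
  \<comment> \<open>Otherwise the ramp passes strictly below the lower left corner, and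
    \<open>d\<close> is short enough that the segment from \<open>(a, b)\<close> to
    \<open>(a + d, b)\<close> is above it. This yields a bottom edge, disjoint from the top
    edge.\<close>
  have bottom_left: "b \<le> m * (a - x0)"
  proof (rule ccontr)
    assume n: "\<not> b \<le> m * (a - x0)"
    define d where "d = min h ((b - m * (a - x0)) / m)"
    have d: "0 < d" "d \<le> h" using n m_pos h by (auto simp: d_def)
    have "d \<le> (b - m * (a - x0)) / m" by (simp add: d_def)
    then have "d * m \<le> b - m * (a - x0)" using m_pos by (simp add: pos_le_divide_eq)
    then have dm: "m * (a + d - x0) \<le> b" by (simp add: algebra_simps)
    have "(closure E \<inter> {p. (0, -1) \<bullet> p = - b}) edge_of closure E"
      by (rule edge_of_supportingI[where p = "(a, b)" and q = "(a + d, b)"])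
        (use conv n d dm h ac in \<open>auto simp: cl zero_prod_def\<close>)
    moreover have "(closure E \<inter> {p. (0, 1) \<bullet> p = c}) edge_of closure E"
      by (rule edge_of_supportingI[where p = "(a, c)" and q = "(a + d, c)"])
        (use conv n d dm h ac in \<open>auto simp: cl zero_prod_def\<close>)
    ultimately show False using edges_of_triangle_meet[OF tri] h ac by fastforce
  qed
  \<comment> \<open>Otherwise the ramp leaves a piece of length \<open>d\<close> of the right side
    below the upper corner, and, being increasing, also one of the left side. The two vertical edges
    would be disjoint.\<close>
  have top_right: "c \<le> m * (a' - x0)"
  proof (rule ccontr)
    assume n: "\<not> c \<le> m * (a' - x0)"
    define d where "d = min h (c - m * (a' - x0))"
    have d: "0 < d" "d \<le> h" "m * (a' - x0) \<le> c - d" using n h by (auto simp: d_def)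
    then have d': "m * (a - x0) \<le> c - d" using mono[of a a'] h ac by simp
    have "(closure E \<inter> {p. (1, 0) \<bullet> p = a'}) edge_of closure E"
      by (rule edge_of_supportingI[where p = "(a', c)" and q = "(a', c - d)"])
        (use conv n d h ac in \<open>auto simp: cl zero_prod_def\<close>)
    moreover have "(closure E \<inter> {p. (-1, 0) \<bullet> p = - a}) edge_of closure E"
      by (rule edge_of_supportingI[where p = "(a, c)" and q = "(a, c - d)"])
        (use conv d d' h ac in \<open>auto simp: cl zero_prod_def\<close>)
    ultimately show False using edges_of_triangle_meet[OF tri] h ac by fastforce
  qed
  show ?thesis
    using that[OF ij] bottom_left top_left top_right unfolding a_def b_def a'_def c_def by blast
qed

text \<open>The edges are a left and a top grid edge and a hypotenuse on the ramp. There the first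
  component of \<open>\<beta>\<close> has no zero, hence one sign, and the second is
  \<open>m\<close> times the first. Evaluated at the two corners of the hypotenuse, this sends the
  flow in through one grid edge and out through the other. The conclusion collects everything needed
  about stabilized cells, including uniqueness, so that \<open>THE\<close> can be resolved
  later.\<close>

lemma triangular_cell_flow:
  assumes E: "E \<in> mesh'" and tri: "2 simplex closure E"
  obtains ei eo E1 E2 where
    "ei \<in> faces E" "inflow \<beta> E ei" "\<And>e. e \<in> faces E \<Longrightarrow> inflow \<beta> E e \<Longrightarrow> e = ei"
    "eo \<in> faces E" "outflow \<beta> E eo" "\<And>e. e \<in> faces E \<Longrightarrow> outflow \<beta> E e \<Longrightarrow> e = eo"
    "outer_normal E ei \<in> {(-1, 0), (0, 1)}" "outer_normal E eo \<in> {(-1, 0), (0, 1)}"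
    "E1 \<in> mesh'" "E1 \<noteq> E" "ei \<in> faces E1" "E2 \<in> mesh'" "E2 \<noteq> E" "eo \<in> faces E2"
    "(LINT p|arclength ei. flux_weight \<beta> E ei p) = (LINT p|arclength eo. flux_weight \<beta> E eo p)"
    "\<And>w. w \<in> V0s \<Longrightarrow> wmean \<beta> w E ei = wmean \<beta> w E eo"
proof -
  let ?flux = "\<lambda>e. (LINT p|arclength e. flux_weight \<beta> E e p)"
  obtain i j where ij: "i < N" "j < N" "E = cut_cell i j" and bl: "real j * h \<le> m * (real i * h - x0)"
    and tl: "m * (real i * h - x0) < real (Suc j) * h" and tr: "real (Suc j) * h \<le> m * (real (Suc i) * h - x0)"
    using triangular_cell_indices[OF E tri] by blast
  define a b a' c where "a = real i * h" and "b = real j * h" and "a' = real (Suc i) * h" and "c = real (Suc j) * h"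
  note abc = a_def b_def a'_def c_def
  have ac: "a' = a + h" "c = b + h" by (simp_all add: abc algebra_simps)
  note bl = bl[folded abc] and tl = tl[folded abc] and tr = tr[folded abc]
  have ne: "cut_cell i j \<noteq> {}" using E ij by (auto simp: mesh_iff)
  have mono: "m * (u - x0) \<le> m * (v - x0) \<longleftrightarrow> u \<le> v" for u v using m_pos by simp
  define X where "X = x0 + c / m"
  have X: "m * (X - x0) = c" using m_pos by (simp add: X_def)
  have aX: "a < X" using tl X mono[of X a] by linarith
  have Xa': "X \<le> a'" using tr X mono[of X a'] by simp
  have mX: "m * (x - x0) \<le> c \<longleftrightarrow> x \<le> X" for x using X mono[of x X] by simp
  \<comment> \<open>The ramp reaches the height \<open>c\<close> at \<open>X\<close>, not beyond the
    right grid line, and at \<open>x = a\<close> it is already at height \<open>b\<close> or above.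
    So the right and lower grid constraints follow from the other three.\<close>
  have cl: "closure E = {(x, y). a \<le> x \<and> y \<le> c \<and> m * (x - x0) \<le> y}"
  proof -
    have "closure E = {(x, y). a \<le> x \<and> x \<le> a' \<and> b \<le> y \<and> y \<le> c \<and> m * (x - x0) \<le> y}"
      unfolding ij(3) closure_cut_cell[OF ne] abc by (rule refl)
    moreover have "x \<le> a' \<and> b \<le> y" if "a \<le> x" "y \<le> c" "m * (x - x0) \<le> y" for x y
      using that mX[of x] Xa' bl mono[of a x] by linarith
    ultimately show ?thesis by blast
  qed
  have Eset: "E = {(x, y). a < x \<and> y < c \<and> m * (x - x0) < y}"
  proof -
    have "x < a' \<and> b < y" if "a < x" "y < c" "m * (x - x0) < y" for x y
    proof -
      have "m * (a - x0) < m * (x - x0)" using that m_pos by simp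
      moreover have "m * (x - x0) < m * (a' - x0)" using that tr by linarith
      then have "x < a'" using m_pos by simp
      ultimately show ?thesis using that bl by linarith
    qed
    then have "(x, y) \<in> E \<longleftrightarrow> a < x \<and> y < c \<and> m * (x - x0) < y" for x y
      unfolding ij(3) abc[symmetric] by (auto simp: mem_box_real2)
    then show ?thesis by auto
  qed
  define ya where "ya = m * (a - x0)"
  have ya: "ya < c" using tl by (simp add: ya_def)
  define left hyp top where "left = closed_segment (a, ya) (a, c)"
    and "hyp = closed_segment (a, ya) (X, c)" and "top = closed_segment (a, c) (X, c)"
  have left: "left = {(x, y). x = a \<and> ya \<le> y \<and> y \<le> c}"
    unfolding left_def using ya by (simp add: closed_segment_vertical)
  have top: "top = {(x, y). y = c \<and> a \<le> x \<and> x \<le> X}"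
    unfolding top_def using aX by (simp add: closed_segment_horizontal)
  have hull: "convex hull {(a, ya), (a, c), (X, c)} = closure E"
    unfolding ya_def X_def cl using m_pos tl by (rule triangle_convex_hull)
  have "\<not> collinear {(a, ya), (a, c), (X, c)}"
  proof -
    have "aff_dim (closure E) = 2"
      using aff_dim_nonempty_interior[of "closure E"] interior_closure_cell[OF E] mesh_cell[OF E] by simp
    then have "aff_dim {(a, ya), (a, c), (X, c)} = 2" by (metis hull aff_dim_convex_hull)
    then show ?thesis by (simp add: collinear_aff_dim)
  qed
  then have faces: "faces E = {left, top, hyp}"
    unfolding faces_def hull[symmetric] by (auto simp: edge_of_triangle_iff left_def top_def hyp_def)
  have fl: "left \<in> faces E" "top \<in> faces E" "hyp \<in> faces E" using faces by auto
  have Ecl: "p \<in> E \<Longrightarrow> p \<in> closure E" for p using closure_subset by blast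
  have n_left: "outer_normal E left = (-1, 0)"
    using mesh_cell[OF E] ya Ecl
    by (intro outer_normal_eqI[where a = "(a, ya)" and b = "(a, c)" and c = "- a"]) (auto simp: left cl norm_Pair)
  have n_top: "outer_normal E top = (0, 1)"
    using mesh_cell[OF E] aX Ecl
    by (intro outer_normal_eqI[where a = "(a, c)" and b = "(X, c)" and c = c]) (auto simp: top cl norm_Pair)
  have hyp_line: "snd p = m * (fst p - x0)" if hp: "p \<in> hyp" for p
  proof -
    obtain u where "p = (1 - u) *\<^sub>R (a, ya) + u *\<^sub>R (X, c)" using hp unfolding hyp_def in_segment by blast
    then have f: "fst p = (1 - u) * a + u * X" and s: "snd p = (1 - u) * ya + u * c" by auto
    show ?thesis unfolding f s ya_def X[symmetric] by (simp add: algebra_simps)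
  qed
  have tan_eq: "m * cos \<gamma> = sin \<gamma>" using cos_pos by (simp add: tan_def)
  have n_hyp: "outer_normal E hyp = (sin \<gamma>, - cos \<gamma>)"
  proof (rule outer_normal_eqI[where a = "(a, ya)" and b = "(X, c)" and c = "sin \<gamma> * x0"])
    have nrm: "(sin \<gamma>, - cos \<gamma>) \<bullet> p = cos \<gamma> * (m * (fst p - x0) - snd p) + sin \<gamma> * x0" for p
      by (simp add: inner_prod_def tan_eq[symmetric] algebra_simps)
    show "(sin \<gamma>, - cos \<gamma>) \<bullet> p = sin \<gamma> * x0" if "p \<in> hyp" for p
      unfolding nrm hyp_line[OF that] by simp
    show "(sin \<gamma>, - cos \<gamma>) \<bullet> p \<le> sin \<gamma> * x0" if "p \<in> E" for p
    proof -
      have "m * (fst p - x0) - snd p \<le> 0" using Ecl[OF that] unfolding cl by auto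
      then show ?thesis unfolding nrm using cos_pos by (simp add: mult_nonneg_nonpos)
    qed
  qed (use mesh_cell[OF E] aX in \<open>auto simp: hyp_def norm_Pair\<close>)
  have clO: "closure E \<subseteq> closure \<Omega>'" using mesh_cell(4)[OF E] by (rule closure_mono)
  have ramp: "p \<in> ramp L x0 \<gamma>" if "p \<in> closure E" "snd p = m * (fst p - x0)" for p
  proof -
    have "p \<notin> \<Omega>'" using that unfolding Omega_eq by auto
    then have "p \<in> frontier \<Omega>'"
      using that clO open_Omega by (auto simp: frontier_def interior_open)
    moreover have "p \<in> {(x, y). y = (x - x0) * m}" using that by (cases p) (simp add: mult.commute)
    ultimately show ?thesis unfolding ramp_def by blast
  qed
  have tang': "snd (\<beta> p) = m * fst (\<beta> p)" if "p \<in> ramp L x0 \<gamma>" for p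
  proof -
    have "cos \<gamma> * (m * fst (\<beta> p) - snd (\<beta> p)) = 0"
      using tang[OF that] by (simp add: inner_prod_def tan_eq[symmetric] algebra_simps)
    then show ?thesis using cos_pos by simp
  qed
  have hyp_ramp: "p \<in> ramp L x0 \<gamma>" if "p \<in> hyp" for p
    using ramp hyp_line[OF that] face_subset(1)[OF E fl(3)] that by blast
  have f_nz: "fst (\<beta> p) \<noteq> 0" if "p \<in> hyp" for p
    using nonzero[OF hyp_ramp[OF that]] tang'[OF hyp_ramp[OF that]] by (auto simp: prod_eq_iff)
  have corners: "(a, ya) \<in> hyp" "(X, c) \<in> hyp" "(a, ya) \<in> left" "(X, c) \<in> top"
    by (simp_all add: hyp_def left_def top_def)
  \<comment> \<open>Intermediate value argument: the first component of \<open>\<beta>\<close> maps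
    the hypotenuse onto an interval that avoids 0.\<close>
  have "connected ((\<lambda>p. fst (\<beta> p)) ` hyp)"
    using continuous_on_subset[OF cont_beta face_subset(2)[OF E fl(3)]]
    by (intro connected_continuous_image continuous_intros) (simp_all add: hyp_def)
  then have itv: "is_interval ((\<lambda>p. fst (\<beta> p)) ` hyp)" by (simp add: is_interval_connected_1)
  have same: "0 < fst (\<beta> p) \<longleftrightarrow> 0 < fst (\<beta> q)" if "p \<in> hyp" "q \<in> hyp" for p q
  proof -
    have "\<not> (fst (\<beta> p) \<le> 0 \<and> 0 \<le> fst (\<beta> q))" if pq: "p \<in> hyp" "q \<in> hyp" for p q
    proof
      assume "fst (\<beta> p) \<le> 0 \<and> 0 \<le> fst (\<beta> q)"
      then have "0 \<in> (\<lambda>p. fst (\<beta> p)) ` hyp"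
        using itv[unfolded is_interval_1, rule_format, of "fst (\<beta> p)" "fst (\<beta> q)" 0] pq by blast
      then obtain r where "r \<in> hyp" "fst (\<beta> r) = 0" by auto
      then show False using f_nz by blast
    qed
    from this[of p q] this[of q p] show ?thesis using that by linarith
  qed
  have n_snd: "snd (\<beta> (X, c)) = m * fst (\<beta> (X, c))" using tang' hyp_ramp corners by blast
  have no_hyp: "\<not> inflow \<beta> E hyp" "\<not> outflow \<beta> E hyp"
  proof -
    obtain p where p: "p \<in> rel_interior hyp" using rel_interior_face(2)[OF E fl(3)] by blast
    then have "\<beta> p \<bullet> outer_normal E hyp = 0"
      using tang[OF hyp_ramp] rel_interior_subset unfolding n_hyp by blast
    then show "\<not> inflow \<beta> E hyp" "\<not> outflow \<beta> E hyp" using p unfolding inflow_def outflow_def by force+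
  qed
  \<comment> \<open>The ramp has height at least 0 at \<open>x = a\<close>, so \<open>a\<close> is
    at least \<open>x0\<close> and thus positive: there is a column of cells to the left, and the
    left edge is interior.\<close>
  obtain E1 where E1: "E1 \<in> mesh'" "E1 \<noteq> E" "left \<in> faces E1"
  proof -
    have "0 \<le> b" using h by (simp add: b_def)
    then have "x0 \<le> a" using bl mono[of x0 a] by simp
    then have "0 < a" using x0 by simp
    then have "i \<noteq> 0" by (cases "i = 0") (simp_all add: a_def)
    then obtain k where k: "i = Suc k" using not0_implies_Suc by blast
    define a0 where "a0 = real k * h"
    have a0: "a = a0 + h" by (simp add: a_def a0_def k algebra_simps)
    have "cut_cell k j \<noteq> {}"
    proof (rule cut_cell_nonempty[of k a j c])
      show "real k * h \<le> a" "a \<le> real (Suc k) * h" using a0 h by (simp_all add: a0_def a_def k)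
      show "real j * h \<le> c" "c \<le> real (Suc j) * h" using ac h by (simp_all add: b_def c_def)
    qed (rule tl)
    note ne' = this
    define F1 where "F1 = cut_cell k j"
    have cl': "closure F1 = {(x, y). a0 \<le> x \<and> x \<le> a \<and> b \<le> y \<and> y \<le> c \<and> m * (x - x0) \<le> y}"
      unfolding F1_def closure_cut_cell[OF ne'] abc a0_def k by (rule refl)
    have mem: "F1 \<in> mesh'" unfolding F1_def using ne' ij k mesh_iff by (metis Suc_lessD)
    have "(closure F1 \<inter> {p. (1, 0) \<bullet> p = a}) edge_of closure F1"
      by (rule edge_of_supportingI[OF convex_closure[OF mesh_cell(2)[OF mem]], where p = "(a, ya)" and q = "(a, c)"])
        (use ya h a0 bl ac in \<open>auto simp: cl' zero_prod_def ya_def\<close>)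
    \<comment> \<open>The ramp cuts both neighbours at the same point \<open>(a, ya)\<close> of
      their common grid line, so they share the whole edge and not just a part of it.\<close>
    moreover have "closure F1 \<inter> {p. (1, 0) \<bullet> p = a} = left"
      unfolding cl' left ya_def using bl h a0 by auto
    moreover have "F1 \<noteq> E" unfolding F1_def using cut_cell_inj[OF _ ne'] ij(3) k by (metis n_not_Suc_n)
    ultimately show ?thesis using that mem by (simp add: faces_def)
  qed
  \<comment> \<open>The top edge is below the upper side of the square because the ramp leaves the
    square through its right side (\<open>ramp_right\<close>), and it is at least as high as
    \<open>c\<close> in this column.\<close>
  obtain E2 where E2: "E2 \<in> mesh'" "E2 \<noteq> E" "top \<in> faces E2"
  proof -
    have "Suc i \<le> N" using ij by simp
    then have "a' \<le> L" using h unfolding a'_def LN by (intro mult_right_mono) auto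
    then have "m * (a' - x0) \<le> m * (L - x0)" using mono by simp
    then have "c < L" using tr ramp_right by (simp add: mult.commute)
    then have "Suc j < N" using h unfolding c_def LN by (simp only: mult_less_cancel_right_pos of_nat_less_iff)
    define c' where "c' = real (Suc (Suc j)) * h"
    have c': "c' = c + h" by (simp add: c_def c'_def algebra_simps)
    have "cut_cell i (Suc j) \<noteq> {}"
    proof (rule cut_cell_nonempty[of i a "Suc j" c])
      show "real i * h \<le> a" "a \<le> real (Suc i) * h" using h by (simp_all add: a_def)
      show "real (Suc j) * h \<le> c" "c \<le> real (Suc (Suc j)) * h" using h by (simp_all add: c_def)
    qed (rule tl)
    note ne' = this
    define F2 where "F2 = cut_cell i (Suc j)"
    have cl': "closure F2 = {(x, y). a \<le> x \<and> x \<le> a' \<and> c \<le> y \<and> y \<le> c' \<and> m * (x - x0) \<le> y}"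
      unfolding F2_def closure_cut_cell[OF ne'] abc c'_def by (rule refl)
    have mem: "F2 \<in> mesh'" unfolding F2_def using ne' ij \<open>Suc j < N\<close> mesh_iff by metis
    have "(closure F2 \<inter> {p. (0, -1) \<bullet> p = - c}) edge_of closure F2"
      by (rule edge_of_supportingI[OF convex_closure[OF mesh_cell(2)[OF mem]], where p = "(a, c)" and q = "(X, c)"])
        (use aX Xa' h c' ac tl X in \<open>auto simp: cl' zero_prod_def\<close>)
    moreover have "closure F2 \<inter> {p. (0, -1) \<bullet> p = - c} = top"
    proof -
      have "(x, y) \<in> closure F2 \<inter> {p. (0, -1) \<bullet> p = - c} \<longleftrightarrow> (x, y) \<in> top" for x y
      proof (cases "y = c")
        case True
        have "x \<le> a' \<and> m * (x - x0) \<le> c \<longleftrightarrow> x \<le> X" using mX[of x] Xa' by linarith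
        then show ?thesis unfolding cl' top True using h c' by auto
      qed (simp add: top)
      then show ?thesis by (intro set_eqI) (metis surj_pair)
    qed
    moreover have "F2 \<noteq> E" unfolding F2_def using cut_cell_inj[OF _ ne'] ij(3) by (metis n_not_Suc_n)
    ultimately show ?thesis using that mem by (simp add: faces_def)
  qed
  obtain C where "C-lipschitz_on (closure E) \<beta>" using lip clO lipschitz_on_subset by blast
  then have lipE: "C-lipschitz_on {(x, y). a \<le> x \<and> y \<le> c \<and> m * (x - x0) \<le> y} \<beta>" by (simp only: cl)
  have green: "(LINT y|lborel. indicator {ya..c} y * fst (\<beta> (a, y))) =
      (LINT x|lborel. indicator {a..X} x * snd (\<beta> (x, c)))"
    unfolding ya_def X_def
  proof (rule divergence_theorem_triangle[OF m_pos tl lipE])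
    have "interior {(x, y). a \<le> x \<and> y \<le> c \<and> m * (x - x0) \<le> y} = E"
      using interior_closure_cell[OF E] by (simp only: cl)
    then show "AE p in lborel. p \<in> interior {(x, y). a \<le> x \<and> y \<le> c \<and> m * (x - x0) \<le> y} \<longrightarrow>
        (\<exists>D. (\<beta> has_derivative D) (at p) \<and> (\<Sum>b\<in>Basis. D b \<bullet> b) = 0)"
      using div mesh_cell(4)[OF E] unfolding divergence_free_on_def by (auto elim!: eventually_mono)
    show "snd (\<beta> (x, m * (x - x0))) = m * fst (\<beta> (x, m * (x - x0)))" if "x \<in> {a..x0 + c / m}" for x
      using that mX[of x] by (intro tang' ramp) (auto simp: cl X_def)
  qed
  \<comment> \<open>\<open>\<sigma>\<close> is 1 or -1, according to the direction in which the flow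
    crosses the cell; it removes the absolute values from both fluxes at once.\<close>
  have flux: "?flux left = ?flux top"
    if \<sigma>: "\<And>p. p \<in> left \<Longrightarrow> \<bar>fst (\<beta> p)\<bar> = \<sigma> * fst (\<beta> p)" "\<And>p. p \<in> top \<Longrightarrow> \<bar>snd (\<beta> p)\<bar> = \<sigma> * snd (\<beta> p)" for \<sigma>
  proof -
    have "?flux left = (LINT p|arclength left. \<sigma> * fst (\<beta> p))"
      using \<sigma>(1) by (intro Bochner_Integration.integral_cong)
        (simp_all add: left_def space_arclength flux_weight_def n_left[unfolded left_def] inner_prod_def)
    also have "\<dots> = \<sigma> * (LINT y|lborel. indicator {ya..c} y * fst (\<beta> (a, y)))"
      unfolding integral_mult_right_zero left_def
      using continuous_on_subset[OF cont_beta face_subset(2)[OF E fl(1)]]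
      by (subst arclength_integral_vertical[OF ya]) (auto simp: left_def intro!: continuous_intros)
    also have "\<dots> = (LINT p|arclength top. \<sigma> * snd (\<beta> p))"
      unfolding integral_mult_right_zero top_def green
      using continuous_on_subset[OF cont_beta face_subset(2)[OF E fl(2)]]
      by (subst arclength_integral_horizontal[OF aX]) (auto simp: top_def intro!: continuous_intros)
    also have "\<dots> = ?flux top"
      using \<sigma>(2) by (intro Bochner_Integration.integral_cong)
        (simp_all add: top_def space_arclength flux_weight_def n_top[unfolded top_def] inner_prod_def)
    finally show ?thesis .
  qed
  \<comment> \<open>On both edges the trace is \<open>c0\<close> almost everywhere, so the two means
    are \<open>c0\<close> times the flux over the flux. As the fluxes agree these are the same
    quotient, and a zero flux needs no separate case.\<close>
  have mean: "wmean \<beta> w E left = wmean \<beta> w E top"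
    if w: "w \<in> V0s" and fl_eq: "?flux left = ?flux top" for w
  proof -
    obtain c0 where c0: "AE p in lebesgue_on E. w p = c0" using w E unfolding V0_def by blast
    have wL2: "w \<in> L2 (lebesgue_on E)"
    proof (rule L2_lebesgue_on_subset[OF _ mesh_cell(4)[OF E]])
      show "w \<in> L2 (lebesgue_on \<Omega>')" using w unfolding V0_def by blast
      show "E \<in> sets lebesgue" "\<Omega>' \<in> sets lebesgue" using mesh_cell(1)[OF E] open_Omega by simp_all
    qed
    have bdE: "bounded E" by (rule bounded_subset[OF polytope_imp_bounded[OF polytope_closure_cell[OF E]] closure_subset])
    have opE: "open E" using mesh_cell[OF E] by blast
    have wt: "(LINT p|arclength e. flux_weight \<beta> E e p * trace E e w p) = c0 * ?flux e"
      if e: "e \<in> faces E" "e = closed_segment a' b'" and ae: "\<And>g. is_trace E e w g \<Longrightarrow> AE p in arclength e. g p = c0" for e a' b'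
    proof -
      have "is_trace E e w (\<lambda>p. c0)" unfolding e(2) using opE by (intro is_trace_const wL2 c0) auto
      then have tr: "is_trace E e w (trace E e w)" unfolding trace_def by (rule someI[of "is_trace E e w"])
      then have m1: "trace E e w \<in> borel_measurable (arclength e)" by (auto simp: is_trace_def L2_def)
      have "continuous_on e (flux_weight \<beta> E e)" unfolding flux_weight_def by (intro continuous_intros cont_flux[OF E e(1)])
      then have m2: "flux_weight \<beta> E e \<in> borel_measurable (arclength e)"
        unfolding e(2) by (rule continuous_on_imp_measurable_arclength)
      have "(LINT p|arclength e. flux_weight \<beta> E e p * trace E e w p) = (LINT p|arclength e. c0 * flux_weight \<beta> E e p)"
        by (rule integral_cong_AE) (use m1 m2 ae[OF tr] in \<open>auto elim!: eventually_mono\<close>)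
      then show ?thesis by simp
    qed
    have wl: "(LINT p|arclength left. flux_weight \<beta> E left p * trace E left w p) = c0 * ?flux left"
    proof (rule wt[OF fl(1) left_def])
      fix g assume g: "is_trace E left w g"
      show "AE p in arclength left. g p = c0" unfolding left_def
      \<comment> \<open>With slope \<open>1 / m\<close> the wedge is bounded by the hypotenuse
        itself. For the top edge below, the matching slope is \<open>m\<close>.\<close>
      proof (rule trace_of_constant_vertical[OF g[unfolded left_def] ya opE bdE c0, of "1 / m"])
        fix x y assume xy: "ya < y" "y < c" "a < x" "x < a + 1 / m * (y - ya)"
        have "m * x < m * (a + 1 / m * (y - ya))" using xy(4) m_pos by simp
        also have "\<dots> = m * a + (y - ya)" using m_pos by (simp add: distrib_left)
        finally have "m * (x - x0) < y" by (simp add: ya_def algebra_simps)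
        then show "(x, y) \<in> E" using xy unfolding Eset by simp
      qed (use m_pos in simp)
    qed
    have wtp: "(LINT p|arclength top. flux_weight \<beta> E top p * trace E top w p) = c0 * ?flux top"
    proof (rule wt[OF fl(2) top_def])
      fix g assume g: "is_trace E top w g"
      show "AE p in arclength top. g p = c0" unfolding top_def
      proof (rule trace_of_constant_horizontal[OF g[unfolded top_def] aX opE bdE c0 m_pos])
        fix x y assume xy: "a < x" "x < X" "c - m * (X - x) < y" "y < c"
        have "m * (x - x0) = c - m * (X - x)" unfolding X[symmetric] by (simp add: algebra_simps)
        then show "(x, y) \<in> E" using xy unfolding Eset by simp
      qed
    qed
    show ?thesis unfolding wmean_def wl wtp fl_eq ..
  qed
  have fcA: "fst (\<beta> (a, ya)) \<noteq> 0" using f_nz corners by blast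
  show ?thesis
  proof (cases "0 < fst (\<beta> (a, ya))")
    case True
    then have "0 < snd (\<beta> (X, c))" using same[OF corners(1,2)] n_snd m_pos by simp
    then have o: "outflow \<beta> E top" using corners(4) n_top by (intro outflowI[OF E fl(2)]) (auto simp: inner_prod_def)
    have i: "inflow \<beta> E left" using True corners(3) n_left by (intro inflowI[OF E fl(1)]) (auto simp: inner_prod_def)
    have "\<bar>fst (\<beta> p)\<bar> = 1 * fst (\<beta> p)" if "p \<in> left" for p
      using inflow_le[OF E fl(1) i that] by (simp add: n_left inner_prod_def)
    moreover have "\<bar>snd (\<beta> p)\<bar> = 1 * snd (\<beta> p)" if "p \<in> top" for p
      using outflow_ge[OF E fl(2) o that] by (simp add: n_top inner_prod_def)
    ultimately have fq: "?flux left = ?flux top"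
      by (rule flux)
    have nn: "\<not> outflow \<beta> E left" "\<not> inflow \<beta> E top"
      using not_inflow_outflow[OF E fl(1) i] not_inflow_outflow[OF E fl(2)] o by auto
    have ui: "e = left" if "e \<in> faces E" "inflow \<beta> E e" for e
      using that no_hyp(1) nn(2) unfolding faces by auto
    have uo: "e = top" if "e \<in> faces E" "outflow \<beta> E e" for e
      using that no_hyp(2) nn(1) unfolding faces by auto
    show ?thesis
    proof (rule that[of left top E1 E2])
      show "outer_normal E left \<in> {(-1, 0), (0, 1)}" "outer_normal E top \<in> {(-1, 0), (0, 1)}"
        by (simp_all add: n_left n_top)
    qed (fact fl i ui o uo E1 E2 fq mean[OF _ fq])+
  next
    case False
    then have neg: "fst (\<beta> (a, ya)) < 0" using fcA by simp
    have "fst (\<beta> (X, c)) < 0" using False same[OF corners(1,2)] f_nz[OF corners(2)] by simp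
    then have "snd (\<beta> (X, c)) < 0" using n_snd m_pos by (simp add: mult_pos_neg)
    then have i: "inflow \<beta> E top" using corners(4) n_top by (intro inflowI[OF E fl(2)]) (auto simp: inner_prod_def)
    have o: "outflow \<beta> E left" using neg corners(3) n_left by (intro outflowI[OF E fl(1)]) (auto simp: inner_prod_def)
    have "\<bar>fst (\<beta> p)\<bar> = - 1 * fst (\<beta> p)" if "p \<in> left" for p
      using outflow_ge[OF E fl(1) o that] by (simp add: n_left inner_prod_def)
    moreover have "\<bar>snd (\<beta> p)\<bar> = - 1 * snd (\<beta> p)" if "p \<in> top" for p
      using inflow_le[OF E fl(2) i that] by (simp add: n_top inner_prod_def)
    ultimately have fq: "?flux left = ?flux top"
      by (rule flux)
    have nn: "\<not> outflow \<beta> E top" "\<not> inflow \<beta> E left"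
      using not_inflow_outflow[OF E fl(2) i] not_inflow_outflow[OF E fl(1)] o by auto
    have ui: "e = top" if "e \<in> faces E" "inflow \<beta> E e" for e
      using that no_hyp(1) nn(2) unfolding faces by auto
    have uo: "e = left" if "e \<in> faces E" "outflow \<beta> E e" for e
      using that no_hyp(2) nn(1) unfolding faces by auto
    show ?thesis
    proof (rule that[of top left E2 E1])
      show "outer_normal E left \<in> {(-1, 0), (0, 1)}" "outer_normal E top \<in> {(-1, 0), (0, 1)}"
        by (simp_all add: n_left n_top)
    qed (fact fl i ui o uo E1 E2 fq[symmetric] mean[OF _ fq, symmetric])+
  qed
qed

end

section \<open>Boundedness of the bilinear form\<close>

lemma sum_sqrt_mult_le:
  fixes x y :: "'i \<Rightarrow> real"
  assumes "\<And>i. i \<in> A \<Longrightarrow> 0 \<le> x i" "\<And>i. i \<in> A \<Longrightarrow> 0 \<le> y i"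
  shows "(\<Sum>i\<in>A. sqrt (x i) * sqrt (y i)) \<le> sqrt (\<Sum>i\<in>A. x i) * sqrt (\<Sum>i\<in>A. y i)"
proof -
  have "(\<Sum>i\<in>A. sqrt (x i) * sqrt (y i)) \<le> (\<Sum>i\<in>A. \<bar>sqrt (x i)\<bar> * \<bar>sqrt (y i)\<bar>)"
    by (intro sum_mono) (simp add: abs_mult[symmetric])
  also have "\<dots> \<le> L2_set (\<lambda>i. sqrt (x i)) A * L2_set (\<lambda>i. sqrt (y i)) A" by (rule L2_set_mult_ineq)
  also have "\<dots> = sqrt (\<Sum>i\<in>A. x i) * sqrt (\<Sum>i\<in>A. y i)"
    using assms by (simp add: L2_set_def cong: sum.cong)
  finally show ?thesis .
qed

lemma sqrt_mult_add_le:
  assumes "0 \<le> a" "0 \<le> b" "0 \<le> c" "0 \<le> (d :: real)"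
  shows "sqrt a * sqrt b + sqrt c * sqrt d \<le> sqrt (a + c) * sqrt (b + d)"
  using sum_sqrt_mult_le[of "UNIV :: bool set" "\<lambda>i. if i then a else c" "\<lambda>i. if i then b else d"] assms
  by (simp add: UNIV_bool add.commute)

text \<open>The Cauchy-Schwarz inequality for three products with weights \<open>\<alpha>\<close>,
  \<open>\<alpha>\<close>, \<open>1 - \<alpha>\<close>. As \<open>a\<close> occurs in the first and
  the third, its weights add up to 1.\<close>

lemma weighted_cauchy_schwarz:
  fixes a b p q r \<alpha> W :: real
  assumes \<alpha>: "0 \<le> \<alpha>" "\<alpha> \<le> 1" and W: "0 \<le> W"
  shows "\<bar>W * (\<alpha> * a * p + \<alpha> * b * q + (1 - \<alpha>) * a * r)\<bar> \<le>
    sqrt (W * a\<^sup>2 + \<alpha> * (W * b\<^sup>2)) * sqrt (\<alpha> * (W * p\<^sup>2 + W * q\<^sup>2) + (1 - \<alpha>) * (W * r\<^sup>2))"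
proof -
  \<comment> \<open>Lagrange's identity; the three squares are the remainder, one for each pair of
    products.\<close>
  have "(\<alpha> * a * p + \<alpha> * b * q + (1 - \<alpha>) * a * r)\<^sup>2 +
      (\<alpha>\<^sup>2 * (a * q - b * p)\<^sup>2 + \<alpha> * (1 - \<alpha>) * (a * r - a * p)\<^sup>2 + \<alpha> * (1 - \<alpha>) * (b * r - a * q)\<^sup>2)
      = (a\<^sup>2 + \<alpha> * b\<^sup>2) * (\<alpha> * (p\<^sup>2 + q\<^sup>2) + (1 - \<alpha>) * r\<^sup>2)"
    by algebra
  moreover have "0 \<le> \<alpha>\<^sup>2 * (a * q - b * p)\<^sup>2 + \<alpha> * (1 - \<alpha>) * (a * r - a * p)\<^sup>2 + \<alpha> * (1 - \<alpha>) * (b * r - a * q)\<^sup>2"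
    using \<alpha> by (intro add_nonneg_nonneg mult_nonneg_nonneg) auto
  ultimately have "(\<alpha> * a * p + \<alpha> * b * q + (1 - \<alpha>) * a * r)\<^sup>2 \<le>
      (a\<^sup>2 + \<alpha> * b\<^sup>2) * (\<alpha> * (p\<^sup>2 + q\<^sup>2) + (1 - \<alpha>) * r\<^sup>2)" by linarith
  then have "W\<^sup>2 * (\<alpha> * a * p + \<alpha> * b * q + (1 - \<alpha>) * a * r)\<^sup>2 \<le>
      W\<^sup>2 * ((a\<^sup>2 + \<alpha> * b\<^sup>2) * (\<alpha> * (p\<^sup>2 + q\<^sup>2) + (1 - \<alpha>) * r\<^sup>2))"
    by (rule mult_left_mono) simp
  also have "\<dots> = (W * a\<^sup>2 + \<alpha> * (W * b\<^sup>2)) * (\<alpha> * (W * p\<^sup>2 + W * q\<^sup>2) + (1 - \<alpha>) * (W * r\<^sup>2))"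
    by algebra
  finally have "(W * (\<alpha> * a * p + \<alpha> * b * q + (1 - \<alpha>) * a * r))\<^sup>2 \<le> \<dots>"
    by (simp only: power_mult_distrib)
  then show ?thesis
    unfolding real_sqrt_mult[symmetric] real_sqrt_abs[symmetric] by (rule real_sqrt_le_mono)
qed

context ramp_mesh begin

abbreviation "weight e \<equiv> (LINT p|arclength e. face_weight L x0 \<gamma> h \<beta> e p)"
abbreviation "upw \<equiv> upwind L x0 \<gamma> h \<beta>"
abbreviation "capac \<equiv> capacity L x0 \<gamma> h \<beta> \<tau>"
abbreviation "nbr \<equiv> neighbor L x0 \<gamma> h"
abbreviation "faces_all \<equiv> all_faces L x0 \<gamma> h"
abbreviation "faces_no \<equiv> faces_not_out L x0 \<gamma> h \<beta>"
abbreviation "faces_nio \<equiv> faces_not_in_out L x0 \<gamma> h \<beta>"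
abbreviation "m_in \<equiv> mean_in L x0 \<gamma> h \<beta>"
abbreviation "m_out \<equiv> mean_out L x0 \<gamma> h \<beta>"

section \<open>Capacities, upwind cells, and the faces of stabilized cells\<close>

lemma weight_nonneg: "0 \<le> weight e"
  by (simp add: face_weight_def flux_weight_def)

lemma weight_eq: "\<lbrakk>E \<in> mesh'; e \<in> faces E\<rbrakk> \<Longrightarrow> weight e = (LINT p|arclength e. flux_weight \<beta> E e p)"
  by (simp add: face_weight_eq)

text \<open>The quotient in \<open>capacity\<close> is nonnegative, also for a vanishing flux, where
  it is 0 by \<open>x / 0 = 0\<close>.\<close>

lemma capacity_bounds: "0 \<le> capac E" "capac E \<le> 1"
  using h \<tau> weight_nonneg by (auto simp: capacity_def)

lemma all_faces_cell: "e \<in> faces_all \<Longrightarrow> \<exists>E\<in>mesh'. e \<in> faces E"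
  by (auto simp: all_faces_def interior_faces_def boundary_faces_def)

lemma finite_all_faces: "finite faces_all"
proof (rule finite_subset)
  show "faces_all \<subseteq> (\<Union>E\<in>mesh'. faces E)" using all_faces_cell by blast
qed (use finite_mesh finite_faces in auto)

lemma outflow_unique:
  assumes "E \<in> mesh'" "e \<in> faces E" "outflow \<beta> E e" "E' \<in> mesh'" "e \<in> faces E'" "outflow \<beta> E' e"
  shows "E' = E"
proof (rule ccontr)
  assume "E' \<noteq> E"
  then have "outer_normal E' e = - outer_normal E e" using assms by (intro outer_normal_opposite) auto
  moreover obtain p where "p \<in> rel_interior e" using rel_interior_face(2)[OF assms(1,2)] by blast
  ultimately show False using assms(3,6) unfolding outflow_def by force
qed

lemma upwind_eq:
  assumes "E \<in> mesh'" "e \<in> faces E" "outflow \<beta> E e"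
  shows "upw v e = wmean \<beta> v E e"
proof -
  have mem: "E \<in> cells_at e" using assms by (simp add: face_cells_def)
  have the: "(THE E. E \<in> cells_at e \<and> outflow \<beta> E e) = E"
  proof (rule the_equality)
    show "E \<in> cells_at e \<and> outflow \<beta> E e" using mem assms(3) ..
    show "E' = E" if "E' \<in> cells_at e \<and> outflow \<beta> E' e" for E'
      by (rule outflow_unique[OF assms]) (use that in \<open>simp_all add: face_cells_def\<close>)
  qed
  have ex: "\<exists>E\<in>cells_at e. outflow \<beta> E e" using mem assms(3) ..
  show ?thesis unfolding upwind_def if_P[OF ex] the ..
qed

lemma neighbor_eq:
  assumes "E \<in> mesh'" "e \<in> faces E" "E' \<in> mesh'" "E' \<noteq> E" "e \<in> faces E'"
  shows "nbr E e = E'"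
  unfolding neighbor_def
proof (rule the_equality)
  fix E'' assume "E'' \<in> mesh' \<and> E'' \<noteq> E \<and> e \<in> faces E''"
  then have "E'' \<in> cells_at e" "E'' \<noteq> E" by (auto simp: face_cells_def)
  then show "E'' = E'" using face_cells_eq[OF assms(1,3,4,2,5)] by simp
qed (use assms in auto)

text \<open>Transfers \<open>triangular_cell_flow\<close> to \<open>e_in\<close>,
  \<open>e_out\<close> and \<open>neighbor\<close>, whose \<open>THE\<close> descriptions are
  resolved by the uniqueness stated there.\<close>

lemma stabilized_cell:
  assumes "E \<in> stab"
  shows "E \<in> mesh'" "e_in \<beta> E \<in> faces E" "inflow \<beta> E (e_in \<beta> E)" "e_out \<beta> E \<in> faces E" "outflow \<beta> E (e_out \<beta> E)"
    "\<And>e. e \<in> faces E \<Longrightarrow> outflow \<beta> E e \<Longrightarrow> e = e_out \<beta> E"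
    "outer_normal E (e_in \<beta> E) \<in> {(-1, 0), (0, 1)}" "outer_normal E (e_out \<beta> E) \<in> {(-1, 0), (0, 1)}"
    "nbr E (e_in \<beta> E) \<in> mesh'" "nbr E (e_in \<beta> E) \<noteq> E" "e_in \<beta> E \<in> faces (nbr E (e_in \<beta> E))"
    "nbr E (e_out \<beta> E) \<in> mesh'" "nbr E (e_out \<beta> E) \<noteq> E" "e_out \<beta> E \<in> faces (nbr E (e_out \<beta> E))"
    "weight (e_in \<beta> E) = weight (e_out \<beta> E)"
    "\<And>w. w \<in> V0s \<Longrightarrow> wmean \<beta> w E (e_in \<beta> E) = wmean \<beta> w E (e_out \<beta> E)"
proof -
  have E: "E \<in> mesh'" "2 simplex closure E" using assms by (auto simp: stabilized_cells_def)
  obtain ei eo E1 E2 where ei: "ei \<in> faces E" "inflow \<beta> E ei" "\<And>e. e \<in> faces E \<Longrightarrow> inflow \<beta> E e \<Longrightarrow> e = ei"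
    and eo: "eo \<in> faces E" "outflow \<beta> E eo" "\<And>e. e \<in> faces E \<Longrightarrow> outflow \<beta> E e \<Longrightarrow> e = eo"
    and n: "outer_normal E ei \<in> {(-1, 0), (0, 1)}" "outer_normal E eo \<in> {(-1, 0), (0, 1)}"
    and nb: "E1 \<in> mesh'" "E1 \<noteq> E" "ei \<in> faces E1" "E2 \<in> mesh'" "E2 \<noteq> E" "eo \<in> faces E2"
    and fl: "(LINT p|arclength ei. flux_weight \<beta> E ei p) = (LINT p|arclength eo. flux_weight \<beta> E eo p)"
    and wm: "\<And>w. w \<in> V0s \<Longrightarrow> wmean \<beta> w E ei = wmean \<beta> w E eo"
    by (rule triangular_cell_flow[OF E], rule that) assumption+
  have i: "e_in \<beta> E = ei" unfolding e_in_def
    by (rule the_equality, rule conjI, rule ei(1), rule ei(2), erule conjE, rule ei(3))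
  have o: "e_out \<beta> E = eo" unfolding e_out_def
    by (rule the_equality, rule conjI, rule eo(1), rule eo(2), erule conjE, rule eo(3))
  have N: "nbr E ei = E1" "nbr E eo = E2"
    by (rule neighbor_eq[OF E(1) ei(1) nb(1,2,3)], rule neighbor_eq[OF E(1) eo(1) nb(4,5,6)])
  show "E \<in> mesh'" by (rule E(1))
  show "e_in \<beta> E \<in> faces E" "inflow \<beta> E (e_in \<beta> E)" "e_out \<beta> E \<in> faces E" "outflow \<beta> E (e_out \<beta> E)"
    unfolding i o by (fact ei(1), fact ei(2), fact eo(1), fact eo(2))
  show "e = e_out \<beta> E" if "e \<in> faces E" "outflow \<beta> E e" for e unfolding o by (rule eo(3)[OF that])
  show "outer_normal E (e_in \<beta> E) \<in> {(-1, 0), (0, 1)}" "outer_normal E (e_out \<beta> E) \<in> {(-1, 0), (0, 1)}"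
    unfolding i o by (fact n)+
  show "nbr E (e_in \<beta> E) \<in> mesh'" "nbr E (e_in \<beta> E) \<noteq> E" "e_in \<beta> E \<in> faces (nbr E (e_in \<beta> E))"
    "nbr E (e_out \<beta> E) \<in> mesh'" "nbr E (e_out \<beta> E) \<noteq> E" "e_out \<beta> E \<in> faces (nbr E (e_out \<beta> E))"
    unfolding i o N by (fact nb)+
  show "weight (e_in \<beta> E) = weight (e_out \<beta> E)"
    unfolding i o weight_eq[OF E(1) ei(1)] weight_eq[OF E(1) eo(1)] by (rule fl)
  show "wmean \<beta> w E (e_in \<beta> E) = wmean \<beta> w E (e_out \<beta> E)" if "w \<in> V0s" for w
    unfolding i o by (rule wm[OF that])
qed

text \<open>Across a shared face the normals are opposite, so the flow cannot enter both
  cells.\<close>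

lemma e_in_inj: "inj_on (e_in \<beta>) stab"
proof (rule inj_onI, rule ccontr)
  fix E E' assume a: "E \<in> stab" "E' \<in> stab" "e_in \<beta> E = e_in \<beta> E'" "E \<noteq> E'"
  let ?e = "e_in \<beta> E"
  have f: "?e \<in> faces E" "inflow \<beta> E ?e" "?e \<in> faces E'" "inflow \<beta> E' ?e"
    using stabilized_cell(2,3)[OF a(1)] stabilized_cell(2,3)[OF a(2)] a(3) by auto
  have "outer_normal E' ?e = - outer_normal E ?e"
    using stabilized_cell(1)[OF a(1)] stabilized_cell(1)[OF a(2)] a(4) f by (intro outer_normal_opposite) auto
  moreover obtain p where "p \<in> rel_interior ?e"
    using rel_interior_face(2)[OF stabilized_cell(1,2)[OF a(1)]] by blast
  ultimately show False using f(2,4) unfolding inflow_def by force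
qed

text \<open>A face shared by two stabilized cells would have opposite normals, but both normals come
  from the set of (-1, 0) and (0, 1), which contains no opposite pair. This keeps the cell upwind of
  a stabilized cell unstabilized.\<close>

lemma e_in_out_disjoint: "e_in \<beta> ` stab \<inter> e_out \<beta> ` stab = {}"
proof (rule ccontr)
  assume "\<not> ?thesis"
  then obtain E E' where a: "E \<in> stab" "E' \<in> stab" "e_in \<beta> E = e_out \<beta> E'" by auto
  let ?e = "e_in \<beta> E"
  note s = stabilized_cell[OF a(1)] and s' = stabilized_cell[OF a(2), folded a(3)]
  show False
  proof (cases "E = E'")
    case True
    then show False using not_inflow_outflow[OF s(1,2,3)] s'(5) by simp
  next
    case False
    then have "outer_normal E' ?e = - outer_normal E ?e"
      using s(1,2) s'(1,4) by (intro outer_normal_opposite) auto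
    then show False using s(7) s'(8) by auto
  qed
qed

lemma e_in_all:
  assumes "E \<in> stab" shows "e_in \<beta> E \<in> faces_all"
  using stabilized_cell(1,2,9,10,11)[OF assms] unfolding all_faces_def interior_faces_def by blast

text \<open>Inflow faces of stabilized cells are interior faces and, by
  \<open>e_in_out_disjoint\<close>, are not removed as outflow faces. They can therefore be split
  off and joined to the outflow terms of their cells.\<close>

lemma faces_not_out_eq: "faces_no = faces_nio \<union> e_in \<beta> ` stab" "faces_nio \<inter> e_in \<beta> ` stab = {}"
  using e_in_out_disjoint e_in_all unfolding faces_not_out_def faces_not_in_out_def by auto

lemma finite_stab: "finite stab"
  by (rule finite_subset[OF _ finite_mesh]) (auto simp: stabilized_cells_def)

text \<open>The jump is a multiple of the unit normal, so the integrand is a constant times the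
  normal flow, and its integral is at most that constant in absolute value times the flux.\<close>

lemma jump_term_bound:
  assumes "e \<in> faces_all"
  shows "\<bar>LINT p|arclength e. k * (\<beta> p \<bullet> jmp w e)\<bar> \<le> sqrt (weight e * k\<^sup>2) * sqrt (weight e * (jmp w e \<bullet> jmp w e))"
proof -
  obtain E where E: "E \<in> mesh'" "e \<in> faces E" using all_faces_cell[OF assms] by blast
  obtain d where d: "jmp w e = d *\<^sub>R outer_normal E e" using jump_parallel[OF E] by blast
  have n: "outer_normal E e \<bullet> outer_normal E e = 1" using face_cases[OF E] by (metis norm_eq_1)
  have "(LINT p|arclength e. k * (\<beta> p \<bullet> jmp w e)) = (k * d) * (LINT p|arclength e. \<beta> p \<bullet> outer_normal E e)"
    unfolding d integral_mult_right_zero[symmetric] by (simp add: mult.assoc)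
  also have "\<bar>\<dots>\<bar> \<le> \<bar>k * d\<bar> * weight e"
    unfolding abs_mult[of "k * d"] weight_eq[OF E] flux_weight_def
    by (intro mult_left_mono integral_abs_bound) simp
  also have "\<dots> = sqrt (weight e * k\<^sup>2) * sqrt (weight e * d\<^sup>2)"
    using weight_nonneg[of e] by (simp add: real_sqrt_mult abs_mult)
  also have "d\<^sup>2 = jmp w e \<bullet> jmp w e" unfolding d using n by (simp add: power2_eq_square)
  finally show ?thesis .
qed

text \<open>On inflow and outflow faces the sign of the flow is known, so the face term is an exact
  expression in the flux. Equalities are needed here: the two face terms of a cell must be combined
  before anything is estimated.\<close>

lemma jump_term_interior:
  assumes "E \<in> mesh'" "E' \<in> mesh'" "E' \<noteq> E" "e \<in> faces E" "e \<in> faces E'"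
  shows "inflow \<beta> E e \<Longrightarrow> (LINT p|arclength e. k * (\<beta> p \<bullet> jmp w e)) =
      weight e * (k * (wmean \<beta> w E' e - wmean \<beta> w E e))"
    and "outflow \<beta> E e \<Longrightarrow> (LINT p|arclength e. k * (\<beta> p \<bullet> jmp w e)) =
      weight e * (k * (wmean \<beta> w E e - wmean \<beta> w E' e))"
    and "jmp w e \<bullet> jmp w e = (wmean \<beta> w E e - wmean \<beta> w E' e)\<^sup>2"
proof -
  note j = jump_interior[OF assms, of w]
  have n: "outer_normal E e \<bullet> outer_normal E e = 1" using face_cases[OF assms(1,4)] by (metis norm_eq_1)
  then show "jmp w e \<bullet> jmp w e = (wmean \<beta> w E e - wmean \<beta> w E' e)\<^sup>2"
    unfolding j by (simp add: power2_eq_square)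
  obtain a b where ab: "e = closed_segment a b" using face_cases[OF assms(1,4)] by metis
  have sp: "space (arclength e) = e" unfolding ab by (rule space_arclength)
  show "(LINT p|arclength e. k * (\<beta> p \<bullet> jmp w e)) =
      weight e * (k * (wmean \<beta> w E' e - wmean \<beta> w E e))" if "inflow \<beta> E e"
  proof -
    have "(LINT p|arclength e. k * (\<beta> p \<bullet> jmp w e)) =
        (LINT p|arclength e. flux_weight \<beta> E e p * (k * (wmean \<beta> w E' e - wmean \<beta> w E e)))"
      using inflow_le[OF assms(1,4) that] unfolding j
      by (intro Bochner_Integration.integral_cong) (simp_all add: sp flux_weight_def algebra_simps)
    then show ?thesis unfolding weight_eq[OF assms(1,4)] by simp
  qed
  show "(LINT p|arclength e. k * (\<beta> p \<bullet> jmp w e)) =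
      weight e * (k * (wmean \<beta> w E e - wmean \<beta> w E' e))" if "outflow \<beta> E e"
  proof -
    have "(LINT p|arclength e. k * (\<beta> p \<bullet> jmp w e)) =
        (LINT p|arclength e. flux_weight \<beta> E e p * (k * (wmean \<beta> w E e - wmean \<beta> w E' e)))"
      using outflow_ge[OF assms(1,4) that] unfolding j
      by (intro Bochner_Integration.integral_cong) (simp_all add: sp flux_weight_def algebra_simps)
    then show ?thesis unfolding weight_eq[OF assms(1,4)] by simp
  qed
qed

lemma boundary_norm_sq_eq:
  assumes "E \<in> mesh'"
  shows "boundary_norm_sq \<beta> v E = (\<Sum>e\<in>faces E. weight e * (wmean \<beta> v E e)\<^sup>2)"
  unfolding boundary_norm_sq_def
proof (rule sum.cong[OF refl])
  fix e assume "e \<in> faces E"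
  then show "(LINT p|arclength e. (sqrt (flux_weight \<beta> E e p) * wmean \<beta> v E e)\<^sup>2) = weight e * (wmean \<beta> v E e)\<^sup>2"
    by (simp add: weight_eq[OF assms] power_mult_distrib flux_weight_def)
qed

text \<open>Each face is charged to the pair of its upwind cell and itself, which is injective
  because of the second component. The upwind cell cannot be stabilized, since the face would then
  be its outflow face, and those have been removed.\<close>

lemma upwind_sum_le:
  "(\<Sum>e\<in>faces_no. weight e * (upw v e)\<^sup>2) \<le> (\<Sum>E\<in>mesh' - stab. boundary_norm_sq \<beta> v E)"
proof -
  define up where "up e = (SOME E. E \<in> mesh' \<and> e \<in> faces E \<and> outflow \<beta> E e)" for e
  define A where "A = {e \<in> faces_no. \<exists>E. E \<in> mesh' \<and> e \<in> faces E \<and> outflow \<beta> E e}"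
  have fin: "finite faces_no" by (rule finite_subset[OF _ finite_all_faces]) (auto simp: faces_not_out_def)
  have up: "up e \<in> mesh'" "e \<in> faces (up e)" "outflow \<beta> (up e) e" if "e \<in> A" for e
    using that someI_ex[of "\<lambda>E. E \<in> mesh' \<and> e \<in> faces E \<and> outflow \<beta> E e"] by (auto simp: A_def up_def)
  have up_notin: "up e \<notin> stab" if "e \<in> A" for e
  proof
    assume "up e \<in> stab"
    then have "e \<in> e_out \<beta> ` stab" using stabilized_cell(6) up[OF that] by blast
    then show False using that by (simp add: A_def faces_not_out_def)
  qed
  define t where "t = (\<lambda>(E, e). weight e * (wmean \<beta> v E e)\<^sup>2)"
  have t0: "0 \<le> t x" for x using weight_nonneg by (simp add: t_def split: prod.split)
  \<comment> \<open>Faces without an upwind cell, such as inflow boundary faces or faces with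
    vanishing normal flow, have upwind value 0 by definition.\<close>
  have "(\<Sum>e\<in>faces_no. weight e * (upw v e)\<^sup>2) = (\<Sum>e\<in>A. weight e * (upw v e)\<^sup>2)"
  proof (rule sum.mono_neutral_right[OF fin])
    show "\<forall>e\<in>faces_no - A. weight e * (upw v e)\<^sup>2 = 0"
      by (auto simp: A_def upwind_def face_cells_def)
  qed (auto simp: A_def)
  also have "\<dots> = (\<Sum>e\<in>A. t (up e, e))"
    by (intro sum.cong refl) (simp add: t_def upwind_eq[OF up(1) up(2) up(3)])
  also have "\<dots> = sum t ((\<lambda>e. (up e, e)) ` A)"
    by (subst sum.reindex) (auto simp: inj_on_def)
  also have "\<dots> \<le> sum t (SIGMA E:mesh' - stab. faces E)"
    using finite_mesh finite_faces up up_notin t0 by (intro sum_mono2 finite_SigmaI) auto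
  also have "\<dots> = (\<Sum>E\<in>mesh' - stab. \<Sum>e\<in>faces E. weight e * (wmean \<beta> v E e)\<^sup>2)"
    unfolding t_def using finite_mesh finite_faces by (subst sum.Sigma[symmetric]) auto
  also have "\<dots> = (\<Sum>E\<in>mesh' - stab. boundary_norm_sq \<beta> v E)"
    by (intro sum.cong) (auto simp: boundary_norm_sq_eq)
  finally show ?thesis .
qed

lemma a_DoD_bound:
  assumes w: "w \<in> V0s"
  shows "\<bar>a_DoD L x0 \<gamma> h \<beta> \<tau> v w\<bar> \<le> starnrm v * seminrm w"
proof -
  define t where "t e = (LINT p|arclength e. upw v e * (\<beta> p \<bullet> jmp w e))" for e
  define s where "s E = (LINT p|arclength (e_out \<beta> E).
        (capac E * upw v (e_out \<beta> E) + (1 - capac E) * m_in v E) * (\<beta> p \<bullet> jmp w (e_out \<beta> E)))" for E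
  define x where "x e = weight e * (upw v e)\<^sup>2" for e
  define y where "y e = weight e * (jmp w e \<bullet> jmp w e)" for e
  define vE where "vE E = wmean \<beta> v E (e_out \<beta> E)" for E
  \<comment> \<open>The inflow value keeps the full weight 1, being used with
    \<open>\<alpha>\<close> on the inflow face and with \<open>1 - \<alpha>\<close> in the extended
    outflow term; the value of the cell itself has weight \<open>\<alpha>\<close>, as in the
    norm.\<close>
  define X where "X E = x (e_in \<beta> E) + capac E * (weight (e_out \<beta> E) * (vE E)\<^sup>2)" for E
  define Y where "Y E = capac E * (y (e_in \<beta> E) + y (e_out \<beta> E)) +
    (1 - capac E) * (weight (e_out \<beta> E) * (m_out w E - m_in w E)\<^sup>2)" for E
  have x0': "0 \<le> x e" and y0: "0 \<le> y e" for e using weight_nonneg by (auto simp: x_def y_def)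
  have X0: "0 \<le> X E" and Y0: "0 \<le> Y E" for E
    using x0' y0 weight_nonneg capacity_bounds[of E] by (auto simp: X_def Y_def)
  have fin: "finite faces_nio" "finite stab"
    using finite_all_faces finite_stab by (auto simp: faces_not_in_out_def)
  have split: "sum f faces_no = sum f faces_nio + (\<Sum>E\<in>stab. f (e_in \<beta> E))" for f :: "(real \<times> real) set \<Rightarrow> real"
    unfolding faces_not_out_eq(1) using fin faces_not_out_eq(2) e_in_inj
    by (subst sum.union_disjoint) (auto simp: sum.reindex)
  have cell: "\<bar>t (e_in \<beta> E) + s E\<bar> \<le> sqrt (X E) * sqrt (Y E)" if E: "E \<in> stab" for E
  proof -
    note c = stabilized_cell[OF E]
    define ei eo N1 N2 where "ei = e_in \<beta> E" and "eo = e_out \<beta> E" and "N1 = nbr E ei" and "N2 = nbr E eo"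
    note c = c[folded ei_def eo_def, folded N1_def N2_def]
    note ji = jump_term_interior[OF c(1) c(9,10) c(2) c(11)]
    note jo = jump_term_interior[OF c(1) c(12,13) c(4) c(14)]
    define W a b where "W = weight eo" and "a = m_in v E" and "b = vE E"
    \<comment> \<open>The flow entering the cell leaves its inflow neighbour, so the upwind value on
      the inflow face is the mean that \<open>mean_in\<close> denotes.\<close>
    have N1out: "outflow \<beta> N1 ei"
    proof -
      have "outer_normal N1 ei = - outer_normal E ei"
        using c(10) by (intro outer_normal_opposite[OF c(1) c(9) _ c(2) c(11)]) auto
      then show ?thesis using c(3) by (simp add: inflow_def outflow_def)
    qed
    have a: "upw v ei = a" unfolding upwind_eq[OF c(9,11) N1out] a_def mean_in_def ei_def[symmetric] N1_def[symmetric] ..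
    have b: "upw v eo = b" unfolding upwind_eq[OF c(1,4,5)] b_def vE_def eo_def[symmetric] ..
    define wE wi wo where "wE = wmean \<beta> w E eo" and "wi = m_in w E" and "wo = m_out w E"
    have wE: "wmean \<beta> w E ei = wE" unfolding wE_def by (rule c(16)[OF w])
    have wi: "wmean \<beta> w N1 ei = wi" by (simp add: wi_def mean_in_def ei_def[symmetric] N1_def[symmetric])
    have wo: "wmean \<beta> w N2 eo = wo" by (simp add: wo_def mean_out_def eo_def[symmetric] N2_def[symmetric])
    have "t ei = W * (a * (wi - wE))"
      unfolding t_def a ji(1)[OF c(3)] wE wi c(15) W_def ..
    moreover have "s E = W * ((capac E * b + (1 - capac E) * a) * (wE - wo))"
      unfolding s_def eo_def[symmetric] b a_def[symmetric] jo(2)[OF c(5)] wo wE_def[symmetric] W_def ..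
    \<comment> \<open>Splitting \<open>a\<close> in the first term into its shares
      \<open>\<alpha>\<close> and \<open>1 - \<alpha>\<close> lets the second share telescope with
      the outflow term to \<open>wi - wo\<close>.\<close>
    ultimately have "t ei + s E = W * (capac E * a * (wi - wE) + capac E * b * (wE - wo) + (1 - capac E) * a * (wi - wo))"
      by (simp add: algebra_simps)
    also have "\<bar>\<dots>\<bar> \<le> sqrt (W * a\<^sup>2 + capac E * (W * b\<^sup>2)) *
        sqrt (capac E * (W * (wi - wE)\<^sup>2 + W * (wE - wo)\<^sup>2) + (1 - capac E) * (W * (wi - wo)\<^sup>2))"
      using capacity_bounds weight_nonneg by (intro weighted_cauchy_schwarz) (auto simp: W_def)
    also have "W * a\<^sup>2 + capac E * (W * b\<^sup>2) = X E"
      unfolding X_def x_def ei_def[symmetric] eo_def[symmetric] a b_def[symmetric] c(15) W_def ..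
    also have "capac E * (W * (wi - wE)\<^sup>2 + W * (wE - wo)\<^sup>2) + (1 - capac E) * (W * (wi - wo)\<^sup>2) = Y E"
      unfolding Y_def y_def ei_def[symmetric] eo_def[symmetric] ji(3) jo(3) c(15) wE wi wo
        wE_def[symmetric] wi_def[symmetric] wo_def[symmetric] W_def
      by (simp add: power2_commute)
    finally show ?thesis by (simp add: ei_def)
  qed
  have bs: "sqrt (sum y faces_nio + sum Y stab) = seminrm w"
  proof -
    \<comment> \<open>The seminorm sums over the set of both faces, which has two summands only
      because they are distinct.\<close>
    have "e_in \<beta> E \<noteq> e_out \<beta> E" if "E \<in> stab" for E using e_in_out_disjoint that by blast
    then have "sum Y stab = (\<Sum>E\<in>stab. capac E * (\<Sum>e\<in>{e_in \<beta> E, e_out \<beta> E}. LINT p|arclength e.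
          face_weight L x0 \<gamma> h \<beta> e p * (jmp w e \<bullet> jmp w e)) +
        (1 - capac E) * (LINT p|arclength (e_out \<beta> E). face_weight L x0 \<gamma> h \<beta> (e_out \<beta> E) p * (m_out w E - m_in w E)\<^sup>2))"
      by (intro sum.cong) (simp_all add: Y_def y_def)
    then show ?thesis unfolding beta_seminorm_def y_def by simp
  qed
  have "a_DoD L x0 \<gamma> h \<beta> \<tau> v w = sum t faces_no + sum s stab"
    unfolding a_DoD_def t_def s_def ..
  also have "\<dots> = sum t faces_nio + (\<Sum>E\<in>stab. t (e_in \<beta> E) + s E)"
    by (simp add: split sum.distrib)
  also have "\<bar>\<dots>\<bar> \<le> (\<Sum>e\<in>faces_nio. \<bar>t e\<bar>) + (\<Sum>E\<in>stab. \<bar>t (e_in \<beta> E) + s E\<bar>)"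
    by (intro order_trans[OF abs_triangle_ineq] add_mono sum_abs)
  also have "\<dots> \<le> (\<Sum>e\<in>faces_nio. sqrt (x e) * sqrt (y e)) + (\<Sum>E\<in>stab. sqrt (X E) * sqrt (Y E))"
  proof (intro add_mono sum_mono cell)
    fix e assume "e \<in> faces_nio"
    then show "\<bar>t e\<bar> \<le> sqrt (x e) * sqrt (y e)"
      unfolding t_def x_def y_def by (intro jump_term_bound) (simp add: faces_not_in_out_def)
  qed
  also have "\<dots> \<le> sqrt (sum x faces_nio) * sqrt (sum y faces_nio) + sqrt (sum X stab) * sqrt (sum Y stab)"
    by (intro add_mono sum_sqrt_mult_le x0' y0 X0 Y0)
  also have "\<dots> \<le> sqrt (sum x faces_nio + sum X stab) * sqrt (sum y faces_nio + sum Y stab)"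
    by (intro sqrt_mult_add_le sum_nonneg x0' y0 X0 Y0)
  also have "sqrt (sum y faces_nio + sum Y stab) = seminrm w" by (rule bs)
  also have "sqrt (sum x faces_nio + sum X stab) * seminrm w \<le>
      starnrm v * seminrm w"
  proof (rule mult_right_mono)
    \<comment> \<open>The inflow parts of \<open>X\<close> rejoin the other faces, so that the
      upwind sum is estimated in one piece; the outflow parts go to the boundary terms of the
      stabilized cells.\<close>
    have "sum x faces_nio + sum X stab = sum x faces_no + (\<Sum>E\<in>stab. capac E * (weight (e_out \<beta> E) * (vE E)\<^sup>2))"
      by (simp add: split X_def sum.distrib)
    also have "sum x faces_no \<le> (\<Sum>E\<in>mesh' - stab. boundary_norm_sq \<beta> v E)"
      unfolding x_def by (rule upwind_sum_le)
    also have "(\<Sum>E\<in>stab. capac E * (weight (e_out \<beta> E) * (vE E)\<^sup>2)) \<le> (\<Sum>E\<in>stab. capac E * boundary_norm_sq \<beta> v E)"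
    proof (intro sum_mono mult_left_mono capacity_bounds)
      fix E assume "E \<in> stab"
      note c = stabilized_cell[OF this]
      show "weight (e_out \<beta> E) * (vE E)\<^sup>2 \<le> boundary_norm_sq \<beta> v E"
        unfolding boundary_norm_sq_eq[OF c(1)] vE_def
        using member_le_sum[OF c(4), of "\<lambda>e. weight e * (wmean \<beta> v E e)\<^sup>2"] finite_faces[OF c(1)] weight_nonneg by simp
    qed
    finally have le: "sum x faces_nio + sum X stab \<le>
        (\<Sum>E\<in>mesh' - stab. boundary_norm_sq \<beta> v E) + (\<Sum>E\<in>stab. capac E * boundary_norm_sq \<beta> v E)"
      by simp
    have "0 \<le> (LINT p|lebesgue_on \<Omega>'. (v p)\<^sup>2)" "0 \<le> (seminrm v)\<^sup>2" by simp_all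
    with le show "sqrt (sum x faces_nio + sum X stab) \<le> starnrm v"
      unfolding uwb_star_norm_def by (intro real_sqrt_le_mono) linarith
    show "0 \<le> seminrm w"
      unfolding bs[symmetric] by (intro real_sqrt_ge_zero add_nonneg_nonneg sum_nonneg y0 Y0)
  qed
  finally show ?thesis .
qed

end

theorem lemma4p5:
  fixes L x0 \<gamma> h \<tau> :: real and N :: nat
    and \<beta> :: "real \<times> real \<Rightarrow> real \<times> real"
    and v w :: "real \<times> real \<Rightarrow> real"
  assumes "0 < L" and "0 < x0" and "x0 < L"
    and "0 < \<gamma>" and "\<gamma> < pi / 2" and "(L - x0) * tan \<gamma> < L"
    and "0 < h" and "L = real N * h"
    and "0 < \<tau>"
    and "\<exists>C. C-lipschitz_on (closure (\<Omega> L x0 \<gamma>)) \<beta>"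
    and "divergence_free_on (\<Omega> L x0 \<gamma>) \<beta>"
    and "\<forall>p \<in> ramp L x0 \<gamma>. \<beta> p \<bullet> (sin \<gamma>, - cos \<gamma>) = 0"
    and "\<forall>p \<in> ramp L x0 \<gamma>. \<beta> p \<noteq> 0"
    and "constant_sign_on_faces L x0 \<gamma> h \<beta>"
    and "v \<in> V_star L x0 \<gamma> h" and "w \<in> V0 L x0 \<gamma> h"
  shows "\<bar>a_DoD L x0 \<gamma> h \<beta> \<tau> v w\<bar>
           \<le> uwb_star_norm L x0 \<gamma> h \<beta> \<tau> v * beta_seminorm L x0 \<gamma> h \<beta> \<tau> w"
proof -
  interpret ramp_mesh L x0 \<gamma> h \<tau> N \<beta> by unfold_locales (use assms in auto)
  show ?thesis by (rule a_DoD_bound[OF assms(16)])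
qed

end
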